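(* For every expansion proof $\mathcal{Q}$ there is a cut-free expansion proof $\mathcal{Q}^*$ (i.e. one whose sequence of cuts is empty) such that $\mathcal{Q}\rightarrow\mathcal{Q}^*$ and $\mathrm{Sh}(\mathcal{Q})=\mathrm{Sh}(\mathcal{Q}^* )$. Here $\rightarrow$ is the reflexive, transitive closure of the cut-reduction relation $\mapsto$ defined in the context.
   Context: **Formulas.** Classical first-order logic; all formulas are in negation normal form and without vacuous quantifiers. $\overline{A}$ is the de Morgan dual of $A$. A literal is an atom $P(t_1,\ldots,t_n)$ or a negated atom $\overline{P}(t_1,\ldots,t_n)$. $A[t/x]$ is substitution of $t$ for $x$ in $A$. **Expansion trees and shallow formula $\mathrm{Sh}$**, defined inductively: (1) a literal $L$ is an expansion tree with $\mathrm{Sh}(L)=L$; (2) if $E_1,E_2$ are expansion trees and $\circ\in\{\land,\lor\}$, then $E_1\circ E_2$ is an expansion tree with $\mathrm{Sh}(E_1\circ E_2)=\mathrm{Sh}(E_1)\circ\mathrm{Sh}(E_2)$; (3) if $t_1,\ldots,t_n$ is a sequence of terms and $E_1,\ldots,E_n$ are expansion trees with $\mathrm{Sh}(E_i)=A[t_i/x]$ for all $i$, then $E=\exists x\,A+^{t_1}E_1\cdots+^{t_n}E_n$ is an expansion tree with $\mathrm{Sh}(E)=\exists x\,A$; (4) if $E_0$ is an expansion tree with $\mathrm{Sh}(E_0)=A[\alpha/x]$, $\alpha$ a variable, then $E=\forall x\,A+^{\alpha}E_0$ is an expansion tree with $\mathrm{Sh}(E)=\forall x\,A$. The $+^{t_i}$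 in (3) are $\exists$-expansions, the $+^\alpha$ in (4) are $\forall$-expansions with eigenvariable $\alpha$; both are called expansions. $+^{t_i}$ dominates all expansions in $E_i$; $+^\alpha$ dominates all expansions in $E_0$. **Deep formula $\mathrm{Dp}$:** $\mathrm{Dp}(L)=L$, $\mathrm{Dp}(E_1\circ E_2)=\mathrm{Dp}(E_1)\circ\mathrm{Dp}(E_2)$, $\mathrm{Dp}(\exists x\,A+^{t_1}E_1\cdots+^{t_n}E_n)=\bigvee_{i=1}^n\mathrm{Dp}(E_i)$, $\mathrm{Dp}(\forall x\,A+^\alpha E_0)=\mathrm{Dp}(E_0)$. **Cuts.** A cut is a set $C=\{E_1,E_2\}$ of two expansion trees with $\mathrm{Sh}(E_1)=\overline{\mathrm{Sh}(E_2)}$. A formula is positive if it is a positive literal or its top connective is $\lor$ or $\exists$. Writing $C=(E_1,E_2)$ with $\mathrm{Sh}(E_1)$ positive, set $\mathrm{Sh}(C)=\mathrm{Sh}(E_1)$ (the cut formula) and $\mathrm{Dp}(C)=\mathrm{Dp}(E_1)\land\mathrm{Dp}(E_2)$. **Branches $\mathrm{Br}$.** A finite set of lists of formulas and integers $1,2$: $\mathrm{Br}(L)=\{L\}$; $\mathrm{Br}(E_1\circ E_2)=\{(\mathrm{Sh}(E_1\circ E_2),i,s)\mid i\in\{1,2\},\ s\in\mathrm{Br}(E_i)\}$; $\mathrm{Br}(\exists x\,A+^{t_1}E_1\cdots+^{t_n}E_n)=\{(\exists x\,A,s)\mid s\in\mathrm{Br}(E_i),\ 1\le i\le n\}$; $\mathrm{Br}(\forall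 x\,A+^\alpha E_0)=\{(\forall x\,A,s)\mid s\in\mathrm{Br}(E_0)\}$; for a cut, $\mathrm{Br}(\{E_1,E_2\})=\mathrm{Br}(E_1)\cup\mathrm{Br}(E_2)$. Commas denote concatenation of lists. **Dependency relation.** Let $\mathcal{P}=\mathcal{C},\mathcal{E}$ with $\mathcal{C}$ a finite sequence of cuts and $\mathcal{E}$ a finite sequence of expansion trees (lists of expansion trees and cuts are identified modulo permutation of their elements). On occurrences of expansions and cuts in $\mathcal{P}$, $<^0$ is the least relation with: (1) $v<^0w$ if $w$ is an $\exists$-expansion whose term contains the eigenvariable of the $\forall$-expansion $v$; (2) $v<^0w$ if the expansion $v$ dominates the expansion $w$; (3) $C<^0v$ if $v$ is an expansion of the cut $C$ in $\mathcal{C}$; (4) $v<^0C$ if $C$ is a cut and $\mathrm{Sh}(C)$ contains the eigenvariable of the $\forall$-expansion $v$. $<_{\mathcal{P}}$ is the transitive closure of $<^0$. **Expansion proofs.** $\mathrm{Sh}(\mathcal{P})=\mathrm{Sh}(\mathcal{E})$ is the sequence of the $\mathrm{Sh}$ of the trees in $\mathcal{E}$; $\mathrm{Dp}(\mathcal{P})=\mathrm{Dp}(\mathcal{E}),\mathrm{Dp}(\mathcal{C})$ is the sequent (read disjunctively) of the deep formulas of all trees and cuts. $\mathcal{P}$ is an expansion proof if: (1) (weak regularity) for all $S,T$ in $\mathcal{P}$, if $(s,\forall x A,A[\alpha/x],s')\in\mathrm{Br}(T)$ and $(r,\forall x B,B[\alpha/x],r')\in\mathrm{Br}(S)$, then $s=r$,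 $A=B$, and $S,T$ are both trees or both cuts; (2) (acyclicity) $x<_{\mathcal{P}}x$ for no $x$; (3) (validity) $\mathrm{Dp}(\mathcal{P})$ is a propositional tautology; (4) (eigenvariable condition) for every $\forall$-expansion $+^\alpha$ in $\mathcal{P}$, $\alpha$ does not occur in $\mathrm{Sh}(\mathcal{E})$. **Substitutions.** $e\sigma$ is the result of simultaneously replacing each variable $x$ in the domain of $\sigma$ by $\sigma(x)$ in the expression $e$ (including eigenvariables of $\forall$-expansions); $\sigma$ may be applied to an expansion tree $E$ only if $\sigma(\alpha)$ is a variable for each $\forall$-expansion $+^\alpha$ of $E$. **Cut-reduction steps $\mapsto$ (relating expansion proofs).** *Quantifier step.* Let $\mathcal{P}_1$ be $$\{\exists x\,A+^{t_1}E_1\cdots+^{t_n}E_n,\ \forall x\,\overline{A}+^{\alpha_1}F_1\},\ldots,\{\exists x\,A+^{t_p}E_p\cdots+^{t_l}E_l,\ \forall x\,\overline{A}+^{\alpha_q}F_q\},\ \mathcal{P}$$ ($q$ displayed cuts, all with cut formula $\exists x A$; the existential expansions of all of them are listed consecutively with indices $1,\ldots,l$). Then $\mathcal{P}_1\mapsto$ $$\{E_1,F_1\eta_1\sigma_1\},\ldots,\{E_1,F_q\eta_1\sigma_1\},\ldots,\{E_l,F_1\eta_l\sigma_l\},\ldots,\{E_l,F_q\eta_l\sigma_l\},\ \mathcal{P},\ \mathcal{P}\eta_1\sigma_1,\ldots,\mathcal{P}\eta_l\sigma_l,$$ where $\sigma_i=[t_i/\alpha_1,\ldots,t_i/\alpha_q]$;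 the $\forall$-expansions $+^{\alpha_1},\ldots,+^{\alpha_q}$ do not occur in $\mathcal{P}$; no cut in $\mathcal{P}$ has shallow formula $\exists x A$; and $\eta_1,\ldots,\eta_l$ are renamings to fresh variables of the eigenvariables $\beta$ of $\mathcal{P},F_1,\ldots,F_q$ such that for some $1\le i\le q$ and some occurrence of $+^{\alpha_i}$ one has $+^{\alpha_i}<_{\mathcal{P}_1}+^\beta$. *Propositional step.* $\{E_1\lor F_1,E_1'\land F_1'\},\ldots,\{E_m\lor F_m,E_m'\land F_m'\},\mathcal{P}\ \mapsto\ \{E_1,E_1'\},\{F_1,F_1'\},\ldots,\{E_m,E_m'\},\{F_m,F_m'\},\mathcal{P}$, where $\mathrm{Sh}(E_1\lor F_1)=\cdots=\mathrm{Sh}(E_m\lor F_m)$ and every cut $C$ in $\mathcal{P}$ has $\mathrm{Sh}(C)\ne\mathrm{Sh}(E_1\lor F_1)$. *Atomic step.* $\{A,\overline{A}\},\mathcal{P}\mapsto\mathcal{P}$ for an atom $A$.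
   Formalization: Sh(Q) = Sh(Q* ) is proved as equality of the sets of shallow formulas, since the quantifier step duplicates trees and equality of sequences modulo permutation fails; existential nodes are taken with n ≥ 1, since an empty disjunction is not a formula. *)

theory Defs
  imports "HOL-Library.Multiset"
begin

text \<open>
  First-order terms and formulas in de Bruijn representation, so that formulas are taken modulo
  renaming of bound variables and substitution is capture avoiding.  Below \<open>k\<close> quantifiers,
  index \<open>n < k\<close> is bound and index \<open>k + n\<close> denotes the free variable \<open>n\<close>.
  Eigenvariables are free variables.
\<close>

datatype 'f tm = Var nat | Fun 'f "'f tm list"

datatype ('f, 'p) fm =
    Lit bool 'p "'f tm list"  \<comment> \<open>\<open>True\<close>: atom, \<open>False\<close>: negated atom\<close>
  | And "('f, 'p) fm" "('f, 'p) fm"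
  | Or "('f, 'p) fm" "('f, 'p) fm"
  | Ex "('f, 'p) fm"
  | All "('f, 'p) fm"

primrec fv_tm :: "'f tm \<Rightarrow> nat set" where
  "fv_tm (Var x) = {x}"
| "fv_tm (Fun f ts) = \<Union> (set (map fv_tm ts))"

primrec fv_fm :: "('f, 'p) fm \<Rightarrow> nat set" where
  "fv_fm (Lit b p ts) = \<Union> (set (map fv_tm ts))"
| "fv_fm (And A B) = fv_fm A \<union> fv_fm B"
| "fv_fm (Or A B) = fv_fm A \<union> fv_fm B"
| "fv_fm (Ex A) = {x. Suc x \<in> fv_fm A}"
| "fv_fm (All A) = {x. Suc x \<in> fv_fm A}"

primrec no_vacuous :: "('f, 'p) fm \<Rightarrow> bool" where
  "no_vacuous (Lit b p ts) = True"
| "no_vacuous (And A B) = (no_vacuous A \<and> no_vacuous B)"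
| "no_vacuous (Or A B) = (no_vacuous A \<and> no_vacuous B)"
| "no_vacuous (Ex A) = (0 \<in> fv_fm A \<and> no_vacuous A)"
| "no_vacuous (All A) = (0 \<in> fv_fm A \<and> no_vacuous A)"

primrec subst_tm :: "(nat \<Rightarrow> 'f tm) \<Rightarrow> 'f tm \<Rightarrow> 'f tm" where
  "subst_tm \<sigma> (Var x) = \<sigma> x"
| "subst_tm \<sigma> (Fun f ts) = Fun f (map (subst_tm \<sigma>) ts)"

text \<open>The substitution to be applied below one more quantifier.\<close>

definition lift_subst :: "(nat \<Rightarrow> 'f tm) \<Rightarrow> nat \<Rightarrow> 'f tm" where
  "lift_subst \<sigma> = case_nat (Var 0) (\<lambda>x. subst_tm (\<lambda>y. Var (Suc y)) (\<sigma> x))"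

primrec subst_fm :: "(nat \<Rightarrow> 'f tm) \<Rightarrow> ('f, 'p) fm \<Rightarrow> ('f, 'p) fm" where
  "subst_fm \<sigma> (Lit b p ts) = Lit b p (map (subst_tm \<sigma>) ts)"
| "subst_fm \<sigma> (And A B) = And (subst_fm \<sigma> A) (subst_fm \<sigma> B)"
| "subst_fm \<sigma> (Or A B) = Or (subst_fm \<sigma> A) (subst_fm \<sigma> B)"
| "subst_fm \<sigma> (Ex A) = Ex (subst_fm (lift_subst \<sigma>) A)"
| "subst_fm \<sigma> (All A) = All (subst_fm (lift_subst \<sigma>) A)"

text \<open>\<open>inst A t\<close> is \<open>A[t/x]\<close>, where \<open>A\<close> is the body of a quantifier binding \<open>x\<close>.\<close>

definition inst :: "('f, 'p) fm \<Rightarrow> 'f tm \<Rightarrow> ('f, 'p) fm" where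
  "inst A t = subst_fm (case_nat t Var) A"

primrec dual :: "('f, 'p) fm \<Rightarrow> ('f, 'p) fm" where
  "dual (Lit b p ts) = Lit (\<not> b) p ts"
| "dual (And A B) = Or (dual A) (dual B)"
| "dual (Or A B) = And (dual A) (dual B)"
| "dual (Ex A) = All (dual A)"
| "dual (All A) = Ex (dual A)"

primrec positive :: "('f, 'p) fm \<Rightarrow> bool" where
  "positive (Lit b p ts) = b"
| "positive (And A B) = False"
| "positive (Or A B) = True"
| "positive (Ex A) = True"
| "positive (All A) = False"

section \<open>Expansion trees\<close>

text \<open>
  \<open>EEx A [(t\<^sub>1, E\<^sub>1), \<dots>, (t\<^sub>n, E\<^sub>n)]\<close> is
  \<open>\<exists>x A +\<^sup>t\<^sup>1 E\<^sub>1 \<dots> +\<^sup>t\<^sup>n E\<^sub>n\<close>, and \<open>EAll A \<alpha> E\<close> is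
  \<open>\<forall>x A +\<^sup>\<alpha> E\<close>.
\<close>

datatype ('f, 'p) tree =
    ELit bool 'p "'f tm list"
  | EAnd "('f, 'p) tree" "('f, 'p) tree"
  | EOr "('f, 'p) tree" "('f, 'p) tree"
  | EEx "('f, 'p) fm" "('f tm \<times> ('f, 'p) tree) list"
  | EAll "('f, 'p) fm" nat "('f, 'p) tree"

fun sh :: "('f, 'p) tree \<Rightarrow> ('f, 'p) fm" where
  "sh (ELit b p ts) = Lit b p ts"
| "sh (EAnd E F) = And (sh E) (sh F)"
| "sh (EOr E F) = Or (sh E) (sh F)"
| "sh (EEx A tEs) = Ex A"
| "sh (EAll A \<alpha> E) = All A"

text \<open>
  An existential node has at least one expansion.  With \<open>n = 0\<close>, the deep formula would not be
  a formula and eigenvariables above such nodes would be invisible to \<open>br\<close> below, hence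
  unconstrained by weak regularity.
\<close>

inductive expansion_tree :: "('f, 'p) tree \<Rightarrow> bool" where
  "expansion_tree (ELit b p ts)"
| "expansion_tree E \<Longrightarrow> expansion_tree F \<Longrightarrow> expansion_tree (EAnd E F)"
| "expansion_tree E \<Longrightarrow> expansion_tree F \<Longrightarrow> expansion_tree (EOr E F)"
| "no_vacuous (Ex A) \<Longrightarrow> tEs \<noteq> [] \<Longrightarrow>
   (\<And>t E. (t, E) \<in> set tEs \<Longrightarrow> expansion_tree E \<and> sh E = inst A t) \<Longrightarrow>
   expansion_tree (EEx A tEs)"
| "no_vacuous (All A) \<Longrightarrow> expansion_tree E \<Longrightarrow> sh E = inst A (Var \<alpha>) \<Longrightarrow>
   expansion_tree (EAll A \<alpha> E)"

fun big_or :: "('f, 'p) fm list \<Rightarrow> ('f, 'p) fm" where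
  "big_or [A] = A"
| "big_or (A # B # As) = Or A (big_or (B # As))"

fun dp :: "('f, 'p) tree \<Rightarrow> ('f, 'p) fm" where
  "dp (ELit b p ts) = Lit b p ts"
| "dp (EAnd E F) = And (dp E) (dp F)"
| "dp (EOr E F) = Or (dp E) (dp F)"
| "dp (EEx A tEs) = big_or (map (\<lambda>(t, E). dp E) tEs)"
| "dp (EAll A \<alpha> E) = dp E"

fun br :: "('f, 'p) tree \<Rightarrow> (('f, 'p) fm + nat) list set" where
  "br (ELit b p ts) = {[Inl (Lit b p ts)]}"
| "br (EAnd E F) = {Inl (And (sh E) (sh F)) # Inr 1 # s | s. s \<in> br E} \<union>
                   {Inl (And (sh E) (sh F)) # Inr 2 # s | s. s \<in> br F}"
| "br (EOr E F) = {Inl (Or (sh E) (sh F)) # Inr 1 # s | s. s \<in> br E} \<union>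
                  {Inl (Or (sh E) (sh F)) # Inr 2 # s | s. s \<in> br F}"
| "br (EEx A tEs) = (\<Union>(t, E)\<in>set tEs. {Inl (Ex A) # s | s. s \<in> br E})"
| "br (EAll A \<alpha> E) = {Inl (All A) # s | s. s \<in> br E}"

text \<open>
  Occurrences of expansions: the occurrence of \<open>+\<^sup>t\<^sup>i\<close> (or \<open>+\<^sup>\<alpha>\<close>) is
  identified with the position of its child tree \<open>E\<^sub>i\<close> (or \<open>E\<^sub>0\<close>), so an
  expansion dominates exactly the expansions whose positions properly extend its own.
\<close>

datatype 'f expansion = ExistsExp "'f tm" | ForallExp nat

inductive expansion_at :: "('f, 'p) tree \<Rightarrow> nat list \<Rightarrow> 'f expansion \<Rightarrow> bool" where
  "expansion_at E p e \<Longrightarrow> expansion_at (EAnd E F) (0 # p) e"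
| "expansion_at F p e \<Longrightarrow> expansion_at (EAnd E F) (1 # p) e"
| "expansion_at E p e \<Longrightarrow> expansion_at (EOr E F) (0 # p) e"
| "expansion_at F p e \<Longrightarrow> expansion_at (EOr E F) (1 # p) e"
| "i < length tEs \<Longrightarrow> tEs ! i = (t, E) \<Longrightarrow> expansion_at (EEx A tEs) [i] (ExistsExp t)"
| "i < length tEs \<Longrightarrow> tEs ! i = (t, E) \<Longrightarrow> expansion_at E p e \<Longrightarrow>
   expansion_at (EEx A tEs) (i # p) e"
| "expansion_at (EAll A \<alpha> E) [0] (ForallExp \<alpha>)"
| "expansion_at E p e \<Longrightarrow> expansion_at (EAll A \<alpha> E) (0 # p) e"

definition eigenvars :: "('f, 'p) tree \<Rightarrow> nat set" where
  "eigenvars E = {\<alpha>. \<exists>p. expansion_at E p (ForallExp \<alpha>)}"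

fun vars_tree :: "('f, 'p) tree \<Rightarrow> nat set" where
  "vars_tree (ELit b p ts) = fv_fm (Lit b p ts)"
| "vars_tree (EAnd E F) = vars_tree E \<union> vars_tree F"
| "vars_tree (EOr E F) = vars_tree E \<union> vars_tree F"
| "vars_tree (EEx A tEs) = fv_fm (Ex A) \<union> (\<Union>(t, E)\<in>set tEs. fv_tm t \<union> vars_tree E)"
| "vars_tree (EAll A \<alpha> E) = fv_fm (All A) \<union> {\<alpha>} \<union> vars_tree E"

text \<open>A substitution may be applied to a tree only if it is admissible for it.\<close>

definition admissible :: "(nat \<Rightarrow> 'f tm) \<Rightarrow> ('f, 'p) tree \<Rightarrow> bool" where
  "admissible \<sigma> E \<longleftrightarrow> (\<forall>\<alpha>\<in>eigenvars E. \<exists>\<beta>. \<sigma> \<alpha> = Var \<beta>)"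

fun subst_tree :: "(nat \<Rightarrow> 'f tm) \<Rightarrow> ('f, 'p) tree \<Rightarrow> ('f, 'p) tree" where
  "subst_tree \<sigma> (ELit b p ts) = ELit b p (map (subst_tm \<sigma>) ts)"
| "subst_tree \<sigma> (EAnd E F) = EAnd (subst_tree \<sigma> E) (subst_tree \<sigma> F)"
| "subst_tree \<sigma> (EOr E F) = EOr (subst_tree \<sigma> E) (subst_tree \<sigma> F)"
| "subst_tree \<sigma> (EEx A tEs) =
     EEx (subst_fm (lift_subst \<sigma>) A) (map (\<lambda>(t, E). (subst_tm \<sigma> t, subst_tree \<sigma> E)) tEs)"
| "subst_tree \<sigma> (EAll A \<alpha> E) =
     EAll (subst_fm (lift_subst \<sigma>) A) (THE \<beta>. \<sigma> \<alpha> = Var \<beta>) (subst_tree \<sigma> E)"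

section \<open>Cuts and expansion proofs\<close>

text \<open>
  A cut \<open>{E\<^sub>1, E\<^sub>2}\<close> is represented by the pair whose first component has the positive
  shallow formula; \<open>mk_cut\<close> puts two trees with dual shallow formulas in this order.
\<close>

type_synonym ('f, 'p) cut = "('f, 'p) tree \<times> ('f, 'p) tree"

definition is_cut :: "('f, 'p) cut \<Rightarrow> bool" where
  "is_cut C \<longleftrightarrow> expansion_tree (fst C) \<and> expansion_tree (snd C) \<and>
     sh (fst C) = dual (sh (snd C)) \<and> positive (sh (fst C))"

definition mk_cut :: "('f, 'p) tree \<Rightarrow> ('f, 'p) tree \<Rightarrow> ('f, 'p) cut" where
  "mk_cut E F = (if positive (sh E) then (E, F) else (F, E))"

definition sh_cut :: "('f, 'p) cut \<Rightarrow> ('f, 'p) fm" where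
  "sh_cut C = sh (fst C)"

definition dp_cut :: "('f, 'p) cut \<Rightarrow> ('f, 'p) fm" where
  "dp_cut C = And (dp (fst C)) (dp (snd C))"

definition br_cut :: "('f, 'p) cut \<Rightarrow> (('f, 'p) fm + nat) list set" where
  "br_cut C = br (fst C) \<union> br (snd C)"

definition eigenvars_cut :: "('f, 'p) cut \<Rightarrow> nat set" where
  "eigenvars_cut C = eigenvars (fst C) \<union> eigenvars (snd C)"

definition admissible_cut :: "(nat \<Rightarrow> 'f tm) \<Rightarrow> ('f, 'p) cut \<Rightarrow> bool" where
  "admissible_cut \<sigma> C \<longleftrightarrow> admissible \<sigma> (fst C) \<and> admissible \<sigma> (snd C)"

definition subst_cut :: "(nat \<Rightarrow> 'f tm) \<Rightarrow> ('f, 'p) cut \<Rightarrow> ('f, 'p) cut" where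
  "subst_cut \<sigma> C = (subst_tree \<sigma> (fst C), subst_tree \<sigma> (snd C))"

text \<open>
  The data \<open>\<C>, \<E>\<close> of which an expansion proof consists.  Lists are used in order to speak about
  occurrences; the reduction steps below identify lists up to permutation.
\<close>

type_synonym ('f, 'p) eproof = "('f, 'p) cut list \<times> ('f, 'p) tree list"

abbreviation cuts :: "('f, 'p) eproof \<Rightarrow> ('f, 'p) cut list" where
  "cuts P \<equiv> fst P"

abbreviation trees :: "('f, 'p) eproof \<Rightarrow> ('f, 'p) tree list" where
  "trees P \<equiv> snd P"

text \<open>
  End sequents are to be compared by \<open>set (sh_proof P)\<close>, i.e. up to permutation and contraction:
  a quantifier step with \<open>l\<close> existential expansions replaces every tree by \<open>l + 1\<close>
  trees, all with the same shallow formula, so multiplicities are not invariant.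
\<close>

definition sh_proof :: "('f, 'p) eproof \<Rightarrow> ('f, 'p) fm list" where
  "sh_proof P = map sh (trees P)"

definition dp_proof :: "('f, 'p) eproof \<Rightarrow> ('f, 'p) fm list" where
  "dp_proof P = map dp (trees P) @ map dp_cut (cuts P)"

definition eigenvars_proof :: "('f, 'p) eproof \<Rightarrow> nat set" where
  "eigenvars_proof P =
     (\<Union>C\<in>set (cuts P). eigenvars_cut C) \<union> (\<Union>E\<in>set (trees P). eigenvars E)"

definition vars_proof :: "('f, 'p) eproof \<Rightarrow> nat set" where
  "vars_proof P = (\<Union>C\<in>set (cuts P). vars_tree (fst C) \<union> vars_tree (snd C)) \<union>
     (\<Union>E\<in>set (trees P). vars_tree E)"

subsection \<open>The dependency relation\<close>

text \<open>\<open>InCut i True\<close> and \<open>InCut i False\<close> are the two sides of the \<open>i\<close>-th cut.\<close>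

datatype site = InTree nat | InCut nat bool

fun tree_at :: "('f, 'p) eproof \<Rightarrow> site \<Rightarrow> ('f, 'p) tree option" where
  "tree_at P (InTree i) = (if i < length (trees P) then Some (trees P ! i) else None)"
| "tree_at P (InCut i b) = (if i < length (cuts P)
     then Some (if b then fst (cuts P ! i) else snd (cuts P ! i)) else None)"

datatype occurrence = CutOcc nat | ExpOcc site "nat list"

definition occ_at :: "('f, 'p) eproof \<Rightarrow> site \<Rightarrow> nat list \<Rightarrow> 'f expansion \<Rightarrow> bool" where
  "occ_at P s p e \<longleftrightarrow> (\<exists>E. tree_at P s = Some E \<and> expansion_at E p e)"

inductive dep0 :: "('f, 'p) eproof \<Rightarrow> occurrence \<Rightarrow> occurrence \<Rightarrow> bool" for P where
  dep_term: "occ_at P s p (ForallExp \<alpha>) \<Longrightarrow> occ_at P s' p' (ExistsExp t) \<Longrightarrow> \<alpha> \<in> fv_tm t \<Longrightarrow>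
     dep0 P (ExpOcc s p) (ExpOcc s' p')"
| dep_dominates: "occ_at P s p e \<Longrightarrow> occ_at P s (p @ q) e' \<Longrightarrow> q \<noteq> [] \<Longrightarrow>
     dep0 P (ExpOcc s p) (ExpOcc s (p @ q))"
| dep_cut: "occ_at P (InCut i b) p e \<Longrightarrow> dep0 P (CutOcc i) (ExpOcc (InCut i b) p)"
| dep_cut_formula: "occ_at P s p (ForallExp \<alpha>) \<Longrightarrow> i < length (cuts P) \<Longrightarrow>
     \<alpha> \<in> fv_fm (sh_cut (cuts P ! i)) \<Longrightarrow> dep0 P (ExpOcc s p) (CutOcc i)"

definition dep :: "('f, 'p) eproof \<Rightarrow> occurrence \<Rightarrow> occurrence \<Rightarrow> bool" where
  "dep P = (dep0 P)\<^sup>+\<^sup>+"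

subsection \<open>Expansion proofs\<close>

definition members :: "('f, 'p) eproof \<Rightarrow> (('f, 'p) cut + ('f, 'p) tree) set" where
  "members P = Inl ` set (cuts P) \<union> Inr ` set (trees P)"

definition br_member :: "('f, 'p) cut + ('f, 'p) tree \<Rightarrow> (('f, 'p) fm + nat) list set" where
  "br_member = case_sum br_cut br"

definition weakly_regular :: "('f, 'p) eproof \<Rightarrow> bool" where
  "weakly_regular P \<longleftrightarrow>
     (\<forall>S\<in>members P. \<forall>T\<in>members P. \<forall>s s' r r' A B \<alpha>.
        s @ Inl (All A) # Inl (inst A (Var \<alpha>)) # s' \<in> br_member T \<longrightarrow>
        r @ Inl (All B) # Inl (inst B (Var \<alpha>)) # r' \<in> br_member S \<longrightarrow>
        s = r \<and> A = B \<and> (isl S \<longleftrightarrow> isl T))"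

text \<open>
  Propositional evaluation of deep formulas, which are quantifier free; \<open>v\<close> is an arbitrary
  valuation of the atoms.
\<close>

fun prop_eval :: "('p \<Rightarrow> 'f tm list \<Rightarrow> bool) \<Rightarrow> ('f, 'p) fm \<Rightarrow> bool" where
  "prop_eval v (Lit b p ts) = (v p ts = b)"
| "prop_eval v (And A B) = (prop_eval v A \<and> prop_eval v B)"
| "prop_eval v (Or A B) = (prop_eval v A \<or> prop_eval v B)"

definition tautology :: "('f, 'p) fm list \<Rightarrow> bool" where
  "tautology \<Gamma> \<longleftrightarrow> (\<forall>v. \<exists>A\<in>set \<Gamma>. prop_eval v A)"

definition expansion_proof :: "('f, 'p) eproof \<Rightarrow> bool" where
  "expansion_proof P \<longleftrightarrow>
     (\<forall>C\<in>set (cuts P). is_cut C) \<and> (\<forall>E\<in>set (trees P). expansion_tree E) \<and>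
     weakly_regular P \<and>
     (\<forall>x. \<not> dep P x x) \<and>
     tautology (dp_proof P) \<and>
     (\<forall>\<alpha>\<in>eigenvars_proof P. \<forall>A\<in>set (sh_proof P). \<alpha> \<notin> fv_fm A)"

section \<open>Cut reduction\<close>

text \<open>The substitution \<open>[t/\<alpha>\<^sub>1, \<dots>, t/\<alpha>\<^sub>q]\<close>.\<close>

definition subst_all :: "nat set \<Rightarrow> 'f tm \<Rightarrow> nat \<Rightarrow> 'f tm" where
  "subst_all X t = (\<lambda>x. if x \<in> X then t else Var x)"

definition var_renaming :: "(nat \<Rightarrow> nat) \<Rightarrow> nat \<Rightarrow> 'f tm" where
  "var_renaming \<eta> = (\<lambda>x. Var (\<eta> x))"

text \<open>
  \<open>\<eta>\<close> lists renamings with domain \<open>X\<close>, injective there, whose values are fresh with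
  respect to \<open>V\<close> and to each other.
\<close>

definition fresh_renamings :: "nat set \<Rightarrow> nat set \<Rightarrow> (nat \<Rightarrow> nat) list \<Rightarrow> bool" where
  "fresh_renamings V X \<eta> \<longleftrightarrow>
     (\<forall>i<length \<eta>. inj_on (\<eta> ! i) X \<and> (\<eta> ! i) ` X \<inter> V = {} \<and> (\<forall>x. x \<notin> X \<longrightarrow> (\<eta> ! i) x = x)) \<and>
     (\<forall>i<length \<eta>. \<forall>j<length \<eta>. i \<noteq> j \<longrightarrow> (\<eta> ! i) ` X \<inter> (\<eta> ! j) ` X = {})"

text \<open>Variables \<open>\<beta>\<close> with \<open>+\<^sup>\<alpha> < +\<^sup>\<beta>\<close> for some \<open>\<alpha> \<in> X\<close>.\<close>

definition dependents :: "('f, 'p) eproof \<Rightarrow> nat set \<Rightarrow> nat set" where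
  "dependents P X = {\<beta>. \<exists>\<alpha>\<in>X. \<exists>s p s' p'.
     occ_at P s p (ForallExp \<alpha>) \<and> occ_at P s' p' (ForallExp \<beta>) \<and>
     dep P (ExpOcc s p) (ExpOcc s' p')}"

text \<open>
  In the quantifier step, \<open>D\<close> lists the displayed cuts: its \<open>j\<close>-th entry
  \<open>(tEs, \<alpha>, F)\<close> stands for
  \<open>{\<exists>x A +\<^sup>t E \<dots>, \<forall>x dual A +\<^sup>\<alpha> F}\<close>, where \<open>tEs\<close> lists
  the pairs \<open>(t, E)\<close>.  The remaining part is \<open>R\<close>.
\<close>

inductive quantifier_step :: "('f, 'p) eproof \<Rightarrow> ('f, 'p) eproof \<Rightarrow> bool" where
  "quantifier_step P Q"
  if "D \<noteq> []"
    and "mset (cuts P) = mset (map (\<lambda>(tEs, \<alpha>, F). (EEx A tEs, EAll (dual A) \<alpha> F)) D @ cuts R)"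
    and "mset (trees P) = mset (trees R)"
    and "tE = concat (map (\<lambda>(tEs, \<alpha>, F). tEs) D)"
    and "X = set (map (\<lambda>(tEs, \<alpha>, F). \<alpha>) D)"
    and "Fs = map (\<lambda>(tEs, \<alpha>, F). F) D"
    and "X \<inter> eigenvars_proof R = {}"
    and "\<forall>C\<in>set (cuts R). sh_cut C \<noteq> Ex A"
    and "length \<eta> = length tE"
    and "fresh_renamings (vars_proof P)
           (dependents P X \<inter> (eigenvars_proof R \<union> (\<Union>F\<in>set Fs. eigenvars F))) \<eta>"
    and "ren = (\<lambda>i. subst_tree (var_renaming (\<eta> ! i)))"
    and "ren_cut = (\<lambda>i. subst_cut (var_renaming (\<eta> ! i)))"
    and "\<sigma> = (\<lambda>i. subst_all X (fst (tE ! i)))"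
    and "\<forall>i<length tE. (\<forall>F\<in>set Fs. admissible (\<sigma> i) (ren i F)) \<and>
           (\<forall>C\<in>set (cuts R). admissible_cut (\<sigma> i) (ren_cut i C)) \<and>
           (\<forall>E\<in>set (trees R). admissible (\<sigma> i) (ren i E))"
    and "mset (cuts Q) = mset (
           concat (map (\<lambda>i. map (\<lambda>F. mk_cut (snd (tE ! i)) (subst_tree (\<sigma> i) (ren i F))) Fs)
             [0..<length tE]) @
           cuts R @
           concat (map (\<lambda>i. map (\<lambda>C. subst_cut (\<sigma> i) (ren_cut i C)) (cuts R)) [0..<length tE]))"
    and "mset (trees Q) = mset (
           trees R @
           concat (map (\<lambda>i. map (\<lambda>E. subst_tree (\<sigma> i) (ren i E)) (trees R)) [0..<length tE]))"

inductive propositional_step :: "('f, 'p) eproof \<Rightarrow> ('f, 'p) eproof \<Rightarrow> bool" where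
  "propositional_step P Q"
  if "D \<noteq> []"
    and "mset (cuts P) = mset (map (\<lambda>(E, F, E', F'). (EOr E F, EAnd E' F')) D @ cuts R)"
    and "mset (trees P) = mset (trees R)"
    and "\<forall>(E, F, E', F')\<in>set D. sh (EOr E F) = A"
    and "\<forall>C\<in>set (cuts R). sh_cut C \<noteq> A"
    and "mset (cuts Q) =
           mset (concat (map (\<lambda>(E, F, E', F'). [mk_cut E E', mk_cut F F']) D) @ cuts R)"
    and "mset (trees Q) = mset (trees R)"

inductive atomic_step :: "('f, 'p) eproof \<Rightarrow> ('f, 'p) eproof \<Rightarrow> bool" where
  "atomic_step P Q"
  if "mset (cuts P) = mset ((ELit True p ts, ELit False p ts) # cuts Q)"
    and "mset (trees P) = mset (trees Q)"

text \<open>Cut reduction relates expansion proofs to expansion proofs.\<close>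

definition cut_reduction :: "('f, 'p) eproof \<Rightarrow> ('f, 'p) eproof \<Rightarrow> bool" where
  "cut_reduction P Q \<longleftrightarrow> expansion_proof P \<and> expansion_proof Q \<and>
     (quantifier_step P Q \<or> propositional_step P Q \<or> atomic_step P Q)"

end

theory Submission
  imports Defs
begin

text \<open>
  Cut elimination is proved by induction on the highest number of connectives in a cut formula
  and, for a fixed number, on how many distinct cut formulas attain it.  A propositional or
  quantifier step removes all cuts with one chosen formula of maximal complexity, and the cuts that
  it creates from them have smaller formulas.  The danger is the quantifier step for
  \<open>\<exists>x A\<close>, which also copies the rest of the proof under substitutions: a copy of another
  cut of maximal complexity might carry a new cut formula of the same complexity.  A copying
  substitution moves only the eigenvariables of the displayed cuts and eigenvariables that depend on
  them.  The dependency relation is acyclic, so the eigenvariables can be ranked with ranks growing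
  along dependencies.  Every variable that is moved has a rank above those of all eigenvariables in
  \<open>\<exists>x A\<close> (\<open>cut_formula_below\<close>).  So if \<open>\<exists>x A\<close> is chosen, among the cut
  formulas of maximal complexity, with the highest-ranked eigenvariables, then no moved variable
  occurs in another one of them, and the copies repeat old formulas.

  The larger part of the work is that each step leads again to an expansion proof, and it rests on a
  reformulation of weak regularity and acyclicity (\<open>expansion_proof_iff\<close>).  Call a universal
  quantifier node of a tree, together with the branch of formulas leading to it, a universal node.
  Since there are no vacuous quantifiers, every term or eigenvariable of an expansion that dominates
  the node has all its variables in the formulas of this branch.  Hence everything on which the
  \<open>\<forall>\<close>-expansion at the node depends can be read off the branch.  Weak regularity says that
  the branch, and whether it lies in a cut, is determined by the eigenvariable (\<open>coherent\<close>);
  acyclicity says that some rank function strictly increases from the eigenvariables in the branch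
  to that of the node (\<open>ranked\<close>).  Positions are then no longer needed: for each step it
  suffices to describe the universal nodes of the result as images of universal nodes of the source,
  which for the quantifier step is \<open>origin_Q\<close>.

  Validity is preserved by the quantifier step because a valuation that falsifies every copy of the
  rest can be composed with a copying substitution and still falsifies the rest.  In the original
  valuation some displayed cut must be true, which yields an index \<open>i\<close> with \<open>E\<^sub>i\<close> true;
  in the valuation composed with the \<open>i\<close>-th substitution some displayed cut must be true again,
  which yields a universal side \<open>F\<^sub>j\<close> whose \<open>i\<close>-th instance is true; together they make
  one of the new cuts true (\<open>tautology_Q\<close>).
\<close>

section \<open>Substitution in terms and formulas\<close>

lemma subst_tm_cong: "(\<And>x. x \<in> fv_tm t \<Longrightarrow> \<sigma> x = \<tau> x) \<Longrightarrow> subst_tm \<sigma> t = subst_tm \<tau> t"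
  by (induction t) auto

lemma subst_tm_comp: "subst_tm \<sigma> (subst_tm \<rho> t) = subst_tm (\<lambda>x. subst_tm \<sigma> (\<rho> x)) t"
  by (induction t) auto

lemma subst_tm_Var: "subst_tm Var t = t"
  by (induction t) (auto simp: map_idI)

lemma fv_subst_tm: "fv_tm (subst_tm \<sigma> t) = (\<Union>x\<in>fv_tm t. fv_tm (\<sigma> x))"
  by (induction t) auto

lemma subst_tm_inject: "subst_tm \<sigma> t = subst_tm \<tau> t \<Longrightarrow> x \<in> fv_tm t \<Longrightarrow> \<sigma> x = \<tau> x"
  by (induction t) auto

lemma finite_fv_tm: "finite (fv_tm t)"
  by (induction t) auto

abbreviation shift_tm :: "'f tm \<Rightarrow> 'f tm" where
  "shift_tm \<equiv> subst_tm (\<lambda>y. Var (Suc y))"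

lemma shift_tm_inject: "shift_tm s = shift_tm t \<Longrightarrow> s = t"
proof -
  assume "shift_tm s = shift_tm t"
  then have "subst_tm (\<lambda>y. Var (y - 1)) (shift_tm s) = subst_tm (\<lambda>y. Var (y - 1)) (shift_tm t)"
    by simp
  then show "s = t"
    by (simp add: subst_tm_comp subst_tm_Var)
qed

lemma lift_subst_simps [simp]:
  "lift_subst \<sigma> 0 = Var 0" "lift_subst \<sigma> (Suc x) = shift_tm (\<sigma> x)"
  by (simp_all add: lift_subst_def)

lemma lift_subst_comp:
  "(\<lambda>x. subst_tm (lift_subst \<sigma>) (lift_subst \<rho> x)) = lift_subst (\<lambda>x. subst_tm \<sigma> (\<rho> x))"
proof
  fix x
  show "subst_tm (lift_subst \<sigma>) (lift_subst \<rho> x) = lift_subst (\<lambda>x. subst_tm \<sigma> (\<rho> x)) x"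
    by (cases x) (simp_all add: subst_tm_comp)
qed

lemma lift_subst_Var: "lift_subst Var = Var"
proof
  fix x
  show "lift_subst Var x = Var x"
    by (cases x) simp_all
qed

lemma subst_fm_comp: "subst_fm \<sigma> (subst_fm \<rho> A) = subst_fm (\<lambda>x. subst_tm \<sigma> (\<rho> x)) A"
  by (induction A arbitrary: \<sigma> \<rho>) (auto simp: subst_tm_comp lift_subst_comp)

lemma lift_subst_cong: "(\<And>x. Suc x \<in> V \<Longrightarrow> \<sigma> x = \<tau> x) \<Longrightarrow> y \<in> V \<Longrightarrow> lift_subst \<sigma> y = lift_subst \<tau> y"
  by (cases y) simp_all

lemma subst_fm_cong: "(\<And>x. x \<in> fv_fm A \<Longrightarrow> \<sigma> x = \<tau> x) \<Longrightarrow> subst_fm \<sigma> A = subst_fm \<tau> A"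
proof (induction A arbitrary: \<sigma> \<tau>)
  case (Lit b p ts)
  then show ?case by (auto intro!: subst_tm_cong)
next
  case (And A B)
  then show ?case by (metis Un_iff fv_fm.simps(2) subst_fm.simps(2))
next
  case (Or A B)
  then show ?case by (metis Un_iff fv_fm.simps(3) subst_fm.simps(3))
next
  case (Ex A)
  have "subst_fm (lift_subst \<sigma>) A = subst_fm (lift_subst \<tau>) A"
    by (rule Ex.IH, rule lift_subst_cong[where V = "fv_fm A"]) (auto intro: Ex.prems)
  then show ?case by simp
next
  case (All A)
  have "subst_fm (lift_subst \<sigma>) A = subst_fm (lift_subst \<tau>) A"
    by (rule All.IH, rule lift_subst_cong[where V = "fv_fm A"]) (auto intro: All.prems)
  then show ?case by simp
qed

lemma subst_fm_Var: "subst_fm Var A = A"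
  by (induction A) (auto simp: subst_tm_Var lift_subst_Var map_idI)

lemma subst_fm_ident: "(\<And>x. x \<in> fv_fm A \<Longrightarrow> \<sigma> x = Var x) \<Longrightarrow> subst_fm \<sigma> A = A"
  using subst_fm_cong[of A \<sigma> Var] by (simp add: subst_fm_Var)

text \<open>
  A formula determines the values of a substitution on its free variables.  For non-vacuous
  \<open>A\<close> this means that \<open>A[\<alpha>/x]\<close> determines \<open>\<alpha>\<close>, so that a list of formulas on a
  branch does determine the eigenvariable.
\<close>

lemma subst_fm_inject: "subst_fm \<sigma> A = subst_fm \<tau> A \<Longrightarrow> x \<in> fv_fm A \<Longrightarrow> \<sigma> x = \<tau> x"
proof (induction A arbitrary: \<sigma> \<tau> x)
  case (Lit b p ts)
  then show ?case by (auto dest: subst_tm_inject)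
next
  case (Ex A)
  then have "lift_subst \<sigma> (Suc x) = lift_subst \<tau> (Suc x)"
    by (intro Ex.IH) simp_all
  then show ?case by (auto dest: shift_tm_inject)
next
  case (All A)
  then have "lift_subst \<sigma> (Suc x) = lift_subst \<tau> (Suc x)"
    by (intro All.IH) simp_all
  then show ?case by (auto dest: shift_tm_inject)
qed auto

lemma fv_lift_subst:
  "{x. \<exists>y\<in>V. Suc x \<in> fv_tm (lift_subst \<sigma> y)} = (\<Union>y\<in>{y. Suc y \<in> V}. fv_tm (\<sigma> y))"
proof (intro set_eqI iffI)
  fix x
  assume "x \<in> {x. \<exists>y\<in>V. Suc x \<in> fv_tm (lift_subst \<sigma> y)}"
  then obtain y where "y \<in> V" "Suc x \<in> fv_tm (lift_subst \<sigma> y)" by auto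
  then show "x \<in> (\<Union>y\<in>{y. Suc y \<in> V}. fv_tm (\<sigma> y))"
    by (cases y) (auto simp: fv_subst_tm)
next
  fix x
  assume "x \<in> (\<Union>y\<in>{y. Suc y \<in> V}. fv_tm (\<sigma> y))"
  then obtain y where "Suc y \<in> V" "x \<in> fv_tm (\<sigma> y)" by auto
  then show "x \<in> {x. \<exists>y\<in>V. Suc x \<in> fv_tm (lift_subst \<sigma> y)}"
    by (auto simp: fv_subst_tm intro!: bexI[of _ "Suc y"])
qed

lemma fv_subst_fm: "fv_fm (subst_fm \<sigma> A) = (\<Union>x\<in>fv_fm A. fv_tm (\<sigma> x))"
proof (induction A arbitrary: \<sigma>)
  case (Lit b p ts)
  then show ?case by (auto simp: fv_subst_tm)
next
  case (Ex A)
  then show ?case by (simp add: fv_lift_subst)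
next
  case (All A)
  then show ?case by (simp add: fv_lift_subst)
qed auto

lemma finite_fv_fm: "finite (fv_fm A)"
proof (induction A)
  case (Ex A)
  then show ?case using finite_vimageI[of "fv_fm A" Suc] by (simp add: vimage_def)
next
  case (All A)
  then show ?case using finite_vimageI[of "fv_fm A" Suc] by (simp add: vimage_def)
qed (auto simp: finite_fv_tm)

lemma no_vacuous_subst: "no_vacuous (subst_fm \<sigma> A) = no_vacuous A"
proof -
  have "0 \<in> fv_fm (subst_fm (lift_subst \<sigma>) A) \<longleftrightarrow> 0 \<in> fv_fm A" for \<sigma> and A :: "('a, 'b) fm"
  proof -
    have "0 \<in> fv_tm (lift_subst \<sigma> x) \<longleftrightarrow> x = 0" for x
      by (cases x) (auto simp: fv_subst_tm)
    then show ?thesis by (auto simp: fv_subst_fm)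
  qed
  then show ?thesis by (induction A arbitrary: \<sigma>) auto
qed

lemma subst_inst: "subst_fm \<sigma> (inst A t) = inst (subst_fm (lift_subst \<sigma>) A) (subst_tm \<sigma> t)"
proof -
  have "subst_tm \<sigma> (case x of 0 \<Rightarrow> t | Suc x \<Rightarrow> Var x) =
      subst_tm (case_nat (subst_tm \<sigma> t) Var) (lift_subst \<sigma> x)" for x
    by (cases x) (simp_all add: subst_tm_comp subst_tm_Var)
  then show ?thesis
    by (simp add: inst_def subst_fm_comp)
qed

text \<open>
  Non-vacuity enters here: no variable of the term of an expansion can disappear from the
  formula below that expansion.
\<close>

lemma fv_inst:
  assumes "0 \<in> fv_fm A"
  shows "fv_fm (inst A t) = fv_fm (Ex A) \<union> fv_tm t"
proof -
  have "(\<Union>x\<in>fv_fm A. fv_tm (case x of 0 \<Rightarrow> t | Suc x \<Rightarrow> Var x)) = fv_fm (Ex A) \<union> fv_tm t"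
    using assms by (fastforce split: nat.splits)
  then show ?thesis by (simp add: inst_def fv_subst_fm)
qed

lemma inst_Var_inject: "inst A (Var \<alpha>) = inst A (Var \<beta>) \<Longrightarrow> 0 \<in> fv_fm A \<Longrightarrow> \<alpha> = \<beta>"
  unfolding inst_def by (drule subst_fm_inject) auto

lemma dual_dual [simp]: "dual (dual A) = A"
  by (induction A) auto

lemma fv_dual [simp]: "fv_fm (dual A) = fv_fm A"
  by (induction A) auto

lemma subst_dual: "subst_fm \<sigma> (dual A) = dual (subst_fm \<sigma> A)"
  by (induction A arbitrary: \<sigma>) auto

lemma inst_dual: "inst (dual A) t = dual (inst A t)"
  by (simp add: inst_def subst_dual)

lemma positive_dual [simp]: "positive (dual A) = (\<not> positive A)"
  by (cases A) auto

lemma positive_subst [simp]: "positive (subst_fm \<sigma> A) = positive A"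
  by (cases A) auto

section \<open>Universal nodes of expansion trees\<close>

type_synonym ('f, 'p) branch = "(('f, 'p) fm + nat) list"

text \<open>
  A universal node is recorded as \<open>(s, A, \<alpha>)\<close>: the node \<open>\<forall>x A +\<^sup>\<alpha> E\<close> together with
  the branch \<open>s\<close> that leads to it, excluding \<open>\<forall>x A\<close>.  These are the data about which
  weak regularity speaks.
\<close>

definition below ::
  "('f, 'p) branch \<Rightarrow> (('f, 'p) branch \<times> ('f, 'p) fm \<times> nat) set \<Rightarrow>
   (('f, 'p) branch \<times> ('f, 'p) fm \<times> nat) set" where
  "below u N = (\<lambda>(s, A, \<alpha>). (u @ s, A, \<alpha>)) ` N"

fun foralls :: "('f, 'p) tree \<Rightarrow> (('f, 'p) branch \<times> ('f, 'p) fm \<times> nat) set" where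
  "foralls (ELit b p ts) = {}"
| "foralls (EAnd E F) = below [Inl (And (sh E) (sh F)), Inr 1] (foralls E) \<union>
     below [Inl (And (sh E) (sh F)), Inr 2] (foralls F)"
| "foralls (EOr E F) = below [Inl (Or (sh E) (sh F)), Inr 1] (foralls E) \<union>
     below [Inl (Or (sh E) (sh F)), Inr 2] (foralls F)"
| "foralls (EEx A tEs) = below [Inl (Ex A)] (\<Union>(t, E)\<in>set tEs. foralls E)"
| "foralls (EAll A \<alpha> E) = insert ([], A, \<alpha>) (below [Inl (All A)] (foralls E))"

text \<open>
  Existential nodes have at least one expansion, so each position in a tree lies on a complete
  branch.
\<close>

lemma br_heads: "expansion_tree E \<Longrightarrow> br E \<noteq> {} \<and> (\<forall>b\<in>br E. \<exists>s. b = Inl (sh E) # s)"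
proof (induction rule: expansion_tree.induct)
  case (4 A tEs)
  then show ?case by (cases tEs) (auto, metis equals0I)
qed auto

lemma below_iff: "(s, A, \<alpha>) \<in> below u N \<longleftrightarrow> (\<exists>s'. s = u @ s' \<and> (s', A, \<alpha>) \<in> N)"
  by (force simp: below_def)

lemma foralls_iff_br:
  "expansion_tree E \<Longrightarrow>
   (s, A, \<alpha>) \<in> foralls E \<longleftrightarrow> (\<exists>s'. s @ Inl (All A) # Inl (inst A (Var \<alpha>)) # s' \<in> br E)"
proof (induction arbitrary: s rule: expansion_tree.induct)
  case (1 b p ts)
  then show ?case by (auto simp: Cons_eq_append_conv append_eq_Cons_conv)
next
  case (2 E F)
  then show ?case
    by (auto simp: below_iff append_eq_Cons_conv Cons_eq_append_conv)
next
  case (3 E F)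
  then show ?case
    by (auto simp: below_iff append_eq_Cons_conv Cons_eq_append_conv)
next
  case (4 B tEs)
  then show ?case
    by (fastforce simp: below_iff append_eq_Cons_conv)
next
  case (5 B E \<beta>)
  obtain b where b: "Inl (sh E) # b \<in> br E"
    using br_heads[OF "5.hyps"(2)] by fastforce
  have *: "\<beta> = \<alpha>" if "Inl (inst B (Var \<alpha>)) # s' \<in> br E" for s'
    using br_heads[OF "5.hyps"(2)] that 5 inst_Var_inject[of B \<alpha> \<beta>] by auto
  show ?case
    using 5 b by (auto simp: below_iff append_eq_Cons_conv dest: *)
qed

definition branch_fv :: "('f, 'p) branch \<Rightarrow> nat set" where
  "branch_fv s = (\<Union>x\<in>set s. case_sum fv_fm (\<lambda>_. {}) x)"

lemma branch_fv_simps [simp]: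
  "branch_fv [] = {}" "branch_fv (Inl A # s) = fv_fm A \<union> branch_fv s"
  "branch_fv (Inr n # s) = branch_fv s"
  by (simp_all add: branch_fv_def)

text \<open>
  The variables visible at the universal node \<open>(s, A, \<alpha>)\<close> before \<open>\<alpha>\<close> is introduced.
\<close>

definition scope :: "('f, 'p) branch \<Rightarrow> ('f, 'p) fm \<Rightarrow> nat set" where
  "scope s A = branch_fv s \<union> fv_fm (All A)"

lemma foralls_scope_sh: "(s, A, \<alpha>) \<in> foralls E \<Longrightarrow> fv_fm (sh E) \<subseteq> scope s A"
  by (cases E) (auto simp: below_iff scope_def)

lemma foralls_Cons: "(x # s, A, \<alpha>) \<in> foralls E \<Longrightarrow> x = Inl (sh E)"
  by (cases E) (auto simp: below_iff)

lemma foralls_Nil: "([], A, \<alpha>) \<in> foralls E \<Longrightarrow> sh E = All A"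
  by (cases E) (auto simp: below_iff)

lemma fv_sh_vars_tree: "fv_fm (sh E) \<subseteq> vars_tree E"
  by (induction E) auto

lemma foralls_vars: "(s, A, \<alpha>) \<in> foralls E \<Longrightarrow> scope s A \<subseteq> vars_tree E \<and> \<alpha> \<in> vars_tree E"
proof (induction E arbitrary: s rule: foralls.induct)
  case (2 E F)
  then show ?case
    using fv_sh_vars_tree[of E] fv_sh_vars_tree[of F]
    by (auto simp: below_iff scope_def; blast)
next
  case (3 E F)
  then show ?case
    using fv_sh_vars_tree[of E] fv_sh_vars_tree[of F]
    by (auto simp: below_iff scope_def; blast)
next
  case (4 B tEs)
  then show ?case by (fastforce simp: below_iff scope_def)
next
  case (5 B \<beta> E)
  then show ?case by (auto simp: below_iff scope_def; blast)
qed simp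

lemma finite_vars_tree: "finite (vars_tree E)"
proof (induction E rule: vars_tree.induct)
  case (4 A tEs)
  then show ?case using finite_fv_fm[of "Ex A"] by (auto simp: finite_fv_tm)
next
  case (5 A \<alpha> E)
  then show ?case using finite_fv_fm[of "All A"] by simp
qed (auto simp: finite_fv_fm finite_fv_tm)

subsection \<open>Positions and domination\<close>

lemma expansion_at_ELit: "expansion_at (ELit b q ts) p e \<longleftrightarrow> False"
  by (subst expansion_at.simps) simp

lemma expansion_at_EAnd: "expansion_at (EAnd E F) p e \<longleftrightarrow>
    (\<exists>q. p = 0 # q \<and> expansion_at E q e \<or> p = 1 # q \<and> expansion_at F q e)"
  by (subst expansion_at.simps) auto

lemma expansion_at_EOr: "expansion_at (EOr E F) p e \<longleftrightarrow>
    (\<exists>q. p = 0 # q \<and> expansion_at E q e \<or> p = 1 # q \<and> expansion_at F q e)"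
  by (subst expansion_at.simps) auto

lemma expansion_at_EEx: "expansion_at (EEx A tEs) p e \<longleftrightarrow>
    (\<exists>i q. i < length tEs \<and> p = i # q \<and>
      (q = [] \<and> e = ExistsExp (fst (tEs ! i)) \<or> expansion_at (snd (tEs ! i)) q e))"
  by (subst expansion_at.simps) (auto, (metis prod.collapse)+)

lemma expansion_at_EAll: "expansion_at (EAll A \<alpha> E) p e \<longleftrightarrow>
    (\<exists>q. p = 0 # q \<and> (q = [] \<and> e = ForallExp \<alpha> \<or> expansion_at E q e))"
  by (subst expansion_at.simps) auto

lemmas expansion_at_iffs =
  expansion_at_ELit expansion_at_EAnd expansion_at_EOr expansion_at_EEx expansion_at_EAll

lemma expansion_at_Nil: "\<not> expansion_at E [] e"
  by (cases E) (simp_all add: expansion_at_iffs)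

lemma expansion_at_unique: "expansion_at E p e \<Longrightarrow> expansion_at E p e' \<Longrightarrow> e = e'"
proof (induction E arbitrary: p rule: foralls.induct)
  case (1 b q ts)
  then show ?case by (simp add: expansion_at_ELit)
next
  case (2 E F)
  obtain q where "expansion_at E q e \<and> expansion_at E q e' \<or> expansion_at F q e \<and> expansion_at F q e'"
    using "2.prems" unfolding expansion_at_EAnd by auto
  then show ?case using "2.IH" by blast
next
  case (3 E F)
  obtain q where "expansion_at E q e \<and> expansion_at E q e' \<or> expansion_at F q e \<and> expansion_at F q e'"
    using "3.prems" unfolding expansion_at_EOr by auto
  then show ?case using "3.IH" by blast
next
  case (4 A tEs)
  obtain i q where i: "i < length tEs" "p = i # q"
      "q = [] \<and> e = ExistsExp (fst (tEs ! i)) \<or> expansion_at (snd (tEs ! i)) q e"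
      "q = [] \<and> e' = ExistsExp (fst (tEs ! i)) \<or> expansion_at (snd (tEs ! i)) q e'"
    using "4.prems" unfolding expansion_at_EEx by blast
  show ?case
  proof (cases "q = []")
    case True
    then show ?thesis using i expansion_at_Nil by blast
  next
    case False
    then show ?thesis using i "4.IH"[OF nth_mem[OF i(1)] prod.collapse] by blast
  qed
next
  case (5 A \<alpha> E)
  show ?case
  proof (cases "p = [0]")
    case True
    then show ?thesis using "5.prems" expansion_at_Nil unfolding expansion_at_EAll by blast
  next
    case False
    then show ?thesis using "5.prems" "5.IH" unfolding expansion_at_EAll by blast
  qed
qed

lemma finite_expansion_at: "finite {p. \<exists>e. expansion_at E p e}"
proof (induction E rule: foralls.induct)
  case (1 b p ts)
  then show ?case by (simp add: expansion_at_iffs)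
next
  case (2 E F)
  have "{p. \<exists>e. expansion_at (EAnd E F) p e} =
      (#) 0 ` {p. \<exists>e. expansion_at E p e} \<union> (#) 1 ` {p. \<exists>e. expansion_at F p e}"
    by (auto simp: expansion_at_iffs)
  with 2 show ?case by simp
next
  case (3 E F)
  have "{p. \<exists>e. expansion_at (EOr E F) p e} =
      (#) 0 ` {p. \<exists>e. expansion_at E p e} \<union> (#) 1 ` {p. \<exists>e. expansion_at F p e}"
    by (auto simp: expansion_at_iffs)
  with 3 show ?case by simp
next
  case (4 A tEs)
  let ?P = "\<lambda>i. {p. \<exists>e. expansion_at (snd (tEs ! i)) p e}"
  have "finite (?P i)" if "i < length tEs" for i
    using 4[OF nth_mem[OF that]] by (metis prod.collapse)
  then have "finite (\<Union>i<length tEs. (#) i ` insert [] (?P i))" by blast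
  moreover have "{p. \<exists>e. expansion_at (EEx A tEs) p e} \<subseteq> (\<Union>i<length tEs. (#) i ` insert [] (?P i))"
    by (auto simp: expansion_at_iffs)
  ultimately show ?case by (rule finite_subset[rotated])
next
  case (5 A \<alpha> E)
  have "{p. \<exists>e. expansion_at (EAll A \<alpha> E) p e} \<subseteq> (#) 0 ` insert [] {p. \<exists>e. expansion_at E p e}"
    by (auto simp: expansion_at_iffs)
  with 5 show ?case by (auto intro: finite_subset)
qed

fun label_fv :: "'f expansion \<Rightarrow> nat set" where
  "label_fv (ExistsExp t) = fv_tm t"
| "label_fv (ForallExp \<alpha>) = {\<alpha>}"

text \<open>
  A term counts at its own expansion, but an eigenvariable counts only strictly below its own
  expansion: a term may be built from variables on which the expansion depends, whereas the
  eigenvariable is what it introduces.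
\<close>

definition labels_above :: "('f, 'p) tree \<Rightarrow> nat list \<Rightarrow> nat set" where
  "labels_above E p =
     {x. \<exists>q r e. p = q @ r \<and> expansion_at E q e \<and> x \<in> label_fv e \<and> (r \<noteq> [] \<or> (\<exists>t. e = ExistsExp t))}"

definition seen_at :: "('f, 'p) tree \<Rightarrow> nat list \<Rightarrow> nat set" where
  "seen_at E p = fv_fm (sh E) \<union> labels_above E p"

lemma labels_above_Cons:
  assumes "\<And>q e. expansion_at G (i # q) e \<longleftrightarrow> q = [] \<and> e \<in> L \<or> expansion_at E q e"
  shows "labels_above G (i # p) =
    {x. \<exists>e\<in>L. x \<in> label_fv e \<and> (p \<noteq> [] \<or> (\<exists>t. e = ExistsExp t))} \<union> labels_above E p"
    (is "?L = ?M \<union> ?R")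
proof (intro equalityI subsetI)
  fix x
  assume "x \<in> ?L"
  then obtain q r e where *: "i # p = q @ r" "expansion_at G q e" "x \<in> label_fv e"
      "r \<noteq> [] \<or> (\<exists>t. e = ExistsExp t)"
    unfolding labels_above_def by blast
  then obtain q' where q': "q = i # q'" "p = q' @ r"
    using expansion_at_Nil[of G e] by (cases q) auto
  with * assms have "q' = [] \<and> e \<in> L \<or> expansion_at E q' e" by simp
  then show "x \<in> ?M \<union> ?R"
  proof
    assume "q' = [] \<and> e \<in> L"
    with * q' have "x \<in> ?M" by auto
    then show ?thesis ..
  next
    assume "expansion_at E q' e"
    with * q' have "x \<in> ?R" unfolding labels_above_def by blast
    then show ?thesis ..
  qed
next
  fix x
  assume "x \<in> ?M \<union> ?R"
  then show "x \<in> ?L"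
  proof
    assume "x \<in> ?M"
    then obtain e where e: "e \<in> L" "x \<in> label_fv e" "p \<noteq> [] \<or> (\<exists>t. e = ExistsExp t)"
      by blast
    with assms[of "[]" e] have "i # p = [i] @ p \<and> expansion_at G [i] e" by simp
    with e show ?thesis unfolding labels_above_def by blast
  next
    assume "x \<in> ?R"
    then obtain q r e where *: "p = q @ r" "expansion_at E q e" "x \<in> label_fv e"
        "r \<noteq> [] \<or> (\<exists>t. e = ExistsExp t)"
      unfolding labels_above_def by blast
    with assms[of q e] have "i # p = (i # q) @ r \<and> expansion_at G (i # q) e" by simp
    with * show ?thesis unfolding labels_above_def by blast
  qed
qed

lemma seen_at_EAnd:
  "seen_at (EAnd E F) (0 # p) = fv_fm (And (sh E) (sh F)) \<union> seen_at E p"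
  "seen_at (EAnd E F) (Suc 0 # p) = fv_fm (And (sh E) (sh F)) \<union> seen_at F p"
  using labels_above_Cons[of "EAnd E F" 0 "{}" E p] labels_above_Cons[of "EAnd E F" 1 "{}" F p]
  by (auto simp: seen_at_def expansion_at_iffs)

lemma seen_at_EOr:
  "seen_at (EOr E F) (0 # p) = fv_fm (Or (sh E) (sh F)) \<union> seen_at E p"
  "seen_at (EOr E F) (Suc 0 # p) = fv_fm (Or (sh E) (sh F)) \<union> seen_at F p"
  using labels_above_Cons[of "EOr E F" 0 "{}" E p] labels_above_Cons[of "EOr E F" 1 "{}" F p]
  by (auto simp: seen_at_def expansion_at_iffs)

lemma seen_at_EEx:
  assumes "i < length tEs" "tEs ! i = (t, E)" "sh E = inst A t" "0 \<in> fv_fm A"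
  shows "seen_at (EEx A tEs) (i # p) = fv_fm (Ex A) \<union> seen_at E p"
  using labels_above_Cons[of "EEx A tEs" i "{ExistsExp t}" E p] assms
  by (auto simp: seen_at_def expansion_at_EEx fv_inst)

lemma seen_at_EAll:
  assumes "sh E = inst A (Var \<alpha>)" "0 \<in> fv_fm A" "p \<noteq> []"
  shows "seen_at (EAll A \<alpha> E) (0 # p) = fv_fm (All A) \<union> seen_at E p"
  using labels_above_Cons[of "EAll A \<alpha> E" 0 "{ForallExp \<alpha>}" E p] assms
  by (auto simp: seen_at_def expansion_at_EAll fv_inst)

lemma seen_at_root: "seen_at (EAll A \<alpha> E) [0] = fv_fm (All A)"
  using labels_above_Cons[of "EAll A \<alpha> E" 0 "{ForallExp \<alpha>}" E "[]"]
  by (auto simp: seen_at_def expansion_at_EAll labels_above_def expansion_at_Nil)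

text \<open>
  The labels that dominate an expansion and the root formula have together the same variables as
  the formulas on the branch.  By induction on the tree: passing below an expansion adds its label
  to both sides, since the instance of a non-vacuous body contains all variables of the label.
  This is what allows dependencies to be computed from branches.
\<close>

lemma foralls_of_expansion_at:
  "expansion_tree E \<Longrightarrow> expansion_at E p (ForallExp \<alpha>) \<Longrightarrow>
   \<exists>s A. (s, A, \<alpha>) \<in> foralls E \<and> scope s A = seen_at E p"
proof (induction arbitrary: p rule: expansion_tree.induct)
  case (1 b p ts)
  then show ?case by (simp add: expansion_at_iffs)
next
  case (2 E F)
  from "2.prems" consider q where "p = 0 # q" "expansion_at E q (ForallExp \<alpha>)"
    | q where "p = Suc 0 # q" "expansion_at F q (ForallExp \<alpha>)"
    by (auto simp: expansion_at_iffs)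
  then show ?case
  proof cases
    case (1 q)
    obtain s A where "(s, A, \<alpha>) \<in> foralls E" "scope s A = seen_at E q"
      using "2.IH"(1)[OF 1(2)] by blast
    with 1 show ?thesis
      by (intro exI[of _ "Inl (And (sh E) (sh F)) # Inr 1 # s"] exI[of _ A])
        (auto simp: below_iff scope_def seen_at_EAnd)
  next
    case (2 q)
    obtain s A where "(s, A, \<alpha>) \<in> foralls F" "scope s A = seen_at F q"
      using "2.IH"(2)[OF 2(2)] by blast
    with 2 show ?thesis
      by (intro exI[of _ "Inl (And (sh E) (sh F)) # Inr 2 # s"] exI[of _ A])
        (auto simp: below_iff scope_def seen_at_EAnd)
  qed
next
  case (3 E F)
  from "3.prems" consider q where "p = 0 # q" "expansion_at E q (ForallExp \<alpha>)"
    | q where "p = Suc 0 # q" "expansion_at F q (ForallExp \<alpha>)"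
    by (auto simp: expansion_at_iffs)
  then show ?case
  proof cases
    case (1 q)
    obtain s A where "(s, A, \<alpha>) \<in> foralls E" "scope s A = seen_at E q"
      using "3.IH"(1)[OF 1(2)] by blast
    with 1 show ?thesis
      by (intro exI[of _ "Inl (Or (sh E) (sh F)) # Inr 1 # s"] exI[of _ A])
        (auto simp: below_iff scope_def seen_at_EOr)
  next
    case (2 q)
    obtain s A where "(s, A, \<alpha>) \<in> foralls F" "scope s A = seen_at F q"
      using "3.IH"(2)[OF 2(2)] by blast
    with 2 show ?thesis
      by (intro exI[of _ "Inl (Or (sh E) (sh F)) # Inr 2 # s"] exI[of _ A])
        (auto simp: below_iff scope_def seen_at_EOr)
  qed
next
  case (4 B tEs)
  from "4.prems" obtain i q where i: "i < length tEs" "p = i # q"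
      "expansion_at (snd (tEs ! i)) q (ForallExp \<alpha>)"
    by (auto simp: expansion_at_iffs)
  obtain t E where tE: "tEs ! i = (t, E)" by fastforce
  then have mem: "(t, E) \<in> set tEs" using i by (metis nth_mem)
  obtain s A where "(s, A, \<alpha>) \<in> foralls E" "scope s A = seen_at E q"
    using "4.IH"[OF mem] i tE by auto
  moreover have "seen_at (EEx B tEs) p = fv_fm (Ex B) \<union> seen_at E q"
    using i tE "4.IH"[OF mem] "4.hyps" by (simp add: seen_at_EEx)
  ultimately have "(Inl (Ex B) # s, A, \<alpha>) \<in> foralls (EEx B tEs) \<and>
      scope (Inl (Ex B) # s) A = seen_at (EEx B tEs) p"
    using mem by (auto simp: below_iff scope_def)
  then show ?case by blast
next
  case (5 B E \<beta>)
  from "5.prems" consider "p = [0]" "\<beta> = \<alpha>" | q where "p = 0 # q" "expansion_at E q (ForallExp \<alpha>)"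
    by (auto simp: expansion_at_iffs)
  then show ?case
  proof cases
    case 1
    then have "([], B, \<alpha>) \<in> foralls (EAll B \<beta> E) \<and> scope [] B = seen_at (EAll B \<beta> E) p"
      by (simp add: seen_at_root scope_def)
    then show ?thesis by blast
  next
    case (2 q)
    then have "q \<noteq> []" using expansion_at_Nil by metis
    moreover obtain s A where "(s, A, \<alpha>) \<in> foralls E" "scope s A = seen_at E q"
      using "5.IH"[OF 2(2)] by blast
    ultimately have "(Inl (All B) # s, A, \<alpha>) \<in> foralls (EAll B \<beta> E) \<and>
        scope (Inl (All B) # s) A = seen_at (EAll B \<beta> E) p"
      using 2(1) "5.hyps" by (simp add: below_iff scope_def seen_at_EAll Un_assoc)
    then show ?thesis by blast
  qed
qed

lemma eigenvars_simps [simp]: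
  "eigenvars (ELit b p ts) = {}"
  "eigenvars (EAnd E F) = eigenvars E \<union> eigenvars F"
  "eigenvars (EOr E F) = eigenvars E \<union> eigenvars F"
  "eigenvars (EEx A tEs) = (\<Union>(t, E)\<in>set tEs. eigenvars E)"
  "eigenvars (EAll A \<alpha> E) = insert \<alpha> (eigenvars E)"
proof -
  show "eigenvars (EEx A tEs) = (\<Union>(t, E)\<in>set tEs. eigenvars E)"
  proof (intro set_eqI)
    fix \<beta>
    have "\<beta> \<in> eigenvars (EEx A tEs) \<longleftrightarrow> (\<exists>i<length tEs. \<beta> \<in> eigenvars (snd (tEs ! i)))"
      unfolding eigenvars_def expansion_at_EEx by blast
    also have "\<dots> \<longleftrightarrow> (\<exists>x\<in>set tEs. \<beta> \<in> eigenvars (snd x))"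
      by (metis in_set_conv_nth)
    finally show "\<beta> \<in> eigenvars (EEx A tEs) \<longleftrightarrow> \<beta> \<in> (\<Union>(t, E)\<in>set tEs. eigenvars E)"
      by (simp add: split_beta)
  qed
qed (auto simp: eigenvars_def expansion_at_iffs)

lemma eigenvars_foralls: "eigenvars E = (\<lambda>(s, A, \<alpha>). \<alpha>) ` foralls E"
proof (induction E rule: foralls.induct)
  case (4 A tEs)
  have "(\<Union>(t, E)\<in>set tEs. eigenvars E) = (\<Union>(t, E)\<in>set tEs. (\<lambda>(s, A, \<alpha>). \<alpha>) ` foralls E)"
    using 4 by (intro SUP_cong refl) (metis (no_types, lifting) case_prod_conv surj_pair)
  then show ?case by (simp add: below_def image_UN image_image split_beta)
qed (simp_all add: below_def image_Un image_image split_beta)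

lemma eigenvar_iff: "\<alpha> \<in> eigenvars E \<longleftrightarrow> (\<exists>s A. (s, A, \<alpha>) \<in> foralls E)"
  by (force simp: eigenvars_foralls)

subsection \<open>Substitution in trees\<close>

definition subst_branch :: "(nat \<Rightarrow> 'f tm) \<Rightarrow> ('f, 'p) branch \<Rightarrow> ('f, 'p) branch" where
  "subst_branch \<sigma> = map (map_sum (subst_fm \<sigma>) id)"

lemma subst_branch_simps [simp]:
  "subst_branch \<sigma> [] = []" "subst_branch \<sigma> (Inl A # s) = Inl (subst_fm \<sigma> A) # subst_branch \<sigma> s"
  "subst_branch \<sigma> (Inr n # s) = Inr n # subst_branch \<sigma> s"
  by (simp_all add: subst_branch_def)

lemma branch_fv_subst: "branch_fv (subst_branch \<sigma> s) = (\<Union>x\<in>branch_fv s. fv_tm (\<sigma> x))"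
proof (induction s)
  case (Cons x s)
  then show ?case by (cases x) (auto simp: fv_subst_fm)
qed simp

lemma scope_subst:
  "scope (subst_branch \<sigma> s) (subst_fm (lift_subst \<sigma>) A) = (\<Union>x\<in>scope s A. fv_tm (\<sigma> x))"
  using fv_subst_fm[of \<sigma> "All A"] by (simp add: scope_def branch_fv_subst)

lemma subst_branch_ident: "(\<And>x. x \<in> branch_fv s \<Longrightarrow> \<sigma> x = Var x) \<Longrightarrow> subst_branch \<sigma> s = s"
proof (induction s)
  case (Cons x s)
  then show ?case by (cases x) (auto intro: subst_fm_ident)
qed simp

lemma sh_subst: "sh (subst_tree \<sigma> E) = subst_fm \<sigma> (sh E)"
  by (induction E) auto

text \<open>
  The description operator repeats the one in the definition of substitution on trees; it is the
  intended variable only where the substitution is admissible.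
\<close>

lemma foralls_subst:
  "foralls (subst_tree \<sigma> E) =
   (\<lambda>(s, A, \<alpha>). (subst_branch \<sigma> s, subst_fm (lift_subst \<sigma>) A, THE \<beta>. \<sigma> \<alpha> = Var \<beta>)) ` foralls E"
proof (induction E rule: foralls.induct)
  case (4 A tEs)
  then have "(\<Union>(t, E)\<in>set tEs. foralls (subst_tree \<sigma> E)) =
    (\<Union>(t, E)\<in>set tEs. (\<lambda>(s, A, \<alpha>).
      (subst_branch \<sigma> s, subst_fm (lift_subst \<sigma>) A, THE \<beta>. \<sigma> \<alpha> = Var \<beta>)) ` foralls E)"
    by (intro SUP_cong refl) (metis (no_types, lifting) case_prod_conv surj_pair)
  then show ?case
    by (simp add: below_def image_UN image_image split_beta)
qed (simp_all add: below_def image_Un image_image sh_subst split_beta)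

lemma expansion_tree_subst:
  "expansion_tree E \<Longrightarrow> admissible \<sigma> E \<Longrightarrow> expansion_tree (subst_tree \<sigma> E)"
proof (induction rule: expansion_tree.induct)
  case (1 b p ts)
  then show ?case by (simp add: expansion_tree.intros)
next
  case (2 E F)
  then show ?case by (simp add: admissible_def expansion_tree.intros)
next
  case (3 E F)
  then show ?case by (simp add: admissible_def expansion_tree.intros)
next
  case (4 B tEs)
  show ?case
    unfolding subst_tree.simps
  proof (rule expansion_tree.intros(4))
    show "no_vacuous (Ex (subst_fm (lift_subst \<sigma>) B))"
      using "4.hyps" no_vacuous_subst[of \<sigma> "Ex B"] by simp
  next
    fix t E
    assume "(t, E) \<in> set (map (\<lambda>(t, E). (subst_tm \<sigma> t, subst_tree \<sigma> E)) tEs)"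
    then obtain t' E' where *: "(t', E') \<in> set tEs" "t = subst_tm \<sigma> t'" "E = subst_tree \<sigma> E'"
      by auto
    have "admissible \<sigma> E'"
      using "4.prems" *(1) by (auto simp: admissible_def)
    with "4.IH"[OF *(1)] * show "expansion_tree E \<and> sh E = inst (subst_fm (lift_subst \<sigma>) B) t"
      by (simp add: sh_subst subst_inst)
  qed (use 4 in simp)
next
  case (5 B E \<alpha>)
  obtain \<beta> where \<beta>: "\<sigma> \<alpha> = Var \<beta>"
    using "5.prems" by (auto simp: admissible_def)
  have "expansion_tree (subst_tree \<sigma> E)"
    using 5 by (simp add: admissible_def)
  moreover have "no_vacuous (All (subst_fm (lift_subst \<sigma>) B))"
    using 5 no_vacuous_subst[of \<sigma> "All B"] by simp
  ultimately show ?case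
    using 5 \<beta> by (simp add: sh_subst subst_inst expansion_tree.intros)
qed

lemma prop_eval_big_or: "As \<noteq> [] \<Longrightarrow> prop_eval v (big_or As) \<longleftrightarrow> (\<exists>A\<in>set As. prop_eval v A)"
  by (induction As rule: big_or.induct) auto

lemma prop_eval_dp_EEx:
  "tEs \<noteq> [] \<Longrightarrow> prop_eval v (dp (EEx A tEs)) \<longleftrightarrow> (\<exists>(t, E)\<in>set tEs. prop_eval v (dp E))"
  by (simp add: prop_eval_big_or split_beta)

lemma prop_eval_dp_subst: "expansion_tree E \<Longrightarrow>
  prop_eval v (dp (subst_tree \<sigma> E)) = prop_eval (\<lambda>p ts. v p (map (subst_tm \<sigma>) ts)) (dp E)"
proof (induction rule: expansion_tree.induct)
  case (4 B tEs)
  have "prop_eval v (dp (subst_tree \<sigma> (EEx B tEs))) \<longleftrightarrow>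
      (\<exists>(t, E)\<in>set tEs. prop_eval v (dp (subst_tree \<sigma> E)))"
    using "4.hyps" by (simp add: prop_eval_dp_EEx split_beta del: dp.simps)
  also have "\<dots> \<longleftrightarrow> (\<exists>(t, E)\<in>set tEs. prop_eval (\<lambda>p ts. v p (map (subst_tm \<sigma>) ts)) (dp E))"
    using "4.IH" by (intro bex_cong refl) auto
  finally show ?case
    using "4.hyps" by (simp add: prop_eval_dp_EEx del: dp.simps)
qed auto

text \<open>
  Renaming eigenvariables and then instantiating is a single substitution.  A renaming maps
  eigenvariables to variables, so the inner description operator always finds the new name.
\<close>

lemma subst_tree_renaming_comp:
  "subst_tree \<sigma> (subst_tree (var_renaming \<eta>) E) = subst_tree (\<lambda>x. \<sigma> (\<eta> x)) E"
proof (induction E)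
  case (ELit b p ts)
  then show ?case by (simp add: subst_tm_comp var_renaming_def)
next
  case (EEx A tEs)
  have "subst_fm (lift_subst \<sigma>) (subst_fm (lift_subst (var_renaming \<eta>)) A) =
      subst_fm (lift_subst (\<lambda>x. \<sigma> (\<eta> x))) A"
    by (simp add: subst_fm_comp lift_subst_comp) (simp add: var_renaming_def)
  with EEx show ?case by (fastforce simp: subst_tm_comp var_renaming_def)
next
  case (EAll A \<alpha> E)
  have "subst_fm (lift_subst \<sigma>) (subst_fm (lift_subst (var_renaming \<eta>)) A) =
      subst_fm (lift_subst (\<lambda>x. \<sigma> (\<eta> x))) A"
    by (simp add: subst_fm_comp lift_subst_comp) (simp add: var_renaming_def)
  with EAll show ?case by (simp add: var_renaming_def)
qed auto

section \<open>Weak regularity and acyclicity in terms of eigenvariables\<close>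

text \<open>
  The Boolean component of a universal node of a proof says whether the node belongs to a cut.
\<close>

definition foralls_cut :: "('f, 'p) cut \<Rightarrow> (('f, 'p) branch \<times> ('f, 'p) fm \<times> nat) set" where
  "foralls_cut C = foralls (fst C) \<union> foralls (snd C)"

definition foralls_proof ::
  "('f, 'p) eproof \<Rightarrow> (bool \<times> ('f, 'p) branch \<times> ('f, 'p) fm \<times> nat) set" where
  "foralls_proof P =
     Pair True ` (\<Union>C\<in>set (cuts P). foralls_cut C) \<union> Pair False ` (\<Union>E\<in>set (trees P). foralls E)"

lemma foralls_proof_iffs:
  "(True, n) \<in> foralls_proof P \<longleftrightarrow> (\<exists>C\<in>set (cuts P). n \<in> foralls_cut C)"
  "(False, n) \<in> foralls_proof P \<longleftrightarrow> (\<exists>E\<in>set (trees P). n \<in> foralls E)"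
  by (auto simp: foralls_proof_def)

definition well_formed :: "('f, 'p) eproof \<Rightarrow> bool" where
  "well_formed P \<longleftrightarrow> (\<forall>C\<in>set (cuts P). is_cut C) \<and> (\<forall>E\<in>set (trees P). expansion_tree E)"

text \<open>Weak regularity: an eigenvariable determines its universal node and the kind of its member.\<close>

definition coherent :: "('f, 'p) eproof \<Rightarrow> bool" where
  "coherent P \<longleftrightarrow> (\<forall>k s A k' s' A' \<alpha>.
     (k, s, A, \<alpha>) \<in> foralls_proof P \<longrightarrow> (k', s', A', \<alpha>) \<in> foralls_proof P \<longrightarrow>
     k = k' \<and> s = s' \<and> A = A')"

lemma weakly_regular_iff:
  assumes "well_formed P"
  shows "weakly_regular P \<longleftrightarrow> coherent P"
proof -
  have cut: "(\<exists>s'. s @ Inl (All A) # Inl (inst A (Var \<alpha>)) # s' \<in> br_cut C) \<longleftrightarrow>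
      (s, A, \<alpha>) \<in> foralls_cut C" if "C \<in> set (cuts P)" for s A \<alpha> C
    using that assms
    by (auto simp: br_cut_def foralls_cut_def well_formed_def is_cut_def foralls_iff_br)
  have tree: "(\<exists>s'. s @ Inl (All A) # Inl (inst A (Var \<alpha>)) # s' \<in> br E) \<longleftrightarrow>
      (s, A, \<alpha>) \<in> foralls E" if "E \<in> set (trees P)" for s A \<alpha> E
    using that assms by (auto simp: well_formed_def foralls_iff_br)
  have *: "(\<exists>S\<in>members P. isl S = k \<and> (\<exists>s'. s @ Inl (All A) # Inl (inst A (Var \<alpha>)) # s' \<in> br_member S))
      \<longleftrightarrow> (k, s, A, \<alpha>) \<in> foralls_proof P" for k s A \<alpha>
  proof (cases k)
    case True
    have "(\<exists>S\<in>members P. isl S = k \<and> (\<exists>s'. s @ Inl (All A) # Inl (inst A (Var \<alpha>)) # s' \<in> br_member S))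
        \<longleftrightarrow> (\<exists>C\<in>set (cuts P). \<exists>s'. s @ Inl (All A) # Inl (inst A (Var \<alpha>)) # s' \<in> br_cut C)"
      using True by (simp add: members_def br_member_def bex_Un)
    also have "\<dots> \<longleftrightarrow> (k, s, A, \<alpha>) \<in> foralls_proof P"
      using True cut by (simp add: foralls_proof_iffs)
    finally show ?thesis .
  next
    case False
    have "(\<exists>S\<in>members P. isl S = k \<and> (\<exists>s'. s @ Inl (All A) # Inl (inst A (Var \<alpha>)) # s' \<in> br_member S))
        \<longleftrightarrow> (\<exists>E\<in>set (trees P). \<exists>s'. s @ Inl (All A) # Inl (inst A (Var \<alpha>)) # s' \<in> br E)"
      using False by (simp add: members_def br_member_def bex_Un)
    also have "\<dots> \<longleftrightarrow> (k, s, A, \<alpha>) \<in> foralls_proof P"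
      using False tree by (simp add: foralls_proof_iffs)
    finally show ?thesis .
  qed
  show ?thesis
    unfolding weakly_regular_def coherent_def *[symmetric] by blast
qed

lemma eigenvar_proof_iff:
  "\<alpha> \<in> eigenvars_proof P \<longleftrightarrow> (\<exists>k s A. (k, s, A, \<alpha>) \<in> foralls_proof P)"
proof -
  have "(\<exists>k s A. (k, s, A, \<alpha>) \<in> foralls_proof P) \<longleftrightarrow>
     (\<exists>s A. (True, s, A, \<alpha>) \<in> foralls_proof P) \<or> (\<exists>s A. (False, s, A, \<alpha>) \<in> foralls_proof P)"
    by (metis (full_types))
  also have "\<dots> \<longleftrightarrow> \<alpha> \<in> eigenvars_proof P"
    unfolding eigenvars_proof_def foralls_proof_iffs foralls_cut_def eigenvars_cut_def
      UN_iff Un_iff eigenvar_iff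
    by blast
  finally show ?thesis by simp
qed

lemma eigenvarI: "(k, s, A, \<alpha>) \<in> foralls_proof P \<Longrightarrow> \<alpha> \<in> eigenvars_proof P"
  unfolding eigenvar_proof_iff by blast

lemma foralls_proof_vars:
  assumes "(k, s, A, \<alpha>) \<in> foralls_proof P"
  shows "scope s A \<subseteq> vars_proof P" "\<alpha> \<in> vars_proof P"
  using assms by (cases k; auto simp: foralls_proof_iffs foralls_cut_def vars_proof_def dest!: foralls_vars)+

lemma finite_vars_proof: "finite (vars_proof P)"
  by (simp add: vars_proof_def finite_vars_tree)

lemma eigenvars_vars_proof: "eigenvars_proof P \<subseteq> vars_proof P"
  by (auto simp: eigenvar_proof_iff dest: foralls_proof_vars(2))

lemma finite_eigenvars_proof: "finite (eigenvars_proof P)"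
  using eigenvars_vars_proof finite_vars_proof by (rule finite_subset)

subsection \<open>Dependencies between eigenvariables\<close>

text \<open>
  For expansion proofs this relation on eigenvariables carries the information in \<open>dep\<close>: its
  transitive closure describes \<open>dependents\<close> (\<open>dependents_eq\<close>), and the existence of a
  rank function for it can replace acyclicity of \<open>dep\<close> (\<open>acyclic_if_ranked\<close>, \<open>ex_ranked\<close>).  Unlike
  \<open>dep\<close>, it does not mention positions, which change in every reduction step.
\<close>

definition vdep :: "('f, 'p) eproof \<Rightarrow> (nat \<times> nat) set" where
  "vdep P = {(\<beta>, \<alpha>). \<beta> \<in> eigenvars_proof P \<and> (\<exists>k s A. (k, s, A, \<alpha>) \<in> foralls_proof P \<and> \<beta> \<in> scope s A)}"

definition ranked :: "(nat \<Rightarrow> nat) \<Rightarrow> ('f, 'p) eproof \<Rightarrow> bool" where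
  "ranked r P \<longleftrightarrow> (\<forall>(\<beta>, \<alpha>)\<in>vdep P. r \<beta> < r \<alpha>)"

lemma ranked_trancl: "(\<beta>, \<alpha>) \<in> (vdep P)\<^sup>+ \<Longrightarrow> ranked r P \<Longrightarrow> r \<beta> < r \<alpha>"
  by (induction rule: trancl_induct) (auto simp: ranked_def dest: less_trans)

text \<open>The successor makes sets without eigenvariables lower than all others.\<close>

definition height :: "(nat \<Rightarrow> nat) \<Rightarrow> nat set \<Rightarrow> nat" where
  "height r V = Max (insert 0 ((\<lambda>x. Suc (r x)) ` V))"

lemma height_le_iff: "finite V \<Longrightarrow> height r V \<le> n \<longleftrightarrow> (\<forall>x\<in>V. r x < n)"
  by (auto simp: height_def)

lemma height_mono: "finite W \<Longrightarrow> V \<subseteq> W \<Longrightarrow> height r V \<le> height r W"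
  unfolding height_def by (intro Max_mono) auto

lemma height_greater: "finite V \<Longrightarrow> x \<in> V \<Longrightarrow> r x < height r V"
  using height_le_iff[of V r "height r V"] by simp

definition forall_occ :: "('f, 'p) eproof \<Rightarrow> occurrence \<Rightarrow> nat \<Rightarrow> bool" where
  "forall_occ P x \<alpha> \<longleftrightarrow> (\<exists>s p. x = ExpOcc s p \<and> occ_at P s p (ForallExp \<alpha>))"

lemma forall_occ_simps [simp]:
  "forall_occ P (ExpOcc s p) \<alpha> \<longleftrightarrow> occ_at P s p (ForallExp \<alpha>)"
  "\<not> forall_occ P (CutOcc i) \<alpha>"
  by (simp_all add: forall_occ_def)

lemma occ_at_unique: "occ_at P s p e \<Longrightarrow> occ_at P s p e' \<Longrightarrow> e = e'"
  unfolding occ_at_def using expansion_at_unique by fastforce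

text \<open>The variables on which an occurrence depends directly or through its dominating expansions.\<close>

primrec seen :: "('f, 'p) eproof \<Rightarrow> occurrence \<Rightarrow> nat set" where
  "seen P (CutOcc i) = fv_fm (sh_cut (cuts P ! i))"
| "seen P (ExpOcc s p) = seen_at (the (tree_at P s)) p"

primrec depth :: "occurrence \<Rightarrow> nat" where
  "depth (CutOcc i) = 0"
| "depth (ExpOcc s p) = length p"

lemma tree_at_mem:
  assumes "tree_at P st = Some E"
  shows "(\<exists>C\<in>set (cuts P). E = fst C \<or> E = snd C) \<or> E \<in> set (trees P)"
  using assms by (cases st) (auto split: if_splits)

lemma cut_tree_at:
  assumes "C \<in> set (cuts P)" "E = fst C \<or> E = snd C"
  shows "\<exists>st. tree_at P st = Some E"
proof -
  obtain i where i: "i < length (cuts P)" "cuts P ! i = C"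
    using assms(1) by (metis in_set_conv_nth)
  then have "tree_at P (InCut i (E = fst C)) = Some E"
    using assms(2) by auto
  then show ?thesis ..
qed

lemma end_tree_at:
  assumes "E \<in> set (trees P)"
  shows "\<exists>st. tree_at P st = Some E"
proof -
  obtain i where i: "i < length (trees P)" "trees P ! i = E"
    using assms by (metis in_set_conv_nth)
  then have "tree_at P (InTree i) = Some E" by simp
  then show ?thesis ..
qed

lemma node_of_forall_occ:
  assumes "well_formed P" "forall_occ P x \<alpha>"
  shows "\<exists>k s A. (k, s, A, \<alpha>) \<in> foralls_proof P \<and> scope s A = seen P x"
proof -
  obtain st p E where x: "x = ExpOcc st p" and E: "tree_at P st = Some E"
    and p: "expansion_at E p (ForallExp \<alpha>)"
    using assms(2) by (auto simp: forall_occ_def occ_at_def)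
  have "expansion_tree E"
    using tree_at_mem[OF E] assms(1) by (auto simp: well_formed_def is_cut_def)
  then obtain s A where sA: "(s, A, \<alpha>) \<in> foralls E" "scope s A = seen_at E p"
    using foralls_of_expansion_at[OF _ p] by blast
  have "\<exists>k. (k, s, A, \<alpha>) \<in> foralls_proof P"
    using tree_at_mem[OF E]
  proof
    assume "\<exists>C\<in>set (cuts P). E = fst C \<or> E = snd C"
    then have "(True, s, A, \<alpha>) \<in> foralls_proof P"
      using sA(1) unfolding foralls_proof_iffs foralls_cut_def by blast
    then show ?thesis ..
  next
    assume "E \<in> set (trees P)"
    then have "(False, s, A, \<alpha>) \<in> foralls_proof P"
      using sA(1) unfolding foralls_proof_iffs by blast
    then show ?thesis ..
  qed
  with sA x E show ?thesis by auto
qed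

lemma forall_occ_of_eigenvar:
  assumes "\<alpha> \<in> eigenvars_proof P"
  shows "\<exists>x. forall_occ P x \<alpha>"
proof -
  obtain E st where "tree_at P st = Some E" "\<alpha> \<in> eigenvars E"
    using assms cut_tree_at[of _ P] end_tree_at[of _ P]
    by (auto simp: eigenvars_proof_def eigenvars_cut_def) blast+
  then show ?thesis
    by (auto simp: eigenvars_def forall_occ_def occ_at_def)
qed

lemma eigenvar_of_forall_occ:
  assumes "forall_occ P x \<alpha>"
  shows "\<alpha> \<in> eigenvars_proof P"
proof -
  obtain st p E where E: "tree_at P st = Some E" and p: "expansion_at E p (ForallExp \<alpha>)"
    using assms by (auto simp: forall_occ_def occ_at_def)
  then have "\<alpha> \<in> eigenvars E" by (auto simp: eigenvars_def)
  then show ?thesis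
    using tree_at_mem[OF E] by (auto simp: eigenvars_proof_def eigenvars_cut_def)
qed

lemma fv_sh_side:
  assumes "well_formed P" "tree_at P (InCut i b) = Some E"
  shows "i < length (cuts P)" "fv_fm (sh E) = fv_fm (sh_cut (cuts P ! i))"
proof -
  show i: "i < length (cuts P)" using assms(2) by (auto split: if_splits)
  then have "is_cut (cuts P ! i)" using assms(1) by (simp add: well_formed_def)
  then show "fv_fm (sh E) = fv_fm (sh_cut (cuts P ! i))"
    using assms(2) i by (cases b) (auto simp: sh_cut_def is_cut_def)
qed

lemma labels_above_mono: "labels_above E p \<subseteq> labels_above E (p @ q)"
proof
  fix x
  assume "x \<in> labels_above E p"
  then obtain q' r e where *: "p = q' @ r" "expansion_at E q' e" "x \<in> label_fv e"
      "r \<noteq> [] \<or> (\<exists>t. e = ExistsExp t)"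
    unfolding labels_above_def by blast
  then have "p @ q = q' @ (r @ q)" "r @ q \<noteq> [] \<or> (\<exists>t. e = ExistsExp t)" by auto
  with * show "x \<in> labels_above E (p @ q)"
    unfolding labels_above_def by blast
qed

text \<open>
  The four generating rules of the dependency relation fall into two kinds.  Either the source is
  a \<open>\<forall>\<close>-expansion and its eigenvariable becomes visible at the target, or the step leads deeper
  into a cut or tree and all visible variables are kept.  (Domination by a \<open>\<forall>\<close>-expansion is of
  both kinds.)
\<close>

lemma dep0_seen:
  assumes "well_formed P" "dep0 P x y"
  shows "(\<forall>\<alpha>. forall_occ P x \<alpha> \<longrightarrow> \<alpha> \<in> seen P y) \<and>
    ((\<exists>\<alpha>. forall_occ P x \<alpha>) \<or> seen P x \<subseteq> seen P y \<and> depth x < depth y)"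
  using assms(2)
proof cases
  case (dep_term s p \<alpha> s' p' t)
  obtain E where E: "tree_at P s' = Some E" "expansion_at E p' (ExistsExp t)"
    using dep_term by (auto simp: occ_at_def)
  have "p' = p' @ [] \<and> \<alpha> \<in> label_fv (ExistsExp t) \<and> (\<exists>t'. ExistsExp t = ExistsExp t')"
    using dep_term by simp
  with E(2) have "\<alpha> \<in> labels_above E p'"
    unfolding labels_above_def by blast
  then have "\<alpha> \<in> seen P y"
    using dep_term E by (simp add: seen_at_def)
  moreover have "forall_occ P x \<alpha>"
    using dep_term by simp
  moreover have "\<beta> = \<alpha>" if "forall_occ P x \<beta>" for \<beta>
    using that dep_term(1) occ_at_unique[OF dep_term(3), of "ForallExp \<beta>"] by simp
  ultimately show ?thesis by blast
next
  case (dep_dominates s p e q e')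
  obtain E where E: "tree_at P s = Some E" "expansion_at E p e"
    using dep_dominates by (auto simp: occ_at_def)
  have "\<alpha> \<in> labels_above E (p @ q)" if "forall_occ P x \<alpha>" for \<alpha>
  proof -
    have "expansion_at E p (ForallExp \<alpha>)"
      using that E(1) dep_dominates(1) by (simp add: occ_at_def)
    moreover have "\<alpha> \<in> label_fv (ForallExp \<alpha>)" by simp
    ultimately show ?thesis
      using dep_dominates(5) unfolding labels_above_def by blast
  qed
  then show ?thesis
    using dep_dominates E labels_above_mono[of E p q] by (auto simp: seen_at_def)
next
  case (dep_cut i b p e)
  obtain E where E: "tree_at P (InCut i b) = Some E" "expansion_at E p e"
    using dep_cut by (auto simp: occ_at_def)
  have "p \<noteq> []" using E(2) expansion_at_Nil by metis
  moreover have "seen P x \<subseteq> seen P y"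
    using dep_cut E fv_sh_side[OF assms(1) E(1)] by (simp add: seen_at_def)
  ultimately show ?thesis
    using dep_cut by simp
next
  case (dep_cut_formula s p \<alpha> i)
  have "forall_occ P x \<alpha>"
    using dep_cut_formula by simp
  moreover have "\<beta> = \<alpha>" if "forall_occ P x \<beta>" for \<beta>
    using that dep_cut_formula(1) occ_at_unique[OF dep_cut_formula(3), of "ForallExp \<beta>"] by simp
  moreover have "\<alpha> \<in> seen P y"
    using dep_cut_formula by simp
  ultimately show ?thesis by blast
qed

lemma forall_occ_seen_vdep:
  assumes "well_formed P" "forall_occ P x \<alpha>" "\<beta> \<in> seen P x" "\<beta> \<in> eigenvars_proof P"
  shows "(\<beta>, \<alpha>) \<in> vdep P"
  using node_of_forall_occ[OF assms(1,2)] assms(3,4) unfolding vdep_def by blast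

text \<open>
  Along a generating step, the height of the visible eigenvariables grows strictly when the source
  is a \<open>\<forall>\<close>-expansion, because its own eigenvariable outranks everything visible at it;
  otherwise the height does not fall and the depth of the position grows.
\<close>

lemma acyclic_if_ranked:
  assumes wf: "well_formed P" and r: "ranked r P"
  shows "\<not> dep P x x"
proof -
  let ?h = "\<lambda>x. height r (seen P x \<inter> eigenvars_proof P)"
  let ?m = "\<lambda>x. (?h x, depth x)"
  let ?R = "less_than <*lex*> less_than"
  have fin: "finite (seen P x \<inter> eigenvars_proof P)" for x
    using finite_eigenvars_proof by blast
  have step: "(?m x, ?m y) \<in> ?R" if "dep0 P x y" for x y
  proof (cases "\<exists>\<alpha>. forall_occ P x \<alpha>")
    case True
    then obtain \<alpha> where \<alpha>: "forall_occ P x \<alpha>" ..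
    have "?h x \<le> r \<alpha>"
      unfolding height_le_iff[OF fin]
      using forall_occ_seen_vdep[OF wf \<alpha>] r by (auto simp: ranked_def)
    also have "r \<alpha> < ?h y"
      using dep0_seen[OF wf that] \<alpha> eigenvar_of_forall_occ[OF \<alpha>] by (intro height_greater[OF fin]) simp
    finally show ?thesis by simp
  next
    case False
    then have "seen P x \<subseteq> seen P y" "depth x < depth y"
      using dep0_seen[OF wf that] by auto
    moreover have "?h x \<le> ?h y"
      using \<open>seen P x \<subseteq> seen P y\<close> by (intro height_mono[OF fin]) blast
    ultimately show ?thesis by auto
  qed
  have "(?m x, ?m y) \<in> ?R" if "dep P x y" for x y
    using that unfolding dep_def
  proof (induction rule: tranclp_induct)
    case (base y)
    then show ?case by (rule step)
  next
    case step': (step y z)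
    have "trans ?R" by (intro trans_lex_prod trans_less_than)
    with step'.IH step[OF step'.hyps(2)] show ?case by (meson transD)
  qed
  then show ?thesis by fastforce
qed

text \<open>
  Coherence makes all occurrences of an eigenvariable see the same variables, so that a dependency
  between eigenvariables can be followed backwards from any occurrence of the target.  The
  eigenvariable condition excludes that the variable is visible only through the root formula of a
  tree in the end sequent; in a cut, the root formula is covered by the rule for cut formulas.
\<close>

lemma vdep_pullback:
  assumes P: "well_formed P" "coherent P"
    and ec: "\<forall>\<alpha>\<in>eigenvars_proof P. \<forall>A\<in>set (sh_proof P). \<alpha> \<notin> fv_fm A"
    and "(\<beta>, \<alpha>) \<in> vdep P" "forall_occ P y \<alpha>"
  shows "\<exists>x. forall_occ P x \<beta> \<and> dep P x y"
proof -
  have \<beta>: "\<beta> \<in> eigenvars_proof P" "\<beta> \<in> seen P y"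
    using assms(4) node_of_forall_occ[OF P(1) assms(5)] P(2)
    unfolding vdep_def coherent_def by blast+
  obtain st p E where y: "y = ExpOcc st p" "occ_at P st p (ForallExp \<alpha>)" and E: "tree_at P st = Some E"
    and p: "expansion_at E p (ForallExp \<alpha>)"
    using assms(5) by (auto simp: forall_occ_def occ_at_def)
  from \<beta>(2) y E consider "\<beta> \<in> fv_fm (sh E)" | "\<beta> \<in> labels_above E p"
    by (auto simp: seen_at_def)
  then show ?thesis
  proof cases
    case 1
    show ?thesis
    proof (cases st)
      case (InTree i)
      then have "sh E \<in> set (sh_proof P)"
        using E by (auto simp: sh_proof_def split: if_splits)
      with ec \<beta>(1) 1 show ?thesis by blast
    next
      case (InCut i b)
      obtain s' p' where x: "occ_at P s' p' (ForallExp \<beta>)"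
        using forall_occ_of_eigenvar[OF \<beta>(1)] by (auto simp: forall_occ_def)
      have "dep0 P (ExpOcc s' p') (CutOcc i)"
        using fv_sh_side[OF P(1) E[unfolded InCut]] 1 by (intro dep0.dep_cut_formula[OF x]) simp_all
      moreover have "dep0 P (CutOcc i) y"
        using y InCut dep0.dep_cut[of P i b p "ForallExp \<alpha>"] by simp
      ultimately have "dep P (ExpOcc s' p') y"
        unfolding dep_def by (meson tranclp.intros)
      with x show ?thesis by (auto simp: forall_occ_def)
    qed
  next
    case 2
    then obtain q r e where q: "p = q @ r" "expansion_at E q e" "\<beta> \<in> label_fv e"
        "r \<noteq> [] \<or> (\<exists>t. e = ExistsExp t)"
      unfolding labels_above_def by blast
    have r: "r \<noteq> []"
    proof
      assume "r = []"
      then show False using q p expansion_at_unique[of E p e "ForallExp \<alpha>"] by auto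
    qed
    then have dom: "dep0 P (ExpOcc st q) y"
      using y q E dep0.dep_dominates[of P st q e r] by (simp add: occ_at_def)
    show ?thesis
    proof (cases e)
      case (ExistsExp t)
      obtain s' p' where x: "occ_at P s' p' (ForallExp \<beta>)"
        using forall_occ_of_eigenvar[OF \<beta>(1)] by (auto simp: forall_occ_def)
      have "dep0 P (ExpOcc s' p') (ExpOcc st q)"
        using q E ExistsExp by (intro dep0.dep_term[OF x, of st q t]) (simp_all add: occ_at_def)
      with dom have "dep P (ExpOcc s' p') y"
        unfolding dep_def by (meson tranclp.intros)
      with x show ?thesis by (auto simp: forall_occ_def)
    next
      case (ForallExp \<gamma>)
      then have "forall_occ P (ExpOcc st q) \<beta>"
        using q E by (auto simp: forall_occ_def occ_at_def)
      with dom show ?thesis unfolding dep_def by blast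
    qed
  qed
qed

lemma finite_dep: "finite {x. dep P x y}"
proof -
  let ?S = "InTree ` {..<length (trees P)} \<union> (\<lambda>(i, b). InCut i b) ` ({..<length (cuts P)} \<times> UNIV)"
  let ?O = "CutOcc ` {..<length (cuts P)} \<union>
    (\<Union>s\<in>?S. ExpOcc s ` {p. \<exists>e. expansion_at (the (tree_at P s)) p e})"
  have "finite ?O"
    by (intro finite_UnI finite_imageI finite_UN_I finite_expansion_at) auto
  have occ: "ExpOcc s p \<in> ?O" if "occ_at P s p e" for s p e
  proof -
    have "s \<in> ?S" using that by (cases s) (auto simp: occ_at_def split: if_splits)
    then show ?thesis using that by (fastforce simp: occ_at_def)
  qed
  have "x \<in> ?O" if "dep0 P x y" for x y
    using that
  proof cases
    case (dep_cut i b p e)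
    then have "i < length (cuts P)" by (auto simp: occ_at_def split: if_splits)
    then show ?thesis using dep_cut by simp
  next
    case (dep_term s p \<alpha> s' p' t)
    show ?thesis unfolding dep_term(1) by (rule occ[OF dep_term(3)])
  next
    case (dep_dominates s p e q e')
    show ?thesis unfolding dep_dominates(1) by (rule occ[OF dep_dominates(3)])
  next
    case (dep_cut_formula s p \<alpha> i)
    show ?thesis unfolding dep_cut_formula(1) by (rule occ[OF dep_cut_formula(3)])
  qed
  then have "{x. dep P x y} \<subseteq> ?O"
    unfolding dep_def by (blast dest: tranclpD)
  with \<open>finite ?O\<close> show ?thesis by (rule finite_subset[rotated])
qed

text \<open>
  An occurrence can be ranked by the number of its predecessors, which is finite and grows along
  the acyclic relation.  For an eigenvariable the least rank of its occurrences is taken, since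
  \<open>vdep_pullback\<close> starts from an arbitrary occurrence of the target, in particular from a
  minimal one.
\<close>

lemma ex_ranked:
  assumes P: "well_formed P" "coherent P"
    and ec: "\<forall>\<alpha>\<in>eigenvars_proof P. \<forall>A\<in>set (sh_proof P). \<alpha> \<notin> fv_fm A"
    and acyclic: "\<forall>x. \<not> dep P x x"
  shows "\<exists>r. ranked r P"
proof -
  let ?below = "\<lambda>y. card {x. dep P x y}"
  define r where "r \<alpha> = (LEAST n. \<exists>y. forall_occ P y \<alpha> \<and> n = ?below y)" for \<alpha>
  have mono: "?below x < ?below y" if "dep P x y" for x y
  proof (rule psubset_card_mono[OF finite_dep])
    have "{z. dep P z x} \<subseteq> {z. dep P z y}"
      using that unfolding dep_def by (auto intro: tranclp_trans)
    moreover have "x \<in> {z. dep P z y}" "x \<notin> {z. dep P z x}"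
      using that acyclic by auto
    ultimately show "{z. dep P z x} \<subset> {z. dep P z y}" by blast
  qed
  have "r \<beta> < r \<alpha>" if vd: "(\<beta>, \<alpha>) \<in> vdep P" for \<beta> \<alpha>
  proof -
    have "\<alpha> \<in> eigenvars_proof P"
      using vd by (auto simp: vdep_def eigenvar_proof_iff)
    then have "\<exists>n y. forall_occ P y \<alpha> \<and> n = ?below y"
      using forall_occ_of_eigenvar by blast
    then have "\<exists>y. forall_occ P y \<alpha> \<and> r \<alpha> = ?below y"
      unfolding r_def by (rule LeastI_ex)
    then obtain y where y: "forall_occ P y \<alpha>" "r \<alpha> = ?below y" by blast
    obtain x where x: "forall_occ P x \<beta>" "dep P x y"
      using vdep_pullback[OF P ec vd y(1)] by blast
    have "r \<beta> \<le> ?below x"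
      unfolding r_def using x(1) by (intro Least_le) blast
    with mono[OF x(2)] y(2) show ?thesis by simp
  qed
  then show ?thesis unfolding ranked_def by blast
qed

text \<open>
  This characterization replaces the definition of expansion proofs in all that follows.
\<close>

lemma expansion_proof_iff:
  "expansion_proof P \<longleftrightarrow> well_formed P \<and> coherent P \<and> (\<exists>r. ranked r P) \<and> tautology (dp_proof P) \<and>
     (\<forall>\<alpha>\<in>eigenvars_proof P. \<forall>A\<in>set (sh_proof P). \<alpha> \<notin> fv_fm A)" (is "_ \<longleftrightarrow> ?R")
proof
  assume P: "expansion_proof P"
  then have "well_formed P" by (simp add: expansion_proof_def well_formed_def)
  with P show ?R
    using weakly_regular_iff[of P] ex_ranked[of P] by (auto simp: expansion_proof_def)
next
  assume R: ?R
  then show "expansion_proof P"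
    using weakly_regular_iff[of P] acyclic_if_ranked[of P]
    by (auto simp: expansion_proof_def well_formed_def)
qed

text \<open>
  From left to right, a path of occurrences that starts at \<open>+\<^sup>\<alpha>\<close> always sees some
  eigenvariable reachable from \<open>\<alpha>\<close>.  From right to left, the path between eigenvariables is
  pulled back step by step.
\<close>

lemma dependents_eq:
  assumes P: "expansion_proof P" and X: "X \<subseteq> eigenvars_proof P"
  shows "dependents P X = {\<beta>. \<exists>\<alpha>\<in>X. (\<alpha>, \<beta>) \<in> (vdep P)\<^sup>+}"
proof -
  note P' = P[unfolded expansion_proof_iff]
  have wf: "well_formed P" using P' by simp
  have *: "\<beta> \<in> dependents P X \<longleftrightarrow> (\<exists>\<alpha>\<in>X. \<exists>x y. forall_occ P x \<alpha> \<and> forall_occ P y \<beta> \<and> dep P x y)" for \<beta>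
    unfolding dependents_def forall_occ_def by blast
  have down: "\<exists>\<alpha>\<in>X. (\<alpha>, \<beta>) \<in> (vdep P)\<^sup>+"
    if down: "\<alpha> \<in> X" "forall_occ P x \<alpha>" "forall_occ P y \<beta>" "dep P x y" for \<alpha> \<beta> x y
  proof -
    let ?W = "{\<gamma>. (\<alpha>, \<gamma>) \<in> (vdep P)\<^sup>*} \<inter> eigenvars_proof P"
    have "\<alpha> \<in> ?W" using down X by auto
    have "?W \<inter> seen P y \<noteq> {}"
      using down(4) unfolding dep_def
    proof (induction rule: tranclp_induct)
      case (base y)
      then show ?case using dep0_seen[OF wf base] down(2) \<open>\<alpha> \<in> ?W\<close> by blast
    next
      case (step y z)
      show ?case
      proof (cases "\<exists>\<gamma>. forall_occ P y \<gamma>")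
        case True
        then obtain \<gamma> where \<gamma>: "forall_occ P y \<gamma>" ..
        obtain \<delta> where "\<delta> \<in> ?W" "\<delta> \<in> seen P y" using step.IH by blast
        then have "(\<alpha>, \<gamma>) \<in> (vdep P)\<^sup>*"
          using forall_occ_seen_vdep[OF wf \<gamma>] by (auto intro: rtrancl_into_rtrancl)
        then show ?thesis
          using dep0_seen[OF wf step.hyps(2)] \<gamma> eigenvar_of_forall_occ[OF \<gamma>] by blast
      next
        case False
        then show ?thesis using dep0_seen[OF wf step.hyps(2)] step.IH by blast
      qed
    qed
    then obtain \<delta> where "(\<alpha>, \<delta>) \<in> (vdep P)\<^sup>*" "(\<delta>, \<beta>) \<in> vdep P"
      using forall_occ_seen_vdep[OF wf down(3)] by blast
    then have "(\<alpha>, \<beta>) \<in> (vdep P)\<^sup>+" by (rule rtrancl_into_trancl1)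
    with down(1) show ?thesis by blast
  qed
  have up: "\<exists>x. forall_occ P x \<alpha> \<and> dep P x y" if "(\<alpha>, \<beta>) \<in> (vdep P)\<^sup>+" "forall_occ P y \<beta>" for \<alpha> \<beta> y
    using that
  proof (induction arbitrary: y rule: trancl_induct)
    case (base \<beta>)
    then show ?case using vdep_pullback P' by blast
  next
    case (step \<beta> \<gamma>)
    obtain x where x: "forall_occ P x \<beta>" "dep P x y"
      using vdep_pullback[OF _ _ _ step.hyps(2) step.prems] P' by blast
    obtain z where "forall_occ P z \<alpha>" "dep P z x"
      using step.IH[OF x(1)] by blast
    with x(2) show ?case unfolding dep_def by (meson tranclp_trans)
  qed
  have "\<beta> \<in> dependents P X" if "\<alpha> \<in> X" "(\<alpha>, \<beta>) \<in> (vdep P)\<^sup>+" for \<alpha> \<beta>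
  proof -
    have "\<beta> \<in> eigenvars_proof P"
      using that(2) by cases (auto simp: vdep_def eigenvar_proof_iff)
    then show ?thesis
      using forall_occ_of_eigenvar up[OF that(2)] that(1) unfolding * by blast
  qed
  moreover have "\<exists>\<alpha>\<in>X. (\<alpha>, \<beta>) \<in> (vdep P)\<^sup>+" if "\<beta> \<in> dependents P X" for \<beta>
    using that down unfolding * by blast
  ultimately show ?thesis by blast
qed

section \<open>Reduction steps\<close>

primrec connectives :: "('f, 'p) fm \<Rightarrow> nat" where
  "connectives (Lit b p ts) = 0"
| "connectives (And A B) = Suc (connectives A + connectives B)"
| "connectives (Or A B) = Suc (connectives A + connectives B)"
| "connectives (Ex A) = Suc (connectives A)"
| "connectives (All A) = Suc (connectives A)"

lemma connectives_subst [simp]: "connectives (subst_fm \<sigma> A) = connectives A"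
  by (induction A arbitrary: \<sigma>) auto

lemma connectives_inst [simp]: "connectives (inst A t) = connectives A"
  by (simp add: inst_def)

lemma connectives_dual [simp]: "connectives (dual A) = connectives A"
  by (induction A) auto

definition cut_formulas :: "('f, 'p) eproof \<Rightarrow> ('f, 'p) fm set" where
  "cut_formulas P = sh_cut ` set (cuts P)"

text \<open>
  The contract between the steps and the termination argument: a step on the cuts with formula
  \<open>A\<close> removes \<open>A\<close> and adds only less complex cut formulas.
\<close>

definition reduces :: "('f, 'p) fm \<Rightarrow> ('f, 'p) eproof \<Rightarrow> ('f, 'p) eproof \<Rightarrow> bool" where
  "reduces A P Q \<longleftrightarrow> cut_reduction P Q \<and> set (sh_proof Q) = set (sh_proof P) \<and>
     (\<forall>B\<in>cut_formulas Q. B \<in> cut_formulas P - {A} \<or> connectives B < connectives A)"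

text \<open>
  How a step shortens branches.  If a branch of a cut begins with the cut formula \<open>A\<close> or its
  dual, it comes from a displayed cut and loses its initial segment: one entry in the quantifier
  step, and two in the propositional step, where the direction \<open>1\<close> or \<open>2\<close> goes as well.
\<close>

definition strip :: "nat \<Rightarrow> ('f, 'p) fm \<Rightarrow> bool \<Rightarrow> ('f, 'p) branch \<Rightarrow> ('f, 'p) branch" where
  "strip n A k s = (if k \<and> s \<noteq> [] \<and> (hd s = Inl A \<or> hd s = Inl (dual A)) then drop n s else s)"

text \<open>
  Polarity separates the two sides of a cut, so no branch of a cut with another formula can begin
  with \<open>A\<close> or its dual.
\<close>

lemma strip_other_cut:
  assumes "is_cut C" "sh_cut C \<noteq> A" "positive A" "(s, B, \<beta>) \<in> foralls_cut C"
  shows "strip n A k s = s"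
proof (cases s)
  case (Cons x s')
  have "x = Inl (sh (fst C)) \<or> x = Inl (sh (snd C))"
    using assms(4) foralls_Cons unfolding Cons foralls_cut_def by blast
  then show ?thesis
    using assms(1-3) Cons by (auto simp: strip_def is_cut_def sh_cut_def)
qed (simp add: strip_def)

lemma scope_strip: "scope (strip n A k s) B \<subseteq> scope s B"
  using set_drop_subset[of n s] by (auto simp: strip_def scope_def branch_fv_def)

lemma foralls_cut_mk_cut: "foralls_cut (mk_cut E F) = foralls E \<union> foralls F"
  by (auto simp: foralls_cut_def mk_cut_def)

lemma is_cut_mk_cut:
  "expansion_tree E \<Longrightarrow> expansion_tree F \<Longrightarrow> sh F = dual (sh E) \<Longrightarrow> is_cut (mk_cut E F)"
  by (auto simp: is_cut_def mk_cut_def)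

lemma sh_cut_mk_cut: "sh_cut (mk_cut E F) = sh E \<or> sh_cut (mk_cut E F) = sh F"
  by (auto simp: sh_cut_def mk_cut_def)

lemma prop_eval_mk_cut:
  "prop_eval v (dp_cut (mk_cut E F)) \<longleftrightarrow> prop_eval v (dp E) \<and> prop_eval v (dp F)"
  by (auto simp: dp_cut_def mk_cut_def)

lemma tautology_dp_proof:
  "tautology (dp_proof P) \<longleftrightarrow>
   (\<forall>v. (\<exists>E\<in>set (trees P). prop_eval v (dp E)) \<or> (\<exists>C\<in>set (cuts P). prop_eval v (dp_cut C)))"
  unfolding tautology_def dp_proof_def by (simp add: bex_Un)

lemma mset_filter_split: "mset xs = mset (filter p xs @ filter (\<lambda>x. \<not> p x) xs)"
  by (simp add: multiset_partition)

subsection \<open>Propositional and atomic steps\<close>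

text \<open>
  Steps that do not rename eigenvariables change branches by a fixed function \<open>g\<close>.  Equal
  eigenvariables then still have equal branches, and the dependency relation between eigenvariables
  can only shrink, so the old rank function remains valid.
\<close>

lemma expansion_proof_transfer:
  assumes P: "expansion_proof P" and wf: "well_formed Q" and taut: "tautology (dp_proof Q)"
    and sh: "set (sh_proof Q) = set (sh_proof P)"
    and nodes: "\<And>k s A \<alpha>. (k, s, A, \<alpha>) \<in> foralls_proof Q \<Longrightarrow>
      \<exists>s0. (k, s0, A, \<alpha>) \<in> foralls_proof P \<and> s = g k s0 \<and> scope s A \<subseteq> scope s0 A"
  shows "expansion_proof Q"
proof -
  note P' = P[unfolded expansion_proof_iff]
  have eig: "eigenvars_proof Q \<subseteq> eigenvars_proof P"
  proof
    fix \<alpha>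
    assume "\<alpha> \<in> eigenvars_proof Q"
    then obtain k s A where "(k, s, A, \<alpha>) \<in> foralls_proof Q" by (auto simp: eigenvar_proof_iff)
    from nodes[OF this] show "\<alpha> \<in> eigenvars_proof P" by (auto simp: eigenvar_proof_iff)
  qed
  have "vdep Q \<subseteq> vdep P"
  proof clarify
    fix \<beta> \<alpha>
    assume "(\<beta>, \<alpha>) \<in> vdep Q"
    then obtain k s A where "\<beta> \<in> eigenvars_proof Q" "(k, s, A, \<alpha>) \<in> foralls_proof Q" "\<beta> \<in> scope s A"
      by (auto simp: vdep_def)
    moreover obtain s0 where "(k, s0, A, \<alpha>) \<in> foralls_proof P" "scope s A \<subseteq> scope s0 A"
      using nodes[OF calculation(2)] by blast
    ultimately show "(\<beta>, \<alpha>) \<in> vdep P"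
      using eig unfolding vdep_def by blast
  qed
  then have "\<exists>r. ranked r Q"
    using P' unfolding ranked_def by blast
  moreover have "coherent Q"
    unfolding coherent_def
  proof (intro allI impI)
    fix k s A k' s' A' \<alpha>
    assume n: "(k, s, A, \<alpha>) \<in> foralls_proof Q" "(k', s', A', \<alpha>) \<in> foralls_proof Q"
    obtain s0 s0' where "(k, s0, A, \<alpha>) \<in> foralls_proof P" "s = g k s0"
        "(k', s0', A', \<alpha>) \<in> foralls_proof P" "s' = g k' s0'"
      using nodes[OF n(1)] nodes[OF n(2)] by blast
    moreover from this have "k = k' \<and> s0 = s0' \<and> A = A'"
      using P' unfolding coherent_def by blast
    ultimately show "k = k' \<and> s = s' \<and> A = A'" by simp
  qed
  ultimately show ?thesis
    unfolding expansion_proof_iff using wf taut sh eig P' by blast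
qed

lemma atomic_reduction:
  assumes P: "expansion_proof P" and C: "C \<in> set (cuts P)" "sh_cut C = Lit b p ts"
  shows "\<exists>Q. cut_reduction P Q \<and> set (sh_proof Q) = set (sh_proof P) \<and>
    mset (cuts P) = add_mset C (mset (cuts Q))"
proof -
  note P' = P[unfolded expansion_proof_iff]
  have "is_cut C" using P' C by (simp add: well_formed_def)
  then have sides: "sh (fst C) = Lit True p ts" "sh (snd C) = Lit False p ts"
    using C(2) dual_dual[of "sh (snd C)"] by (auto simp: is_cut_def sh_cut_def)
  have "fst C = ELit True p ts"
    using sides(1) by (cases "fst C") simp_all
  moreover have "snd C = ELit False p ts"
    using sides(2) by (cases "snd C") simp_all
  ultimately have Ceq: "C = (ELit True p ts, ELit False p ts)" by (simp add: prod_eq_iff)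
  define Q where "Q = (remove1 C (cuts P), trees P)"
  have mset: "mset (cuts P) = add_mset C (mset (cuts Q))"
    using C(1) by (simp add: Q_def)
  have sub: "set (cuts P) = insert C (set (cuts Q))"
    using arg_cong[OF mset, of set_mset] by simp
  have trees: "trees Q = trees P" by (simp add: Q_def)
  have "foralls_proof Q \<subseteq> foralls_proof P"
    unfolding foralls_proof_def sub trees by auto
  moreover have "tautology (dp_proof Q)"
    using P' unfolding tautology_dp_proof sub trees by (simp add: Ceq dp_cut_def)
  moreover have "well_formed Q"
    using P' sub by (simp add: well_formed_def trees)
  ultimately have "expansion_proof Q"
    by (intro expansion_proof_transfer[OF P, of Q "\<lambda>k s. s"]) (auto simp: sh_proof_def trees)
  moreover have "atomic_step P Q"
    using mset by (intro atomic_step.intros[of P p ts Q]) (simp_all add: Ceq trees)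
  ultimately have "cut_reduction P Q"
    using P by (simp add: cut_reduction_def)
  moreover have "set (sh_proof Q) = set (sh_proof P)"
    by (simp add: sh_proof_def trees)
  ultimately show ?thesis
    using mset by blast
qed

lemma sh_OrE: "sh E = Or A B \<Longrightarrow> \<exists>E1 E2. E = EOr E1 E2 \<and> sh E1 = A \<and> sh E2 = B"
  by (cases E) auto

lemma sh_AndE: "sh E = And A B \<Longrightarrow> \<exists>E1 E2. E = EAnd E1 E2 \<and> sh E1 = A \<and> sh E2 = B"
  by (cases E) auto

lemma sh_ExE: "sh E = Ex A \<Longrightarrow> \<exists>tEs. E = EEx A tEs"
  by (cases E) auto

lemma sh_AllE: "sh E = All A \<Longrightarrow> \<exists>\<alpha> F. E = EAll A \<alpha> F"
  by (cases E) auto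

lemma expansion_tree_EAnd: "expansion_tree (EAnd E F) \<longleftrightarrow> expansion_tree E \<and> expansion_tree F"
  by (subst expansion_tree.simps) simp

lemma expansion_tree_EOr: "expansion_tree (EOr E F) \<longleftrightarrow> expansion_tree E \<and> expansion_tree F"
  by (subst expansion_tree.simps) simp

lemma expansion_tree_EEx: "expansion_tree (EEx A tEs) \<longleftrightarrow> no_vacuous (Ex A) \<and> tEs \<noteq> [] \<and>
    (\<forall>(t, E)\<in>set tEs. expansion_tree E \<and> sh E = inst A t)"
  by (subst expansion_tree.simps) auto

lemma expansion_tree_EAll: "expansion_tree (EAll A \<alpha> E) \<longleftrightarrow>
    no_vacuous (All A) \<and> expansion_tree E \<and> sh E = inst A (Var \<alpha>)"
  by (subst expansion_tree.simps) auto

text \<open>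
  All cuts with this formula have to be treated at once: an eigenvariable shared by two such cuts
  has its branch shortened in one of them and must not keep the long branch in the other.
\<close>

lemma propositional_reduction:
  assumes P: "expansion_proof P" and C0: "C0 \<in> set (cuts P)" "sh_cut C0 = Or A B"
  shows "\<exists>Q. reduces (Or A B) P Q"
proof -
  note P' = P[unfolded expansion_proof_iff]
  let ?f = "\<lambda>(E, F, E', F'). (EOr E F, EAnd E' F')"
  let ?is = "\<lambda>C. sh_cut C = Or A B"
  have "\<exists>d. C = ?f d" if C: "C \<in> set (cuts P)" "?is C" for C
  proof -
    have "is_cut C" using P' C by (simp add: well_formed_def)
    then have "sh (fst C) = Or A B" "sh (snd C) = And (dual A) (dual B)"
      using C(2) dual_dual[of "sh (snd C)"] by (auto simp: is_cut_def sh_cut_def)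
    then obtain E F E' F' where "fst C = EOr E F" "snd C = EAnd E' F'"
      using sh_OrE sh_AndE by blast
    then have "C = ?f (E, F, E', F')" by (simp add: prod_eq_iff)
    then show ?thesis by blast
  qed
  then have "\<exists>D. filter ?is (cuts P) = map ?f D"
    unfolding ex_map_conv by simp
  then obtain D where D: "filter ?is (cuts P) = map ?f D" ..
  define R where "R = (filter (\<lambda>C. \<not> ?is C) (cuts P), trees P)"
  let ?new = "\<lambda>(E, F, E', F'). [mk_cut E E', mk_cut F F']"
  define Q where "Q = (concat (map ?new D) @ cuts R, trees P)"
  have D_cut: "is_cut (EOr E F, EAnd E' F') \<and> (EOr E F, EAnd E' F') \<in> set (cuts P) \<and>
      sh E = A \<and> sh F = B \<and> sh E' = dual A \<and> sh F' = dual B" if "(E, F, E', F') \<in> set D" for E F E' F'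
  proof -
    have "(EOr E F, EAnd E' F') \<in> set (filter ?is (cuts P))"
      unfolding D using that by force
    then have "is_cut (EOr E F, EAnd E' F')" "(EOr E F, EAnd E' F') \<in> set (cuts P)"
      "sh_cut (EOr E F, EAnd E' F') = Or A B"
      using P' by (auto simp: well_formed_def)
    then show ?thesis by (auto simp: is_cut_def sh_cut_def)
  qed
  have R_cut: "C \<in> set (cuts P)" "is_cut C" "\<not> ?is C" if "C \<in> set (cuts R)" for C
    using that P' by (auto simp: R_def well_formed_def)
  have cuts_Q: "(\<exists>(E, F, E', F')\<in>set D. C = mk_cut E E' \<or> C = mk_cut F F') \<or> C \<in> set (cuts R)"
    if "C \<in> set (cuts Q)" for C
    using that by (auto simp: Q_def)
  have cuts_P: "set (cuts P) = ?f ` set D \<union> set (cuts R)"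
  proof -
    have "set (cuts P) = set (filter ?is (cuts P)) \<union> set (cuts R)" by (auto simp: R_def)
    then show ?thesis unfolding D set_map .
  qed
  have trees: "trees Q = trees P" "trees R = trees P" by (simp_all add: Q_def R_def)
  have wf: "well_formed Q"
  proof -
    have "is_cut C" if "C \<in> set (cuts Q)" for C
      using cuts_Q[OF that]
    proof
      assume "\<exists>(E, F, E', F')\<in>set D. C = mk_cut E E' \<or> C = mk_cut F F'"
      then obtain E F E' F' where d: "(E, F, E', F') \<in> set D" and C: "C = mk_cut E E' \<or> C = mk_cut F F'"
        by auto
      have "expansion_tree E" "expansion_tree F" "expansion_tree E'" "expansion_tree F'"
        "sh E' = dual (sh E)" "sh F' = dual (sh F)"
        using D_cut[OF d] by (auto simp: is_cut_def expansion_tree_EAnd expansion_tree_EOr)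
      with C is_cut_mk_cut show ?thesis by blast
    qed (rule R_cut)
    then show ?thesis using P' by (simp add: well_formed_def trees)
  qed
  have "prop_eval v (dp_cut C) \<Longrightarrow> \<exists>C\<in>set (cuts Q). prop_eval v (dp_cut C)"
    if C_P: "C \<in> set (cuts P)" for v C
  proof (cases "C \<in> set (cuts R)")
    case True
    then show "prop_eval v (dp_cut C) \<Longrightarrow> ?thesis" by (auto simp: Q_def)
  next
    case False
    assume v: "prop_eval v (dp_cut C)"
    obtain E F E' F' where d: "(E, F, E', F') \<in> set D" and C: "C = (EOr E F, EAnd E' F')"
      using False C_P unfolding cuts_P by auto
    have "set (?new (E, F, E', F')) \<subseteq> set (cuts Q)"
      unfolding Q_def using d by force
    then have "mk_cut E E' \<in> set (cuts Q)" "mk_cut F F' \<in> set (cuts Q)" by auto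
    moreover have "prop_eval v (dp_cut (mk_cut E E')) \<or> prop_eval v (dp_cut (mk_cut F F'))"
      unfolding prop_eval_mk_cut using v C by (auto simp: dp_cut_def)
    ultimately show ?thesis by blast
  qed
  then have taut: "tautology (dp_proof Q)"
    using P' unfolding tautology_dp_proof trees by blast
  have nodes: "\<exists>s0. (k, s0, G, \<alpha>) \<in> foralls_proof P \<and> s = strip 2 (Or A B) k s0 \<and> scope s G \<subseteq> scope s0 G"
    if n: "(k, s, G, \<alpha>) \<in> foralls_proof Q" for k s G \<alpha>
  proof -
    have "\<exists>s0. (k, s0, G, \<alpha>) \<in> foralls_proof P \<and> s = strip 2 (Or A B) k s0"
    proof (cases k)
      case False
      then show ?thesis using n by (auto simp: foralls_proof_iffs trees strip_def)
    next
      case True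
      then obtain C where C: "C \<in> set (cuts Q)" "(s, G, \<alpha>) \<in> foralls_cut C"
        using n by (auto simp: foralls_proof_iffs)
      from cuts_Q[OF C(1)] show ?thesis
      proof
        assume "C \<in> set (cuts R)"
        with C(2) True show ?thesis
          using R_cut[of C] strip_other_cut[of C "Or A B" s G \<alpha> 2 k]
          by (intro exI[of _ s]) (auto simp: foralls_proof_iffs)
      next
        assume "\<exists>(E, F, E', F')\<in>set D. C = mk_cut E E' \<or> C = mk_cut F F'"
        then obtain E F E' F' where d: "(E, F, E', F') \<in> set D" and C': "C = mk_cut E E' \<or> C = mk_cut F F'"
          by auto
        have sub: "foralls (EOr E F) \<union> foralls (EAnd E' F') \<subseteq> {n. (True, n) \<in> foralls_proof P}"
        proof -
          have "foralls_cut (EOr E F, EAnd E' F') \<subseteq> {n. (True, n) \<in> foralls_proof P}"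
            unfolding foralls_proof_iffs using D_cut[OF d] by blast
          then show ?thesis unfolding foralls_cut_def fst_conv snd_conv .
        qed
        have in_P: "n \<in> foralls (EOr E F) \<or> n \<in> foralls (EAnd E' F') \<Longrightarrow> (k, n) \<in> foralls_proof P" for n
          using sub True by auto
        have st: "s = strip 2 (Or A B) k (Inl (Or A B) # Inr n # s)"
          "s = strip 2 (Or A B) k (Inl (And (dual A) (dual B)) # Inr n # s)" for n
          using True by (simp_all add: strip_def)
        from C(2) C' consider "(s, G, \<alpha>) \<in> foralls E" | "(s, G, \<alpha>) \<in> foralls F"
          | "(s, G, \<alpha>) \<in> foralls E'" | "(s, G, \<alpha>) \<in> foralls F'"
          by (auto simp: foralls_cut_mk_cut)
        then show ?thesis
        proof cases
          case 1
          then have "(Inl (Or A B) # Inr 1 # s, G, \<alpha>) \<in> foralls (EOr E F)"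
            using D_cut[OF d] by (simp add: below_iff)
          then show ?thesis using in_P st by blast
        next
          case 2
          then have "(Inl (Or A B) # Inr 2 # s, G, \<alpha>) \<in> foralls (EOr E F)"
            using D_cut[OF d] by (simp add: below_iff)
          then show ?thesis using in_P st by blast
        next
          case 3
          then have "(Inl (And (dual A) (dual B)) # Inr 1 # s, G, \<alpha>) \<in> foralls (EAnd E' F')"
            using D_cut[OF d] by (simp add: below_iff)
          then show ?thesis using in_P st by blast
        next
          case 4
          then have "(Inl (And (dual A) (dual B)) # Inr 2 # s, G, \<alpha>) \<in> foralls (EAnd E' F')"
            using D_cut[OF d] by (simp add: below_iff)
          then show ?thesis using in_P st by blast
        qed
      qed
    qed
    then show ?thesis using scope_strip by blast
  qed
  have Q: "expansion_proof Q"
    using expansion_proof_transfer[OF P wf taut _ nodes] by (simp add: sh_proof_def trees)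
  have D_ne: "D \<noteq> []"
  proof
    assume "D = []"
    then have "C0 \<in> set (cuts R)" using C0 cuts_P by simp
    then show False using R_cut C0 by blast
  qed
  have mset_P: "mset (cuts P) = mset (map ?f D @ cuts R)"
    using mset_filter_split[of "cuts P" ?is] by (simp add: D R_def)
  have sh_D: "\<forall>(E, F, E', F')\<in>set D. sh (EOr E F) = Or A B"
    using D_cut by fastforce
  have "propositional_step P Q"
  proof (rule propositional_step.intros)
    show "D \<noteq> []" by (rule D_ne)
    show "mset (cuts P) = mset (map ?f D @ cuts R)" by (rule mset_P)
    show "\<forall>(E, F, E', F')\<in>set D. sh (EOr E F) = Or A B" by (rule sh_D)
    show "\<forall>C\<in>set (cuts R). sh_cut C \<noteq> Or A B" using R_cut(3) by blast
    show "mset (cuts Q) = mset (concat (map ?new D) @ cuts R)" by (simp only: Q_def fst_conv)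
    show "mset (trees P) = mset (trees R)" "mset (trees Q) = mset (trees R)" by (simp_all only: trees)
  qed
  with P Q have "cut_reduction P Q" by (simp add: cut_reduction_def)
  moreover have "G \<in> cut_formulas P - {Or A B} \<or> connectives G < connectives (Or A B)"
    if G: "G \<in> cut_formulas Q" for G
  proof -
    obtain C where C: "C \<in> set (cuts Q)" "G = sh_cut C"
      using G by (auto simp: cut_formulas_def)
    from cuts_Q[OF C(1)] show ?thesis
    proof
      assume "C \<in> set (cuts R)"
      then show ?thesis using R_cut[of C] C(2) by (auto simp: cut_formulas_def)
    next
      assume "\<exists>(E, F, E', F')\<in>set D. C = mk_cut E E' \<or> C = mk_cut F F'"
      then obtain E F E' F' where d: "(E, F, E', F') \<in> set D" and C': "C = mk_cut E E' \<or> C = mk_cut F F'"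
        by auto
      have "G \<in> {A, B, dual A, dual B}"
        using D_cut[OF d] C(2) C' sh_cut_mk_cut[of E E'] sh_cut_mk_cut[of F F'] by auto
      then have "connectives G < connectives (Or A B)" by auto
      then show ?thesis ..
    qed
  qed
  moreover have "set (sh_proof Q) = set (sh_proof P)"
    by (simp add: sh_proof_def trees)
  ultimately show ?thesis
    unfolding reduces_def by blast
qed

subsection \<open>The quantifier step\<close>

lemma eigenvars_renaming: "eigenvars (subst_tree (var_renaming \<eta>) E) = \<eta> ` eigenvars E"
  by (simp add: eigenvars_foralls foralls_subst image_image split_beta var_renaming_def)

lemma admissible_renaming:
  "admissible \<sigma> (subst_tree (var_renaming \<eta>) E) \<longleftrightarrow> admissible (\<lambda>x. \<sigma> (\<eta> x)) E"
  by (simp add: admissible_def eigenvars_renaming)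

text \<open>
  With \<open>b\<close> above all variables in \<open>V\<close> and \<open>Y\<close>, the \<open>i\<close>-th renaming moves
  \<open>Y\<close> into the interval from \<open>(i + 1) b\<close> to \<open>(i + 2) b\<close>; division by \<open>b\<close>
  recovers \<open>i\<close>.
\<close>

lemma ex_fresh_renamings:
  assumes "finite V" "finite Y"
  shows "\<exists>\<eta>. length \<eta> = l \<and> fresh_renamings V Y \<eta>"
proof -
  define b where "b = Suc (Max (insert 0 (V \<union> Y)))"
  have less: "x < b" if "x \<in> V \<union> Y" for x
    using that assms by (simp add: b_def less_Suc_eq_le)
  define \<eta> where "\<eta> = map (\<lambda>i x. if x \<in> Y then x + Suc i * b else x) [0..<l]"
  have len: "length \<eta> = l" by (simp add: \<eta>_def)
  have nth: "\<eta> ! i = (\<lambda>x. if x \<in> Y then x + Suc i * b else x)" if "i < l" for i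
  proof -
    have "[0..<l] ! i = i" using that by simp
    then show ?thesis using that by (simp only: \<eta>_def nth_map length_upt diff_zero)
  qed
  have index: "(\<eta> ! i) x div b = Suc i" if "i < l" "x \<in> Y" for i x
    using less[of x] that div_mult_self1[of b x "Suc i"] by (simp add: nth del: mult_Suc)
  have "fresh_renamings V Y \<eta>"
    unfolding fresh_renamings_def len
  proof (intro conjI allI impI)
    fix i
    assume i: "i < l"
    show "inj_on (\<eta> ! i) Y"
      by (simp add: nth[OF i] inj_on_def)
    show "(\<eta> ! i) ` Y \<inter> V = {}"
    proof -
      have "(\<eta> ! i) x \<notin> V" if x: "x \<in> Y" for x
        using index[OF i x] less[of "(\<eta> ! i) x"] by auto
      then show ?thesis by blast
    qed
    show "(\<eta> ! i) x = x" if "x \<notin> Y" for x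
      using that by (simp add: nth[OF i])
  next
    fix i j
    assume ij: "i < l" "j < l" "i \<noteq> j"
    have "(\<eta> ! i) x \<noteq> (\<eta> ! j) y" if xy: "x \<in> Y" "y \<in> Y" for x y
      using index[OF ij(1) xy(1)] index[OF ij(2) xy(2)] ij(3) by auto
    then show "(\<eta> ! i) ` Y \<inter> (\<eta> ! j) ` Y = {}" by blast
  qed
  with len show ?thesis by blast
qed

text \<open>
  The situation before a quantifier step: \<open>D\<close> lists the displayed cuts and \<open>R\<close> is the rest.
\<close>

locale quantifier_cuts =
  fixes P R :: "('f, 'p) eproof" and A :: "('f, 'p) fm"
    and D :: "(('f tm \<times> ('f, 'p) tree) list \<times> nat \<times> ('f, 'p) tree) list"
  assumes P: "expansion_proof P"
    and D_ne: "D \<noteq> []"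
    and mset_P: "mset (cuts P) = mset (map (\<lambda>(tEs, \<alpha>, F). (EEx A tEs, EAll (dual A) \<alpha> F)) D @ cuts R)"
    and trees_R: "trees R = trees P"
    and rest: "\<And>C. C \<in> set (cuts R) \<Longrightarrow> sh_cut C \<noteq> Ex A"
begin

text \<open>
  \<open>X\<close> consists of the eigenvariables to be instantiated and \<open>Y\<close> of those to be renamed.
\<close>

definition X :: "nat set" where "X = set (map (\<lambda>(tEs, \<alpha>, F). \<alpha>) D)"

definition tE :: "('f tm \<times> ('f, 'p) tree) list" where "tE = concat (map (\<lambda>(tEs, \<alpha>, F). tEs) D)"

definition Fs :: "('f, 'p) tree list" where "Fs = map (\<lambda>(tEs, \<alpha>, F). F) D"

definition Y :: "nat set" where
  "Y = dependents P X \<inter> (eigenvars_proof R \<union> (\<Union>F\<in>set Fs. eigenvars F))"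

lemma P_facts: "well_formed P" "coherent P" "\<exists>r. ranked r P" "tautology (dp_proof P)"
  "\<And>\<alpha> G. \<alpha> \<in> eigenvars_proof P \<Longrightarrow> G \<in> set (sh_proof P) \<Longrightarrow> \<alpha> \<notin> fv_fm G"
  using P by (simp_all add: expansion_proof_iff)

lemma P_coherent:
  "(k, s, B, \<beta>) \<in> foralls_proof P \<Longrightarrow> (k', s', B', \<beta>) \<in> foralls_proof P \<Longrightarrow> k = k' \<and> s = s' \<and> B = B'"
  using P_facts(2) unfolding coherent_def by blast

lemma set_cuts_P: "set (cuts P) = (\<lambda>(tEs, \<alpha>, F). (EEx A tEs, EAll (dual A) \<alpha> F)) ` set D \<union> set (cuts R)"
  using arg_cong[OF mset_P, of set_mset] by simp

lemma D_cut:
  assumes "(tEs, \<alpha>, F) \<in> set D"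
  shows "(EEx A tEs, EAll (dual A) \<alpha> F) \<in> set (cuts P)"
  using assms unfolding set_cuts_P by force

lemma D_facts:
  assumes "(tEs, \<alpha>, F) \<in> set D"
  shows "tEs \<noteq> []" "\<And>t E. (t, E) \<in> set tEs \<Longrightarrow> expansion_tree E \<and> sh E = inst A t"
    "expansion_tree F" "sh F = inst (dual A) (Var \<alpha>)" "0 \<in> fv_fm A"
proof -
  have "is_cut (EEx A tEs, EAll (dual A) \<alpha> F)"
    using D_cut[OF assms] P_facts(1) by (simp add: well_formed_def)
  then show "tEs \<noteq> []" "\<And>t E. (t, E) \<in> set tEs \<Longrightarrow> expansion_tree E \<and> sh E = inst A t"
    "expansion_tree F" "sh F = inst (dual A) (Var \<alpha>)" "0 \<in> fv_fm A"
    by (auto simp: is_cut_def expansion_tree_EEx expansion_tree_EAll)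
qed

lemma tE_source:
  assumes "i < length tE"
  shows "\<exists>tEs \<alpha> F. (tEs, \<alpha>, F) \<in> set D \<and> tE ! i \<in> set tEs"
proof -
  have "tE ! i \<in> set tE" using assms by simp
  then show ?thesis by (auto simp: tE_def)
qed

lemma tE_index:
  assumes "(tEs, \<alpha>, F) \<in> set D" "p \<in> set tEs"
  shows "\<exists>i<length tE. tE ! i = p"
proof -
  have "p \<in> set tE" using assms by (force simp: tE_def)
  then show ?thesis by (simp add: in_set_conv_nth)
qed

lemma tE_facts:
  assumes "i < length tE"
  shows "expansion_tree (snd (tE ! i))" "sh (snd (tE ! i)) = inst A (fst (tE ! i))"
    "fv_tm (fst (tE ! i)) \<subseteq> vars_proof P"
    "(s, B, \<beta>) \<in> foralls (snd (tE ! i)) \<Longrightarrow> (True, Inl (Ex A) # s, B, \<beta>) \<in> foralls_proof P"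
proof -
  obtain tEs \<alpha> F where d: "(tEs, \<alpha>, F) \<in> set D" and i: "(fst (tE ! i), snd (tE ! i)) \<in> set tEs"
    using tE_source[OF assms] by auto
  show "expansion_tree (snd (tE ! i))" "sh (snd (tE ! i)) = inst A (fst (tE ! i))"
    using D_facts(2)[OF d i] by auto
  have "fv_tm (fst (tE ! i)) \<subseteq> vars_tree (EEx A tEs)"
    using i by auto
  also have "\<dots> \<subseteq> vars_proof P"
    using D_cut[OF d] unfolding vars_proof_def by force
  finally show "fv_tm (fst (tE ! i)) \<subseteq> vars_proof P" .
  assume "(s, B, \<beta>) \<in> foralls (snd (tE ! i))"
  then have "(Inl (Ex A) # s, B, \<beta>) \<in> foralls (EEx A tEs)"
    using i by (auto simp: below_iff intro!: bexI[of _ "tE ! i"] split: prod.splits)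
  then have "(Inl (Ex A) # s, B, \<beta>) \<in> foralls_cut (EEx A tEs, EAll (dual A) \<alpha> F)"
    unfolding foralls_cut_def fst_conv by blast
  then show "(True, Inl (Ex A) # s, B, \<beta>) \<in> foralls_proof P"
    unfolding foralls_proof_iffs using D_cut[OF d] by blast
qed

lemma Fs_source: "F \<in> set Fs \<Longrightarrow> \<exists>tEs \<alpha>. (tEs, \<alpha>, F) \<in> set D"
  by (auto simp: Fs_def)

lemma EAll_foralls:
  assumes "(tEs, \<alpha>, F) \<in> set D" "n \<in> foralls (EAll (dual A) \<alpha> F)"
  shows "(True, n) \<in> foralls_proof P"
proof -
  have "n \<in> foralls_cut (EEx A tEs, EAll (dual A) \<alpha> F)"
    using assms(2) unfolding foralls_cut_def snd_conv by blast
  then show ?thesis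
    unfolding foralls_proof_iffs using D_cut[OF assms(1)] by blast
qed

lemma X_foralls:
  assumes "\<alpha> \<in> X"
  shows "(True, [], dual A, \<alpha>) \<in> foralls_proof P"
proof -
  obtain tEs F where "(tEs, \<alpha>, F) \<in> set D" using assms by (auto simp: X_def)
  then show ?thesis by (rule EAll_foralls) simp
qed

lemma X_eigenvars: "X \<subseteq> eigenvars_proof P"
  using X_foralls eigenvarI by blast

text \<open>
  Everything in \<open>F\<^sub>j\<close> is dominated by \<open>+\<^sup>\<alpha>\<^sup>j\<close>, so all eigenvariables of
  \<open>F\<^sub>j\<close> get renamed.
\<close>

lemma Fs_foralls:
  assumes "F \<in> set Fs" "(s, B, \<beta>) \<in> foralls F"
  shows "(True, Inl (All (dual A)) # s, B, \<beta>) \<in> foralls_proof P" "\<exists>\<alpha>\<in>X. (\<alpha>, \<beta>) \<in> vdep P" "\<beta> \<notin> X"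
proof -
  obtain tEs \<alpha> where d: "(tEs, \<alpha>, F) \<in> set D" using Fs_source[OF assms(1)] by blast
  show n: "(True, Inl (All (dual A)) # s, B, \<beta>) \<in> foralls_proof P"
    using d assms(2) by (intro EAll_foralls) (simp_all add: below_iff)
  have \<alpha>: "\<alpha> \<in> X" using d by (force simp: X_def)
  have "\<alpha> \<in> fv_fm (sh F)"
    using D_facts[OF d] by (simp add: fv_inst)
  also have "\<dots> \<subseteq> scope s B" by (rule foralls_scope_sh[OF assms(2)])
  also have "\<dots> \<subseteq> scope (Inl (All (dual A)) # s) B" by (auto simp: scope_def)
  finally have "(\<alpha>, \<beta>) \<in> vdep P"
    using n \<alpha> X_eigenvars unfolding vdep_def by blast
  with \<alpha> show "\<exists>\<alpha>\<in>X. (\<alpha>, \<beta>) \<in> vdep P" by blast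
  show "\<beta> \<notin> X"
    using P_coherent[OF n X_foralls] by auto
qed

lemma R_cuts: "C \<in> set (cuts R) \<Longrightarrow> C \<in> set (cuts P) \<and> is_cut C"
  using P_facts(1) by (simp add: set_cuts_P well_formed_def)

lemma R_foralls:
  assumes "(k, s, B, \<beta>) \<in> foralls_proof R"
  shows "(k, s, B, \<beta>) \<in> foralls_proof P" "strip 1 (Ex A) k s = s"
proof -
  show "(k, s, B, \<beta>) \<in> foralls_proof P"
    using assms unfolding foralls_proof_def trees_R set_cuts_P by auto
  show "strip 1 (Ex A) k s = s"
  proof (cases k)
    case True
    then obtain C where C: "C \<in> set (cuts R)" "(s, B, \<beta>) \<in> foralls_cut C"
      using assms by (auto simp: foralls_proof_iffs)
    then show ?thesis
      using True strip_other_cut[of C "Ex A" s B \<beta> 1] R_cuts[OF C(1)] rest[OF C(1)] by simp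
  qed (simp add: strip_def)
qed

lemma R_eigenvars: "eigenvars_proof R \<subseteq> eigenvars_proof P"
  unfolding subset_eq Ball_def using R_foralls(1) eigenvarI eigenvar_proof_iff by metis

text \<open>
  The side condition on the displayed eigenvariables holds automatically: by coherence another
  occurrence would be at the root of a cut as well, with the same formula \<open>\<forall>x dual A\<close>, and that
  cut would be displayed.
\<close>

lemma X_not_R: "X \<inter> eigenvars_proof R = {}"
proof -
  have False if \<alpha>: "\<alpha> \<in> X" and n: "(k, s, B, \<alpha>) \<in> foralls_proof R" for \<alpha> k s B
  proof -
    have eq: "k = True \<and> s = [] \<and> B = dual A"
      using P_coherent[OF R_foralls(1)[OF n] X_foralls[OF \<alpha>]] by simp
    then obtain C where C: "C \<in> set (cuts R)" "([], dual A, \<alpha>) \<in> foralls_cut C"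
      using n by (auto simp: foralls_proof_iffs)
    then have "sh (fst C) = All (dual A) \<or> sh (snd C) = All (dual A)"
      using foralls_Nil unfolding foralls_cut_def by blast
    then have "sh_cut C = Ex A"
      using R_cuts[OF C(1)] by (auto simp: is_cut_def sh_cut_def)
    with rest[OF C(1)] show False by blast
  qed
  then show ?thesis by (auto simp: eigenvar_proof_iff)
qed

lemma Y_eigenvars: "Y \<subseteq> eigenvars_proof P"
proof -
  have "\<beta> \<in> eigenvars_proof P" if F: "F \<in> set Fs" "\<beta> \<in> eigenvars F" for F \<beta>
    using Fs_foralls(1)[OF F(1)] F(2) unfolding eigenvar_iff eigenvar_proof_iff by blast
  then show ?thesis using R_eigenvars unfolding Y_def by blast
qed

lemma X_Y_disjoint: "X \<inter> Y = {}"
proof -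
  have "\<beta> \<notin> X" if F: "F \<in> set Fs" "\<beta> \<in> eigenvars F" for F \<beta>
    using Fs_foralls(3)[OF F(1)] F(2) unfolding eigenvar_iff by blast
  then show ?thesis using X_not_R unfolding Y_def by blast
qed

lemma X_Y_vdep:
  assumes "\<beta> \<in> X \<union> Y"
  shows "\<exists>\<alpha>\<in>X. (\<alpha>, \<beta>) \<in> (vdep P)\<^sup>*"
  using assms
proof
  assume "\<beta> \<in> Y"
  then have "\<beta> \<in> dependents P X" by (simp add: Y_def)
  then show ?thesis
    unfolding dependents_eq[OF P X_eigenvars] by (auto intro: trancl_into_rtrancl)
qed auto

lemma dependent_of_scope:
  assumes n: "(k, s, B, \<gamma>) \<in> foralls_proof P" and \<beta>: "\<beta> \<in> X \<union> Y" "\<beta> \<in> scope s B"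
  shows "\<gamma> \<in> dependents P X"
proof -
  obtain \<alpha> where \<alpha>: "\<alpha> \<in> X" "(\<alpha>, \<beta>) \<in> (vdep P)\<^sup>*" using X_Y_vdep[OF \<beta>(1)] by blast
  have "\<beta> \<in> eigenvars_proof P" using \<beta>(1) X_eigenvars Y_eigenvars by blast
  then have "(\<beta>, \<gamma>) \<in> vdep P" using n \<beta>(2) unfolding vdep_def by blast
  with \<alpha>(2) have "(\<alpha>, \<gamma>) \<in> (vdep P)\<^sup>+" by (rule rtrancl_into_trancl1)
  with \<alpha>(1) show ?thesis unfolding dependents_eq[OF P X_eigenvars] by blast
qed

text \<open>
  A universal node that keeps its eigenvariable in the copies also keeps its branch: if a moved
  variable occurred there, the eigenvariable would depend on \<open>X\<close> and be renamed.  Without this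
  the copies would violate weak regularity.
\<close>

lemma R_scope_clean:
  assumes "(k, s, B, \<gamma>) \<in> foralls_proof R" "\<gamma> \<notin> Y" "\<beta> \<in> scope s B"
  shows "\<beta> \<notin> X \<union> Y"
proof
  assume "\<beta> \<in> X \<union> Y"
  then have "\<gamma> \<in> dependents P X"
    using dependent_of_scope R_foralls(1)[OF assms(1)] assms(3) by blast
  moreover have "\<gamma> \<in> eigenvars_proof R"
    using assms(1) unfolding eigenvar_proof_iff by blast
  ultimately show False using assms(2) by (simp add: Y_def)
qed

text \<open>
  An eigenvariable of the cut formula is below every \<open>\<alpha> \<in> X\<close>, since \<open>\<alpha>\<close> sits at the root
  of a cut with this formula, and every moved variable equals or depends on some \<open>\<alpha> \<in> X\<close>.
  Besides the choice of the cut formula, this gives that the cut formula itself is not affected by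
  the substitutions.
\<close>

lemma cut_formula_below:
  assumes r: "ranked r P" and \<beta>: "\<beta> \<in> X \<union> Y"
  shows "height r (fv_fm (Ex A) \<inter> eigenvars_proof P) \<le> r \<beta>"
proof -
  obtain \<alpha> where \<alpha>: "\<alpha> \<in> X" "(\<alpha>, \<beta>) \<in> (vdep P)\<^sup>*" using X_Y_vdep[OF \<beta>] by blast
  have "r \<alpha> \<le> r \<beta>"
    using \<alpha>(2) ranked_trancl[OF _ r, of \<alpha> \<beta>] by (auto simp: rtrancl_eq_or_trancl)
  moreover have "r \<gamma> < r \<alpha>" if "\<gamma> \<in> fv_fm (Ex A) \<inter> eigenvars_proof P" for \<gamma>
  proof -
    have "(\<gamma>, \<alpha>) \<in> vdep P"
      using that X_foralls[OF \<alpha>(1)] unfolding vdep_def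
      by (auto simp: scope_def intro!: exI[of _ True] exI[of _ "[]"] exI[of _ "dual A"])
    with r show ?thesis by (auto simp: ranked_def)
  qed
  ultimately show ?thesis
    using finite_eigenvars_proof[of P] by (subst height_le_iff) (auto intro: less_le_trans)
qed

lemma cut_formula_clean:
  assumes "\<beta> \<in> fv_fm (Ex A)"
  shows "\<beta> \<notin> X \<union> Y"
proof
  assume \<beta>: "\<beta> \<in> X \<union> Y"
  obtain r where r: "ranked r P" using P_facts(3) by blast
  have "\<beta> \<in> fv_fm (Ex A) \<inter> eigenvars_proof P"
    using \<beta> assms X_eigenvars Y_eigenvars by blast
  then have "r \<beta> < height r (fv_fm (Ex A) \<inter> eigenvars_proof P)"
    using finite_eigenvars_proof[of P] by (intro height_greater) auto
  with cut_formula_below[OF r \<beta>] show False by simp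
qed

end

locale quantifier_reduction = quantifier_cuts P R A D
  for P R :: "('f, 'p) eproof" and A :: "('f, 'p) fm"
    and D :: "(('f tm \<times> ('f, 'p) tree) list \<times> nat \<times> ('f, 'p) tree) list" +
  fixes \<eta> :: "(nat \<Rightarrow> nat) list"
  assumes length_\<eta>: "length \<eta> = length tE"
    and fresh: "fresh_renamings (vars_proof P) Y \<eta>"
begin

text \<open>
  The substitution \<open>\<eta>\<^sub>i \<sigma>\<^sub>i\<close> in one piece; its values do not get substituted again because the
  new names are not in \<open>X\<close>.
\<close>

definition \<theta> :: "nat \<Rightarrow> nat \<Rightarrow> 'f tm" where
  "\<theta> i = (\<lambda>x. subst_all X (fst (tE ! i)) ((\<eta> ! i) x))"

definition Q :: "('f, 'p) eproof" where
  "Q = (concat (map (\<lambda>i. map (\<lambda>F. mk_cut (snd (tE ! i)) (subst_tree (\<theta> i) F)) Fs) [0..<length tE]) @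
        cuts R @ concat (map (\<lambda>i. map (subst_cut (\<theta> i)) (cuts R)) [0..<length tE]),
        trees R @ concat (map (\<lambda>i. map (subst_tree (\<theta> i)) (trees R)) [0..<length tE]))"

lemma \<eta>_facts:
  assumes "i < length tE"
  shows "inj_on (\<eta> ! i) Y" "\<beta> \<in> Y \<Longrightarrow> (\<eta> ! i) \<beta> \<notin> vars_proof P" "\<beta> \<notin> Y \<Longrightarrow> (\<eta> ! i) \<beta> = \<beta>"
  using fresh assms unfolding fresh_renamings_def length_\<eta> by blast+

lemma \<eta>_inject:
  assumes "i < length tE" "j < length tE" "\<beta> \<in> Y" "\<gamma> \<in> Y" "(\<eta> ! i) \<beta> = (\<eta> ! j) \<gamma>"
  shows "i = j" "\<beta> = \<gamma>"
proof -
  show "i = j"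
    using fresh assms unfolding fresh_renamings_def length_\<eta> by blast
  then show "\<beta> = \<gamma>"
    using \<eta>_facts(1)[OF assms(1)] assms by (auto dest: inj_onD)
qed

lemma X_vars: "X \<subseteq> vars_proof P"
  using X_eigenvars eigenvars_vars_proof by blast

lemma \<theta>_simps:
  assumes "i < length tE"
  shows "\<beta> \<in> Y \<Longrightarrow> \<theta> i \<beta> = Var ((\<eta> ! i) \<beta>)" "\<beta> \<in> X \<Longrightarrow> \<theta> i \<beta> = fst (tE ! i)"
    "\<beta> \<notin> X \<union> Y \<Longrightarrow> \<theta> i \<beta> = Var \<beta>"
proof -
  show "\<beta> \<in> Y \<Longrightarrow> \<theta> i \<beta> = Var ((\<eta> ! i) \<beta>)"
    using \<eta>_facts(2)[OF assms] X_vars by (auto simp: \<theta>_def subst_all_def)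
  show "\<beta> \<in> X \<Longrightarrow> \<theta> i \<beta> = fst (tE ! i)"
  proof -
    assume \<beta>: "\<beta> \<in> X"
    then have "\<beta> \<notin> Y" using X_Y_disjoint by blast
    with \<beta> show "\<theta> i \<beta> = fst (tE ! i)"
      using \<eta>_facts(3)[OF assms, of \<beta>] by (simp add: \<theta>_def subst_all_def)
  qed
  show "\<beta> \<notin> X \<union> Y \<Longrightarrow> \<theta> i \<beta> = Var \<beta>"
    using \<eta>_facts(3)[OF assms, of \<beta>] by (auto simp: \<theta>_def subst_all_def)
qed

lemma \<theta>_Var: "i < length tE \<Longrightarrow> \<beta> \<notin> X \<Longrightarrow> \<exists>\<gamma>. \<theta> i \<beta> = Var \<gamma>"
  using \<theta>_simps(1,3)[of i \<beta>] by blast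

lemma cuts_Q_cases:
  assumes "C \<in> set (cuts Q)"
  obtains (reduct) i F where "i < length tE" "F \<in> set Fs" "C = mk_cut (snd (tE ! i)) (subst_tree (\<theta> i) F)"
    | (kept) "C \<in> set (cuts R)"
    | (copy) i C' where "i < length tE" "C' \<in> set (cuts R)" "C = subst_cut (\<theta> i) C'"
  using assms by (auto simp: Q_def)

lemma trees_Q_cases:
  assumes "E \<in> set (trees Q)"
  obtains (kept) "E \<in> set (trees R)"
    | (copy) i E' where "i < length tE" "E' \<in> set (trees R)" "E = subst_tree (\<theta> i) E'"
  using assms by (auto simp: Q_def)

lemma admissible_Fs: "i < length tE \<Longrightarrow> F \<in> set Fs \<Longrightarrow> admissible (\<theta> i) F"
  unfolding admissible_def eigenvar_iff Ball_def using Fs_foralls(3) \<theta>_Var by blast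

lemma admissible_R_cut:
  assumes "i < length tE" "C \<in> set (cuts R)"
  shows "admissible_cut (\<theta> i) C"
proof -
  have "eigenvars_cut C \<subseteq> eigenvars_proof R"
    using assms(2) by (auto simp: eigenvars_proof_def)
  then show ?thesis
    using X_not_R \<theta>_Var[OF assms(1)]
    unfolding admissible_cut_def admissible_def eigenvars_cut_def by blast
qed

lemma admissible_R_tree:
  assumes "i < length tE" "E \<in> set (trees R)"
  shows "admissible (\<theta> i) E"
proof -
  have "eigenvars E \<subseteq> eigenvars_proof R"
    using assms(2) by (auto simp: eigenvars_proof_def)
  then show ?thesis
    using X_not_R \<theta>_Var[OF assms(1)] unfolding admissible_def by blast
qed

text \<open>
  The new cuts match because \<open>\<theta> i\<close> fixes the body of the cut formula and sends each
  \<open>\<alpha>\<^sub>j\<close> to \<open>t\<^sub>i\<close>.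
\<close>

lemma sh_instance:
  assumes "i < length tE" "F \<in> set Fs"
  shows "sh (subst_tree (\<theta> i) F) = dual (sh (snd (tE ! i)))"
proof -
  obtain tEs \<alpha> where d: "(tEs, \<alpha>, F) \<in> set D" using Fs_source[OF assms(2)] by blast
  then have \<alpha>: "\<alpha> \<in> X" by (force simp: X_def)
  have "subst_fm (\<theta> i) (Ex A) = Ex A"
    using cut_formula_clean \<theta>_simps(3)[OF assms(1)] by (intro subst_fm_ident) blast
  then have "subst_fm (lift_subst (\<theta> i)) A = A" by simp
  then show ?thesis
    using D_facts(4)[OF d] \<theta>_simps(2)[OF assms(1) \<alpha>] tE_facts(2)[OF assms(1)]
    by (simp add: sh_subst inst_dual subst_dual subst_inst)
qed

lemma well_formed_Q: "well_formed Q"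
proof -
  have "is_cut C" if "C \<in> set (cuts Q)" for C
    using that
  proof (cases rule: cuts_Q_cases)
    case (reduct i F)
    obtain tEs \<alpha> where d: "(tEs, \<alpha>, F) \<in> set D" using Fs_source[OF reduct(2)] by blast
    have "expansion_tree (subst_tree (\<theta> i) F)"
      using D_facts(3)[OF d] admissible_Fs[OF reduct(1,2)] by (rule expansion_tree_subst)
    then show ?thesis
      using reduct tE_facts(1)[OF reduct(1)] sh_instance[OF reduct(1,2)] is_cut_mk_cut by blast
  next
    case (copy i C')
    then show ?thesis
      using R_cuts[OF copy(2)] admissible_R_cut[OF copy(1,2)]
      by (auto simp: is_cut_def subst_cut_def admissible_cut_def sh_subst subst_dual
          intro: expansion_tree_subst)
  qed (simp add: R_cuts)
  moreover have "expansion_tree E" if "E \<in> set (trees Q)" for E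
    using that
  proof (cases rule: trees_Q_cases)
    case (copy i E')
    then show ?thesis
      using P_facts(1) admissible_R_tree[OF copy(1,2)] trees_R
      by (auto simp: well_formed_def intro: expansion_tree_subst)
  qed (use P_facts(1) trees_R in \<open>simp add: well_formed_def\<close>)
  ultimately show ?thesis by (simp add: well_formed_def)
qed

text \<open>
  A universal node \<open>(s', B', \<gamma>)\<close> of the reduct comes from \<open>(s, B, \<beta>)\<close> in one of two ways:
  with the same eigenvariable, and then with the same branch up to its initial formula, or from the
  \<open>i\<close>-th copy with a renamed eigenvariable.
\<close>

definition origin :: "bool \<Rightarrow> ('f, 'p) branch \<Rightarrow> ('f, 'p) fm \<Rightarrow> nat \<Rightarrow>
    ('f, 'p) branch \<Rightarrow> ('f, 'p) fm \<Rightarrow> nat \<Rightarrow> bool" where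
  "origin k s' B' \<gamma> s B \<beta> \<longleftrightarrow> (k, s, B, \<beta>) \<in> foralls_proof P \<and>
     (\<gamma> = \<beta> \<and> B' = B \<and> s' = strip 1 (Ex A) k s \<or>
      (\<exists>i<length tE. \<beta> \<in> Y \<and> \<gamma> = (\<eta> ! i) \<beta> \<and> B' = subst_fm (lift_subst (\<theta> i)) B \<and>
         s' = subst_branch (\<theta> i) (strip 1 (Ex A) k s)))"

lemma origin_copy:
  assumes i: "i < length tE" and n: "(k, s, B, \<beta>) \<in> foralls_proof R"
    and eq: "(s', B', \<gamma>) = (subst_branch (\<theta> i) s, subst_fm (lift_subst (\<theta> i)) B, THE \<gamma>. \<theta> i \<beta> = Var \<gamma>)"
  shows "origin k s' B' \<gamma> s B \<beta>"
proof (cases "\<beta> \<in> Y")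
  case True
  then show ?thesis
    using i eq R_foralls[OF n] \<theta>_simps(1)[OF i True] unfolding origin_def by auto
next
  case False
  have "\<beta> \<notin> X" using X_not_R eigenvarI[OF n] by blast
  with False have "\<gamma> = \<beta>" using eq \<theta>_simps(3)[OF i, of \<beta>] by simp
  moreover have clean: "\<theta> i x = Var x" if "x \<in> scope s B" for x
    using R_scope_clean[OF n False that] \<theta>_simps(3)[OF i] by blast
  then have "subst_branch (\<theta> i) s = s"
    by (intro subst_branch_ident) (simp add: scope_def)
  moreover have "subst_fm (\<theta> i) (All B) = All B"
    using clean by (intro subst_fm_ident) (simp add: scope_def)
  ultimately show ?thesis
    using eq R_foralls[OF n] unfolding origin_def by simp
qed

lemma origin_Q:
  assumes "(k, s', B', \<gamma>) \<in> foralls_proof Q"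
  shows "\<exists>s B \<beta>. origin k s' B' \<gamma> s B \<beta>"
proof (cases k)
  case False
  then obtain E where E: "E \<in> set (trees Q)" "(s', B', \<gamma>) \<in> foralls E"
    using assms by (auto simp: foralls_proof_iffs)
  show ?thesis
    using E(1)
  proof (cases rule: trees_Q_cases)
    case kept
    then have n: "(k, s', B', \<gamma>) \<in> foralls_proof R"
      using E(2) False by (auto simp: foralls_proof_iffs)
    show ?thesis using R_foralls[OF n] unfolding origin_def by metis
  next
    case (copy i E')
    obtain s B \<beta> where n: "(s, B, \<beta>) \<in> foralls E'" and
      eq: "(s', B', \<gamma>) = (subst_branch (\<theta> i) s, subst_fm (lift_subst (\<theta> i)) B, THE \<gamma>. \<theta> i \<beta> = Var \<gamma>)"
      using E(2) unfolding copy(3) foralls_subst by auto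
    have "(k, s, B, \<beta>) \<in> foralls_proof R"
      using n copy(2) False by (auto simp: foralls_proof_iffs)
    then show ?thesis using origin_copy[OF copy(1) _ eq] by blast
  qed
next
  case True
  then obtain C where C: "C \<in> set (cuts Q)" "(s', B', \<gamma>) \<in> foralls_cut C"
    using assms by (auto simp: foralls_proof_iffs)
  show ?thesis
    using C(1)
  proof (cases rule: cuts_Q_cases)
    case kept
    then have n: "(k, s', B', \<gamma>) \<in> foralls_proof R"
      using C(2) True by (auto simp: foralls_proof_iffs)
    show ?thesis using R_foralls[OF n] unfolding origin_def by metis
  next
    case (copy i C')
    obtain s B \<beta> where n: "(s, B, \<beta>) \<in> foralls_cut C'" and
      eq: "(s', B', \<gamma>) = (subst_branch (\<theta> i) s, subst_fm (lift_subst (\<theta> i)) B, THE \<gamma>. \<theta> i \<beta> = Var \<gamma>)"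
      using C(2) unfolding copy(3) foralls_cut_def subst_cut_def fst_conv snd_conv foralls_subst by auto
    have "(k, s, B, \<beta>) \<in> foralls_proof R"
      using n copy(2) True by (auto simp: foralls_proof_iffs)
    then show ?thesis using origin_copy[OF copy(1) _ eq] by blast
  next
    case (reduct i F)
    have "(s', B', \<gamma>) \<in> foralls (snd (tE ! i)) \<or> (s', B', \<gamma>) \<in> foralls (subst_tree (\<theta> i) F)"
      using C(2) unfolding reduct(3) foralls_cut_mk_cut by blast
    then show ?thesis
    proof
      assume "(s', B', \<gamma>) \<in> foralls (snd (tE ! i))"
      then have "(k, Inl (Ex A) # s', B', \<gamma>) \<in> foralls_proof P"
        using tE_facts(4)[OF reduct(1)] True by simp
      moreover have "s' = strip 1 (Ex A) k (Inl (Ex A) # s')"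
        using True by (simp add: strip_def)
      ultimately show ?thesis unfolding origin_def by blast
    next
      assume "(s', B', \<gamma>) \<in> foralls (subst_tree (\<theta> i) F)"
      then obtain s B \<beta> where n: "(s, B, \<beta>) \<in> foralls F" and
        eq: "s' = subst_branch (\<theta> i) s" "B' = subst_fm (lift_subst (\<theta> i)) B" "\<gamma> = (THE \<gamma>. \<theta> i \<beta> = Var \<gamma>)"
        unfolding foralls_subst by auto
      have "\<exists>\<alpha>\<in>X. (\<alpha>, \<beta>) \<in> (vdep P)\<^sup>+"
        using Fs_foralls(2)[OF reduct(2) n] by blast
      then have Y: "\<beta> \<in> Y"
        using n reduct(2) dependents_eq[OF P X_eigenvars] by (auto simp: Y_def eigenvar_iff)
      have "(k, Inl (All (dual A)) # s, B, \<beta>) \<in> foralls_proof P"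
        using Fs_foralls(1)[OF reduct(2) n] True by simp
      moreover have "s = strip 1 (Ex A) k (Inl (All (dual A)) # s)"
        using True by (simp add: strip_def)
      moreover have "\<gamma> = (\<eta> ! i) \<beta>"
        using eq(3) \<theta>_simps(1)[OF reduct(1) Y] by simp
      ultimately show ?thesis
        using Y reduct(1) eq(1,2) unfolding origin_def by metis
    qed
  qed
qed

lemma eigenvars_Q:
  assumes "\<gamma> \<in> eigenvars_proof Q"
  shows "\<gamma> \<in> eigenvars_proof P \<or> (\<exists>i<length tE. \<exists>\<beta>\<in>Y. \<gamma> = (\<eta> ! i) \<beta>)"
proof -
  obtain k s' B' where "(k, s', B', \<gamma>) \<in> foralls_proof Q"
    using assms by (auto simp: eigenvar_proof_iff)
  then obtain s B \<beta> where "origin k s' B' \<gamma> s B \<beta>" using origin_Q by blast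
  then show ?thesis unfolding origin_def eigenvar_proof_iff by blast
qed

text \<open>
  Old and fresh names are disjoint, and a fresh name determines both its copy and the old name.
  So equal eigenvariables in the reduct have origins at the same node of \<open>P\<close> and in the same copy.
\<close>

lemma coherent_Q: "coherent Q"
  unfolding coherent_def
proof (intro allI impI)
  fix k s' B' k2 s2' B2' \<gamma>
  assume n: "(k, s', B', \<gamma>) \<in> foralls_proof Q" "(k2, s2', B2', \<gamma>) \<in> foralls_proof Q"
  obtain s B \<beta> s2 B2 \<beta>2 where o: "origin k s' B' \<gamma> s B \<beta>" "origin k2 s2' B2' \<gamma> s2 B2 \<beta>2"
    using origin_Q[OF n(1)] origin_Q[OF n(2)] by blast
  have P1: "(k, s, B, \<beta>) \<in> foralls_proof P" and P2: "(k2, s2, B2, \<beta>2) \<in> foralls_proof P"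
    using o unfolding origin_def by auto
  have vars: "\<beta> \<in> vars_proof P" "\<beta>2 \<in> vars_proof P"
    using P1 P2 foralls_proof_vars(2) by blast+
  have same: "k = k2 \<and> s = s2 \<and> B = B2" if "\<beta> = \<beta>2"
    using P_coherent[OF P1] P2 that by blast
  from o consider
      (kept) "\<gamma> = \<beta>" "B' = B" "s' = strip 1 (Ex A) k s" "\<gamma> = \<beta>2" "B2' = B2" "s2' = strip 1 (Ex A) k2 s2"
    | (mixed) i where "i < length tE" "\<gamma> = \<beta> \<and> \<gamma> = (\<eta> ! i) \<beta>2 \<and> \<beta>2 \<in> Y \<or> \<gamma> = \<beta>2 \<and> \<gamma> = (\<eta> ! i) \<beta> \<and> \<beta> \<in> Y"
    | (renamed) i j where "i < length tE" "j < length tE" "\<beta> \<in> Y" "\<beta>2 \<in> Y" "\<gamma> = (\<eta> ! i) \<beta>" "\<gamma> = (\<eta> ! j) \<beta>2"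
        "B' = subst_fm (lift_subst (\<theta> i)) B" "s' = subst_branch (\<theta> i) (strip 1 (Ex A) k s)"
        "B2' = subst_fm (lift_subst (\<theta> j)) B2" "s2' = subst_branch (\<theta> j) (strip 1 (Ex A) k2 s2)"
    unfolding origin_def by blast
  then show "k = k2 \<and> s' = s2' \<and> B' = B2'"
  proof cases
    case kept
    then show ?thesis using same by simp
  next
    case mixed
    then show ?thesis using \<eta>_facts(2)[OF mixed(1)] vars by metis
  next
    case renamed
    have "i = j" "\<beta> = \<beta>2"
      using \<eta>_inject[OF renamed(1,2,3,4)] renamed(5,6) by auto
    then show ?thesis using renamed(7-) same by simp
  qed
qed

text \<open>
  Ranking all fresh eigenvariables above all old ones works: old eigenvariables keep their
  branches, where no fresh name occurs.  In a branch of the \<open>i\<close>-th copy, fresh names come from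
  that copy only, because the terms \<open>t\<^sub>i\<close> contain old variables only, and there the old ranks
  decide.
\<close>

lemma ex_ranked_Q: "\<exists>r. ranked r Q"
proof -
  obtain r where r: "ranked r P" using P_facts(3) by blast
  define M where "M = height r (eigenvars_proof P)"
  have M: "r \<beta> < M" if "\<beta> \<in> eigenvars_proof P" for \<beta>
    using that finite_eigenvars_proof unfolding M_def by (intro height_greater)
  define old where "old \<gamma> = (THE \<beta>. \<beta> \<in> Y \<and> (\<exists>i<length tE. \<gamma> = (\<eta> ! i) \<beta>))" for \<gamma>
  define r' where "r' \<gamma> = (if \<gamma> \<in> vars_proof P then r \<gamma> else M + r (old \<gamma>))" for \<gamma>
  have old: "old ((\<eta> ! i) \<beta>) = \<beta>" if "i < length tE" "\<beta> \<in> Y" for i \<beta>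
    unfolding old_def
  proof (rule the_equality)
    show "\<beta> \<in> Y \<and> (\<exists>j<length tE. (\<eta> ! i) \<beta> = (\<eta> ! j) \<beta>)" using that by blast
    show "\<gamma> = \<beta>" if "\<gamma> \<in> Y \<and> (\<exists>j<length tE. (\<eta> ! i) \<beta> = (\<eta> ! j) \<gamma>)" for \<gamma>
      using that \<eta>_inject(2)[OF \<open>i < length tE\<close> _ \<open>\<beta> \<in> Y\<close>] by blast
  qed
  have r'_kept: "r' \<beta> = r \<beta>" if "\<beta> \<in> vars_proof P" for \<beta>
    using that by (simp add: r'_def)
  have r'_new: "r' ((\<eta> ! i) \<beta>) = M + r \<beta>" if "i < length tE" "\<beta> \<in> Y" for i \<beta>
    using that \<eta>_facts(2)[of i \<beta>] old[of i \<beta>] by (simp add: r'_def)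
  have P_vdep: "r \<delta> < r \<beta>"
    if "(k, s, B, \<beta>) \<in> foralls_proof P" "\<delta> \<in> scope s B" "\<delta> \<in> eigenvars_proof P" for k s B \<beta> \<delta>
    using that r unfolding ranked_def vdep_def by blast
  have new: "\<delta> \<in> eigenvars_proof P" if "\<delta> \<in> eigenvars_proof Q" "\<delta> \<in> vars_proof P" for \<delta>
    using eigenvars_Q[OF that(1)] that(2) \<eta>_facts(2) by blast
  have "r' \<delta> < r' \<gamma>" if dep: "(\<delta>, \<gamma>) \<in> vdep Q" for \<delta> \<gamma>
  proof -
    obtain k s' B' where \<delta>: "\<delta> \<in> eigenvars_proof Q" "\<delta> \<in> scope s' B'"
      and n: "(k, s', B', \<gamma>) \<in> foralls_proof Q"
      using dep by (auto simp: vdep_def)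
    obtain s B \<beta> where o: "origin k s' B' \<gamma> s B \<beta>" using origin_Q[OF n] by blast
    then have nP: "(k, s, B, \<beta>) \<in> foralls_proof P" by (simp add: origin_def)
    note vars = foralls_proof_vars[OF nP]
    from o consider (kept) "\<gamma> = \<beta>" "B' = B" "s' = strip 1 (Ex A) k s"
      | (renamed) i where "i < length tE" "\<beta> \<in> Y" "\<gamma> = (\<eta> ! i) \<beta>" "B' = subst_fm (lift_subst (\<theta> i)) B"
        "s' = subst_branch (\<theta> i) (strip 1 (Ex A) k s)"
      unfolding origin_def by blast
    then show ?thesis
    proof cases
      case kept
      have "\<delta> \<in> scope s B" using \<delta>(2) scope_strip unfolding kept(2,3) by blast
      moreover from this have "\<delta> \<in> vars_proof P" using vars(1) by blast
      ultimately show ?thesis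
        using P_vdep[OF nP] new[OF \<delta>(1)] vars(2) kept(1) by (simp add: r'_kept)
    next
      case renamed
      obtain x where x: "x \<in> scope s B" "\<delta> \<in> fv_tm (\<theta> i x)"
        using \<delta>(2) scope_strip unfolding renamed(4,5) scope_subst by blast
      show ?thesis
      proof (cases "x \<in> Y")
        case True
        then have "\<delta> = (\<eta> ! i) x" using x(2) \<theta>_simps(1)[OF renamed(1)] by simp
        moreover have "r x < r \<beta>"
          using P_vdep[OF nP x(1)] True Y_eigenvars by blast
        ultimately show ?thesis
          using True renamed(1-3) by (simp add: r'_new)
      next
        case False
        have "\<delta> \<in> vars_proof P"
        proof (cases "x \<in> X")
          case True
          then show ?thesis
            using x(2) \<theta>_simps(2)[OF renamed(1)] tE_facts(3)[OF renamed(1)] by auto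
        next
          case False
          with \<open>x \<notin> Y\<close> have "\<delta> = x" using x(2) \<theta>_simps(3)[OF renamed(1)] by simp
          then show ?thesis using x(1) vars(1) by blast
        qed
        then have "r' \<delta> < M" using M[OF new[OF \<delta>(1)]] by (simp add: r'_kept)
        then show ?thesis using renamed(1-3) by (simp add: r'_new)
      qed
    qed
  qed
  then show ?thesis unfolding ranked_def by blast
qed

lemma Q_members:
  "trees R = trees P" "set (trees R) \<subseteq> set (trees Q)" "set (cuts R) \<subseteq> set (cuts Q)"
  "i < length tE \<Longrightarrow> E \<in> set (trees R) \<Longrightarrow> subst_tree (\<theta> i) E \<in> set (trees Q)"
  "i < length tE \<Longrightarrow> C \<in> set (cuts R) \<Longrightarrow> subst_cut (\<theta> i) C \<in> set (cuts Q)"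
  "i < length tE \<Longrightarrow> F \<in> set Fs \<Longrightarrow> mk_cut (snd (tE ! i)) (subst_tree (\<theta> i) F) \<in> set (cuts Q)"
  by (auto simp: Q_def trees_R)

text \<open>
  The proof applies validity of \<open>P\<close> twice, first in the given valuation \<open>v\<close> to find an index
  \<open>i\<close>, and then in \<open>v\<close> composed with \<open>\<theta> i\<close> to find a universal side.
\<close>

lemma tautology_Q: "tautology (dp_proof Q)"
  unfolding tautology_dp_proof
proof (rule allI, rule ccontr)
  fix v
  assume "\<not> ((\<exists>E\<in>set (trees Q). prop_eval v (dp E)) \<or> (\<exists>C\<in>set (cuts Q). prop_eval v (dp_cut C)))"
  then have no_tree: "\<And>E. E \<in> set (trees Q) \<Longrightarrow> \<not> prop_eval v (dp E)"
    and no_cut: "\<And>C. C \<in> set (cuts Q) \<Longrightarrow> \<not> prop_eval v (dp_cut C)" by blast+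
  have displayed: "\<exists>tEs \<alpha> F. (tEs, \<alpha>, F) \<in> set D \<and> prop_eval w (dp (EEx A tEs)) \<and> prop_eval w (dp F)"
    if R_false: "\<And>E. E \<in> set (trees R) \<Longrightarrow> \<not> prop_eval w (dp E)"
      "\<And>C. C \<in> set (cuts R) \<Longrightarrow> \<not> prop_eval w (dp_cut C)" for w
  proof -
    obtain C where C: "C \<in> set (cuts P)" "prop_eval w (dp_cut C)"
      using P_facts(4) R_false(1) unfolding tautology_dp_proof trees_R by blast
    then have "C \<in> (\<lambda>(tEs, \<alpha>, F). (EEx A tEs, EAll (dual A) \<alpha> F)) ` set D"
      using R_false(2) unfolding set_cuts_P by blast
    then obtain tEs \<alpha> F where "(tEs, \<alpha>, F) \<in> set D" "C = (EEx A tEs, EAll (dual A) \<alpha> F)"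
      by auto
    moreover from this have "prop_eval w (dp (EEx A tEs)) \<and> prop_eval w (dp F)"
      using C(2) by (simp add: dp_cut_def del: dp.simps(4))
    ultimately show ?thesis by blast
  qed
  obtain tEs \<alpha> F where d: "(tEs, \<alpha>, F) \<in> set D" and v: "prop_eval v (dp (EEx A tEs))"
    using displayed[of v] no_tree no_cut Q_members(2,3) by blast
  obtain t E where tE': "(t, E) \<in> set tEs" "prop_eval v (dp E)"
    using v D_facts(1)[OF d] by (auto simp: prop_eval_dp_EEx simp del: dp.simps)
  obtain i where i: "i < length tE" "tE ! i = (t, E)"
    using tE_index[OF d tE'(1)] by blast
  let ?w = "\<lambda>p ts. v p (map (subst_tm (\<theta> i)) ts)"
  have "\<not> prop_eval ?w (dp E')" if E': "E' \<in> set (trees R)" for E'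
  proof -
    have "expansion_tree E'" using P_facts(1) E' by (simp add: well_formed_def trees_R)
    then show ?thesis
      using no_tree[OF Q_members(4)[OF i(1) E']] by (simp add: prop_eval_dp_subst)
  qed
  moreover have "\<not> prop_eval ?w (dp_cut C)" if C: "C \<in> set (cuts R)" for C
  proof -
    have "expansion_tree (fst C)" "expansion_tree (snd C)"
      using R_cuts[OF C] by (simp_all add: is_cut_def)
    then show ?thesis
      using no_cut[OF Q_members(5)[OF i(1) C]]
      by (simp add: dp_cut_def subst_cut_def prop_eval_dp_subst)
  qed
  ultimately obtain tEs' \<alpha>' F' where d': "(tEs', \<alpha>', F') \<in> set D" and F': "prop_eval ?w (dp F')"
    using displayed[of ?w] by blast
  then have "F' \<in> set Fs" by (force simp: Fs_def)
  moreover have "prop_eval v (dp (subst_tree (\<theta> i) F'))"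
    using F' D_facts(3)[OF d'] by (simp add: prop_eval_dp_subst)
  ultimately show False
    using no_cut[OF Q_members(6)[OF i(1)]] tE'(2) i(2) by (simp add: prop_eval_mk_cut)
qed

lemma set_sh_Q: "set (sh_proof Q) = set (sh_proof P)"
proof -
  have "sh (subst_tree (\<theta> i) E) = sh E" if "i < length tE" "E \<in> set (trees P)" for i E
  proof -
    have "\<beta> \<notin> X \<union> Y" if "\<beta> \<in> fv_fm (sh E)" for \<beta>
      using that \<open>E \<in> set (trees P)\<close> P_facts(5)[of \<beta> "sh E"] X_eigenvars Y_eigenvars
      by (auto simp: sh_proof_def)
    then have "subst_fm (\<theta> i) (sh E) = sh E"
      using \<theta>_simps(3)[OF that(1)] by (intro subst_fm_ident) blast
    then show ?thesis by (simp add: sh_subst)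
  qed
  then have "sh ` set (trees Q) \<subseteq> sh ` set (trees P)"
    by (auto simp: trees_R elim!: trees_Q_cases)
  moreover have "sh ` set (trees P) \<subseteq> sh ` set (trees Q)"
    using Q_members(1,2) by auto
  ultimately show ?thesis by (simp add: sh_proof_def subset_antisym)
qed

lemma eigenvar_condition_Q:
  assumes "\<gamma> \<in> eigenvars_proof Q" "G \<in> set (sh_proof Q)"
  shows "\<gamma> \<notin> fv_fm G"
proof -
  have G: "G \<in> set (sh_proof P)" using assms(2) by (simp add: set_sh_Q)
  have "fv_fm G \<subseteq> vars_proof P"
    using G fv_sh_vars_tree by (fastforce simp: sh_proof_def vars_proof_def)
  then show ?thesis
    using eigenvars_Q[OF assms(1)] P_facts(5)[OF _ G] \<eta>_facts(2) by blast
qed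

lemma expansion_proof_Q: "expansion_proof Q"
  unfolding expansion_proof_iff
  using well_formed_Q coherent_Q ex_ranked_Q tautology_Q eigenvar_condition_Q by blast

lemma quantifier_step_Q: "quantifier_step P Q"
proof (rule quantifier_step.intros)
  let ?ren = "\<lambda>i. subst_tree (var_renaming (\<eta> ! i))"
  let ?ren_cut = "\<lambda>i. subst_cut (var_renaming (\<eta> ! i))"
  let ?\<sigma> = "\<lambda>i. subst_all X (fst (tE ! i))"
  have comp: "subst_tree (?\<sigma> i) (?ren i E) = subst_tree (\<theta> i) E" for i E
    by (simp add: subst_tree_renaming_comp \<theta>_def)
  have comp_cut: "subst_cut (?\<sigma> i) (?ren_cut i C) = subst_cut (\<theta> i) C" for i C
    by (simp add: subst_cut_def comp)
  have adm: "admissible (?\<sigma> i) (?ren i E) \<longleftrightarrow> admissible (\<theta> i) E" for i E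
    by (simp add: admissible_renaming \<theta>_def)
  have adm_cut: "admissible_cut (?\<sigma> i) (?ren_cut i C) \<longleftrightarrow> admissible_cut (\<theta> i) C" for i C
    by (simp add: admissible_cut_def subst_cut_def adm)
  show "D \<noteq> []" by (rule D_ne)
  show "mset (cuts P) = mset (map (\<lambda>(tEs, \<alpha>, F). (EEx A tEs, EAll (dual A) \<alpha> F)) D @ cuts R)"
    by (rule mset_P)
  show "mset (trees P) = mset (trees R)" by (simp add: trees_R)
  show "tE = concat (map (\<lambda>(tEs, \<alpha>, F). tEs) D)" by (rule tE_def)
  show "X = set (map (\<lambda>(tEs, \<alpha>, F). \<alpha>) D)" by (rule X_def)
  show "Fs = map (\<lambda>(tEs, \<alpha>, F). F) D" by (rule Fs_def)
  show "X \<inter> eigenvars_proof R = {}" by (rule X_not_R)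
  show "\<forall>C\<in>set (cuts R). sh_cut C \<noteq> Ex A" using rest by blast
  show "length \<eta> = length tE" by (rule length_\<eta>)
  show "fresh_renamings (vars_proof P)
      (dependents P X \<inter> (eigenvars_proof R \<union> (\<Union>F\<in>set Fs. eigenvars F))) \<eta>"
    using fresh unfolding Y_def .
  show "?ren = ?ren" "?ren_cut = ?ren_cut" "?\<sigma> = ?\<sigma>" by (rule refl)+
  show "\<forall>i<length tE. (\<forall>F\<in>set Fs. admissible (?\<sigma> i) (?ren i F)) \<and>
      (\<forall>C\<in>set (cuts R). admissible_cut (?\<sigma> i) (?ren_cut i C)) \<and>
      (\<forall>E\<in>set (trees R). admissible (?\<sigma> i) (?ren i E))"
    unfolding adm adm_cut using admissible_Fs admissible_R_cut admissible_R_tree by blast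
  show "mset (cuts Q) = mset (
      concat (map (\<lambda>i. map (\<lambda>F. mk_cut (snd (tE ! i)) (subst_tree (?\<sigma> i) (?ren i F))) Fs)
        [0..<length tE]) @
      cuts R @ concat (map (\<lambda>i. map (\<lambda>C. subst_cut (?\<sigma> i) (?ren_cut i C)) (cuts R)) [0..<length tE]))"
    unfolding comp comp_cut Q_def by simp
  show "mset (trees Q) = mset (
      trees R @ concat (map (\<lambda>i. map (\<lambda>E. subst_tree (?\<sigma> i) (?ren i E)) (trees R)) [0..<length tE]))"
    unfolding comp Q_def by simp
qed

lemma cut_formulas_Q:
  assumes "B \<in> cut_formulas Q"
  shows "connectives B < connectives (Ex A) \<or> B \<in> cut_formulas P - {Ex A} \<or>
    (\<exists>i<length tE. \<exists>G\<in>cut_formulas P - {Ex A}. B = subst_fm (\<theta> i) G)"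
proof -
  obtain C where C: "C \<in> set (cuts Q)" "B = sh_cut C"
    using assms by (auto simp: cut_formulas_def)
  have R: "sh_cut C' \<in> cut_formulas P - {Ex A}" if "C' \<in> set (cuts R)" for C'
    using that rest R_cuts by (auto simp: cut_formulas_def)
  show ?thesis
    using C(1)
  proof (cases rule: cuts_Q_cases)
    case (reduct i F)
    have "B = sh (snd (tE ! i)) \<or> B = sh (subst_tree (\<theta> i) F)"
      using C(2) reduct(3) sh_cut_mk_cut by metis
    then have "connectives B = connectives A"
      using sh_instance[OF reduct(1,2)] tE_facts(2)[OF reduct(1)] by auto
    then show ?thesis by simp
  next
    case kept
    then have "B \<in> cut_formulas P - {Ex A}" unfolding C(2) by (rule R)
    then show ?thesis by blast
  next
    case (copy i C')
    then have "B = subst_fm (\<theta> i) (sh_cut C')"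
      using C(2) by (simp add: sh_cut_def subst_cut_def sh_subst)
    then show ?thesis using R[OF copy(2)] copy(1) by blast
  qed
qed

text \<open>
  If a moved variable occurred in a cut formula of maximal complexity, that formula would be
  strictly higher than \<open>\<exists>x A\<close>, against the choice of \<open>\<exists>x A\<close>.
\<close>

lemma reduces_Q:
  assumes r: "ranked r P"
    and max: "\<And>G. G \<in> cut_formulas P \<Longrightarrow> connectives G < connectives (Ex A) \<or>
      connectives G = connectives (Ex A) \<and>
      height r (fv_fm G \<inter> eigenvars_proof P) \<le> height r (fv_fm (Ex A) \<inter> eigenvars_proof P)"
  shows "reduces (Ex A) P Q"
proof -
  have "B \<in> cut_formulas P - {Ex A} \<or> connectives B < connectives (Ex A)" if B: "B \<in> cut_formulas Q" for B
    using cut_formulas_Q[OF B]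
  proof (elim disjE)
    assume "\<exists>i<length tE. \<exists>G\<in>cut_formulas P - {Ex A}. B = subst_fm (\<theta> i) G"
    then obtain i G where i: "i < length tE" and G: "G \<in> cut_formulas P - {Ex A}" "B = subst_fm (\<theta> i) G"
      by blast
    show ?thesis
    proof (cases "connectives G < connectives (Ex A)")
      case True
      then show ?thesis using G(2) by simp
    next
      case False
      then have le: "height r (fv_fm G \<inter> eigenvars_proof P) \<le> height r (fv_fm (Ex A) \<inter> eigenvars_proof P)"
        using max[of G] G(1) by blast
      have "\<beta> \<notin> X \<union> Y" if \<beta>: "\<beta> \<in> fv_fm G" for \<beta>
      proof
        assume XY: "\<beta> \<in> X \<union> Y"
        then have "r \<beta> < height r (fv_fm G \<inter> eigenvars_proof P)"
          using \<beta> X_eigenvars Y_eigenvars finite_eigenvars_proof[of P] by (intro height_greater) auto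
        with le cut_formula_below[OF r XY] show False by simp
      qed
      then have "B = G"
        unfolding G(2) using \<theta>_simps(3)[OF i] by (intro subst_fm_ident) blast
      then show ?thesis using G(1) by simp
    qed
  qed blast+
  then show ?thesis
    unfolding reduces_def cut_reduction_def
    using P expansion_proof_Q quantifier_step_Q set_sh_Q by blast
qed

end

lemma quantifier_reduction_exists:
  assumes P: "expansion_proof P" and r: "ranked r P" and C0: "C0 \<in> set (cuts P)" "sh_cut C0 = Ex A"
    and max: "\<And>G. G \<in> cut_formulas P \<Longrightarrow> connectives G < connectives (Ex A) \<or>
      connectives G = connectives (Ex A) \<and>
      height r (fv_fm G \<inter> eigenvars_proof P) \<le> height r (fv_fm (Ex A) \<inter> eigenvars_proof P)"
  shows "\<exists>Q. reduces (Ex A) P Q"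
proof -
  let ?f = "\<lambda>(tEs, \<alpha>, F). (EEx A tEs, EAll (dual A) \<alpha> F)"
  let ?is = "\<lambda>C. sh_cut C = Ex A"
  have "\<exists>d. C = ?f d" if C: "C \<in> set (cuts P)" "?is C" for C
  proof -
    have "is_cut C" using P C by (simp add: expansion_proof_iff well_formed_def)
    then have "sh (fst C) = Ex A" "sh (snd C) = All (dual A)"
      using C(2) dual_dual[of "sh (snd C)"] by (auto simp: is_cut_def sh_cut_def)
    then obtain tEs \<alpha> F where "fst C = EEx A tEs" "snd C = EAll (dual A) \<alpha> F"
      using sh_ExE sh_AllE by blast
    then have "C = ?f (tEs, \<alpha>, F)" by (simp add: prod_eq_iff)
    then show ?thesis by blast
  qed
  then have "\<exists>D. filter ?is (cuts P) = map ?f D"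
    unfolding ex_map_conv by simp
  then obtain D where D: "filter ?is (cuts P) = map ?f D" ..
  define R where "R = (filter (\<lambda>C. \<not> ?is C) (cuts P), trees P)"
  have "C0 \<in> set (filter ?is (cuts P))" using C0 by simp
  then have "D \<noteq> []" unfolding D by auto
  moreover have "mset (cuts P) = mset (map ?f D @ cuts R)"
    using mset_filter_split[of "cuts P" ?is] by (simp add: D R_def)
  ultimately have "quantifier_cuts P R A D"
    using P by (simp add: quantifier_cuts_def R_def)
  then interpret quantifier_cuts P R A D .
  have "finite Y" using Y_eigenvars finite_eigenvars_proof by (rule finite_subset)
  then obtain \<eta> where "length \<eta> = length tE" "fresh_renamings (vars_proof P) Y \<eta>"
    using ex_fresh_renamings[OF finite_vars_proof] by blast
  then interpret quantifier_reduction P R A D \<eta> by unfold_locales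
  show ?thesis using reduces_Q[OF r max] by blast
qed

section \<open>Termination\<close>

text \<open>
  Disjunctions can be reduced in any order, because a propositional step leaves all other cut
  formulas unchanged.  Existential formulas need the choice by height, and it is made only once no
  disjunction of maximal complexity is left, so that every competitor is existential.
\<close>

lemma max_cut_reducible:
  assumes P: "expansion_proof P" and B: "B \<in> cut_formulas P" "connectives B = Suc n"
    and max: "\<And>G. G \<in> cut_formulas P \<Longrightarrow> connectives G \<le> Suc n"
  shows "\<exists>A Q. A \<in> cut_formulas P \<and> connectives A = Suc n \<and> reduces A P Q"
proof -
  let ?M = "{G \<in> cut_formulas P. connectives G = Suc n}"
  have positive: "positive G" if "G \<in> cut_formulas P" for G
    using that P by (auto simp: cut_formulas_def expansion_proof_iff well_formed_def is_cut_def sh_cut_def)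
  show ?thesis
  proof (cases "\<exists>G H. Or G H \<in> ?M")
    case True
    then obtain G H where M: "Or G H \<in> ?M" by blast
    then obtain C where "C \<in> set (cuts P)" "sh_cut C = Or G H"
      by (force simp: cut_formulas_def)
    then have "\<exists>Q. reduces (Or G H) P Q" by (rule propositional_reduction[OF P])
    with M show ?thesis by blast
  next
    case False
    have Ex: "\<exists>A. G = Ex A" if "G \<in> ?M" for G
      using that False positive[of G] by (cases G) auto
    obtain r where r: "ranked r P" using P by (auto simp: expansion_proof_iff)
    \<comment> \<open>An \<open>\<exists>\<close>-formula whose highest-ranked eigenvariable has the greatest rank possible.\<close>
    let ?h = "\<lambda>G. height r (fv_fm G \<inter> eigenvars_proof P)"
    have fin: "finite ?M" by (simp add: cut_formulas_def)
    then have "Max (?h ` ?M) \<in> ?h ` ?M" using B by (intro Max_in) auto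
    then obtain G where G: "G \<in> ?M" "?h G = Max (?h ` ?M)" by force
    obtain A where A: "G = Ex A" using Ex[OF G(1)] by blast
    obtain C where C: "C \<in> set (cuts P)" "sh_cut C = Ex A" using G(1) A by (auto simp: cut_formulas_def)
    have "\<exists>Q. reduces (Ex A) P Q"
    proof (rule quantifier_reduction_exists[OF P r C])
      fix H
      assume H: "H \<in> cut_formulas P"
      show "connectives H < connectives (Ex A) \<or> connectives H = connectives (Ex A) \<and> ?h H \<le> ?h (Ex A)"
      proof (cases "connectives H = Suc n")
        case True
        then have "?h H \<le> ?h G" unfolding G(2) using H fin by (intro Max_ge) auto
        then show ?thesis using True G(1) A by simp
      next
        case False
        then show ?thesis using max[OF H] G(1) A by simp
      qed
    qed
    then show ?thesis using G(1) A by blast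
  qed
qed

definition normalizes :: "('f, 'p) eproof \<Rightarrow> bool" where
  "normalizes P \<longleftrightarrow> (\<exists>Q. expansion_proof Q \<and> cuts Q = [] \<and> cut_reduction\<^sup>*\<^sup>* P Q \<and>
     set (sh_proof P) = set (sh_proof Q))"

lemma normalizes_step:
  assumes "cut_reduction P Q" "set (sh_proof Q) = set (sh_proof P)" "normalizes Q"
  shows "normalizes P"
  using assms unfolding normalizes_def by (metis converse_rtranclp_into_rtranclp)

text \<open>
  An atomic step removes a single cut, so for atomic cuts it is the number of cuts that decreases
  and not the number of distinct cut formulas.
\<close>

lemma atomic_normalizes:
  assumes "expansion_proof P" "\<And>G. G \<in> cut_formulas P \<Longrightarrow> connectives G = 0"
  shows "normalizes P"
  using assms
proof (induction "length (cuts P)" arbitrary: P)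
  case 0
  then have "cuts P = []" by simp
  with 0(2) show ?case unfolding normalizes_def by blast
next
  case (Suc m)
  then obtain C where C: "C \<in> set (cuts P)" by (cases "cuts P") auto
  then have "connectives (sh_cut C) = 0"
    using Suc.prems(2) by (simp add: cut_formulas_def)
  then obtain b p ts where "sh_cut C = Lit b p ts" by (cases "sh_cut C") auto
  then obtain Q where Q: "cut_reduction P Q" "set (sh_proof Q) = set (sh_proof P)"
      "mset (cuts P) = add_mset C (mset (cuts Q))"
    using atomic_reduction[OF Suc.prems(1) C] by blast
  have "length (cuts P) = Suc (length (cuts Q))"
    using arg_cong[OF Q(3), of size] by simp
  moreover have "cut_formulas Q \<subseteq> cut_formulas P"
    using arg_cong[OF Q(3), of set_mset] by (auto simp: cut_formulas_def)
  moreover have "expansion_proof Q" using Q(1) by (simp add: cut_reduction_def)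
  ultimately have "normalizes Q"
    using Suc.hyps(1)[of Q] Suc.hyps(2) Suc.prems(2) by auto
  with Q show ?case by (intro normalizes_step[of P Q])
qed

lemma bounded_normalizes:
  assumes "expansion_proof P" "\<And>G. G \<in> cut_formulas P \<Longrightarrow> connectives G \<le> n"
  shows "normalizes P"
  using assms
proof (induction n arbitrary: P)
  case 0
  then show ?case by (intro atomic_normalizes) auto
next
  case (Suc n)
  let ?M = "\<lambda>P. {G \<in> cut_formulas P. connectives G = Suc n}"
  from Suc.prems show ?case
  proof (induction "card (?M P)" arbitrary: P rule: less_induct)
    case less
    show ?case
    proof (cases "?M P = {}")
      case True
      then have "connectives G \<le> n" if "G \<in> cut_formulas P" for G
        using that less.prems(2)[OF that] by (auto simp: le_Suc_eq)
      then show ?thesis using Suc.IH less.prems(1) by blast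
    next
      case False
      then obtain B where "B \<in> cut_formulas P" "connectives B = Suc n" by blast
      then obtain A Q where A: "A \<in> ?M P" and Q: "reduces A P Q"
        using max_cut_reducible[OF less.prems(1) _ _ less.prems(2)] by blast
      have step: "cut_reduction P Q" "set (sh_proof Q) = set (sh_proof P)"
        and new: "\<And>B. B \<in> cut_formulas Q \<Longrightarrow> B \<in> cut_formulas P - {A} \<or> connectives B < Suc n"
        using Q A by (auto simp: reduces_def)
      have "?M Q \<subseteq> ?M P - {A}" using new by fastforce
      then have "?M Q \<subset> ?M P" using A by blast
      then have "card (?M Q) < card (?M P)"
        by (intro psubset_card_mono) (simp_all add: cut_formulas_def)
      moreover have "expansion_proof Q" using step(1) by (simp add: cut_reduction_def)
      moreover have "connectives G \<le> Suc n" if "G \<in> cut_formulas Q" for G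
        using new[OF that] less.prems(2)[of G] by auto
      ultimately have "normalizes Q" by (rule less.hyps)
      with step show ?thesis by (rule normalizes_step)
    qed
  qed
qed

theorem theorem6:
  fixes Q :: "('f, 'p) eproof"
  assumes "expansion_proof Q"
  shows "\<exists>Q'. expansion_proof Q' \<and> cuts Q' = [] \<and>
           cut_reduction\<^sup>*\<^sup>* Q Q' \<and> set (sh_proof Q) = set (sh_proof Q')"
proof -
  have "finite (connectives ` cut_formulas Q)" by (simp add: cut_formulas_def)
  then have "connectives G \<le> Max (connectives ` cut_formulas Q)" if "G \<in> cut_formulas Q" for G
    using that by simp
  with assms have "normalizes Q" by (rule bounded_normalizes)
  then show ?thesis unfolding normalizes_def .
qed

end
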